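(* Let $\mathscr{H}$ be a closed subspace of $L^2(G)$, let $\psi\in L^2(G)$, and suppose that the affine system $\mathcal{A}_{\Gamma,H}(\psi)=\{D(h)T(\gamma)\psi : \gamma\in\Gamma,\ h\in H\}$ is a $\varsigma$-frame of $\mathscr{H}$ with constants $0<A\le B<\infty$. Suppose that $\{\widehat{\alpha}_h\}_{h\in H}$ is a measurably bi-Lipschitz family of automorphisms of $\widehat{G}$, with upper Lipschitz constants $\{L(h)\}_{h\in H}$, which has Property X for $\Gamma^\perp$. If there exist $M>0$, $\epsilon_0>0$ and a set $\mathcal{O}$ of $\nu_{\widehat{G}}$-measure zero such that $$\Psi_M(\xi)=\int_{H_M^c}|\widehat{D}(h)\widehat{\psi}(\xi)|^2\,d\varsigma(h)=\int_{H_M^c}\delta(h)\,|\widehat{\psi}(\widehat{\alpha}_h(\xi))|^2\,d\varsigma(h)\ \in\ L^1_{\mathrm{loc}}\big(\widehat{\mathcal{G}}^{\,\mathscr{H}}_{\epsilon_0}\setminus\mathcal{O}\big),$$ where $H_M^c=\{h\in H: L(h)>M\}$, then $$A\le \mathcal{C}_\psi(\xi)\le B\qquad\text{for }\nu_{\widehat{G}}\text{-a.e. }\xi\in\widehat{\mathcal{G}}^{\,\mathscr{H}}_{\epsilon_0}.$$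
   Context: Groups and measures. $G$ is a locally compact second countable abelian group (written additively) with a fixed Haar measure $\mu_G$; $\widehat{G}$ is its dual group with identity $\mathrm{e}$ and pairing $\langle\xi,x\rangle\in\mathbb{T}$; $\widehat{f}(\xi)=\int_G f(x)\overline{\langle\xi,x\rangle}\,d\mu_G(x)$; $\nu_{\widehat{G}}$ is the Haar measure on $\widehat{G}$ making $f\mapsto\widehat f$ unitary from $L^2(G)$ to $L^2(\widehat{G})$. $\Gamma$ is a closed cocompact subgroup of $G$, and $\Gamma^\perp=\{\lambda\in\widehat{G}:\langle\lambda,\gamma\rangle=1\ \forall\gamma\in\Gamma\}$ is its annihilator (discrete and countable). The Haar measure $\mu_\Gamma$ on $\Gamma$ is normalized so that $\int_G f\,d\mu_G=\int_\Gamma\int_{G/\Gamma}f(y+\gamma)\,d\kappa(y)\,d\mu_\Gamma(\gamma)$, where $\kappa$ is the Haar probability measure on $G/\Gamma$. Metric. $\widehat{G}$ carries a translation-invariant metric $d_{\widehat{G}}$ inducing its topology, whose closed balls are compact, with open balls $B(\xi_0,r)$, and which is weakly doubling: there are $r_0>0$, $C>0$ with $\nu_{\widehat{G}}(B(\mathrm{e},2r))\le C\,\nu_{\widehat{G}}(B(\mathrm{e},r))$ for all $r<r_0$. Automorphisms. $\varsigma$ is a $\sigma$-finite Borel measure on $H$, and $\alpha:H\to\mathrm{Aut}(G)$ is such that $(x,h)\mapsto\alpha_h(x)$ is measurable on $(G,\mu_G)\times(H,\varsigma)$. $\delta:H\to\mathbb{R}^+$ is the measurable function with $\int_G f(\alpha_h(x))\,d\mu_G(x)=\delta(h)\int_G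 f\,d\mu_G$ for $f\in L^1(G)$. The dual automorphism $\widehat{\alpha}_h\in\mathrm{Aut}(\widehat{G})$ is defined by $\langle\widehat{\alpha}_h(\xi),x\rangle=\langle\xi,\alpha_h^{-1}(x)\rangle$. The family $\{\widehat{\alpha}_h\}$ is measurably bi-Lipschitz if there are $\varsigma$-measurable $\ell,L:H\to\mathbb{R}^+$ with $\ell(h)d_{\widehat{G}}(\xi,\mathrm{e})\le d_{\widehat{G}}(\widehat{\alpha}_h(\xi),\mathrm{e})\le L(h)d_{\widehat{G}}(\xi,\mathrm{e})$ for all $\xi\in\widehat{G}$, $h\in H$. Property X for $\Gamma^\perp$: there exist $r>0$, $M>0$, $C>0$ such that $\sharp(\Gamma^\perp\cap\widehat{\alpha}_hB(\mathrm{e},r))\le 1+C\,\delta(h)$ for all $h\in H$ with $L(h)>M$. Operators and frames. $T(\gamma)f(x)=f(x-\gamma)$, $D(h)f(x)=\delta(h)^{-1/2}f(\alpha_h(x))$, and $\widehat{D}(h)\widehat f=\widehat{D(h)f}$, i.e. $\widehat{D}(h)\widehat f(\xi)=\delta(h)^{1/2}\widehat f(\widehat{\alpha}_h(\xi))$. $\mathcal{A}_{\Gamma,H}(\psi)$ is a $\varsigma$-frame of $\mathscr{H}$ with constants $A,B$ if $\mathcal{A}_{\Gamma,H}(\psi)\subset\mathscr{H}$ and $A\|f\|^2\le\int_H\int_\Gamma|\langle f,D(h)T(\gamma)\psi\rangle_{L^2(G)}|^2d\mu_\Gamma(\gamma)d\varsigma(h)\le B\|f\|^2$ for all $f\in\mathscr{H}$.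 Calderón sum: $\mathcal{C}_\psi(\xi)=\int_H|\widehat{\psi}(\widehat{\alpha}_h(\xi))|^2d\varsigma(h)$. With $\widehat{\mathscr{H}}=\{\widehat f:f\in\mathscr{H}\}$ and $\chi_E$ the characteristic function of $E$, $\widehat{\mathcal{G}}^{\,\mathscr{H}}_{\epsilon_0}=\{\xi\in\widehat{G}:\chi_{B(\xi,\epsilon)}\in\widehat{\mathscr{H}}\ \text{for all }0<\epsilon<\epsilon_0\}$; it is assumed to have positive $\nu_{\widehat{G}}$-measure. A nonnegative measurable $F$ on $\widehat{G}$ is in $L^1_{\mathrm{loc}}(S)$, $S\subset\widehat{G}$, if every $\xi_0\in S$ has some $\epsilon>0$ with $\int_{B(\xi_0,\epsilon)}F\,d\nu_{\widehat{G}}<\infty$. *)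

theory Defs
  imports "HOL-Probability.Probability_Measure" "HOL-Library.Set_Algebras"
begin

section \<open>Haar measures, subgroups and quotients\<close>

text \<open>
  The operation is the ambient \<open>(+)\<close>, restricted to \<open>topspace X\<close>. The definition is used for
  whole types, for subgroups (with the subspace topology) and for quotient groups (the elements
  are cosets, and \<open>(+)\<close> is the addition of sets from \<open>HOL-Library.Set_Algebras\<close>). All groups that
  occur are second countable and locally compact, so that regularity is automatic.
\<close>

definition haar_measure :: "'a::plus topology \<Rightarrow> 'a measure \<Rightarrow> bool" where
  "haar_measure X M \<longleftrightarrow>
     space M = topspace X \<and>
     sets M = sigma_sets (topspace X) {U. openin X U} \<and>
     (\<forall>a\<in>topspace X. distr M M ((+) a) = M) \<and>
     (\<forall>K. compactin X K \<longrightarrow> emeasure M K < \<infinity>) \<and>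
     (\<forall>U. openin X U \<and> U \<noteq> {} \<longrightarrow> 0 < emeasure M U)"

definition closed_subgroup :: "'g::{topological_space, group_add} set \<Rightarrow> bool" where
  "closed_subgroup \<Gamma> \<longleftrightarrow> closed \<Gamma> \<and> 0 \<in> \<Gamma> \<and> (\<forall>x\<in>\<Gamma>. \<forall>y\<in>\<Gamma>. x - y \<in> \<Gamma>)"

definition coset_topology :: "'g::{topological_space, plus} set \<Rightarrow> 'g set topology" where
  "coset_topology \<Gamma> =
     topology (\<lambda>U. U \<subseteq> range (\<lambda>x. x +o \<Gamma>) \<and> open {x. x +o \<Gamma> \<in> U})"

lemma openin_coset_topology:
  "openin (coset_topology \<Gamma>) U \<longleftrightarrow> U \<subseteq> range (\<lambda>x. x +o \<Gamma>) \<and> open {x. x +o \<Gamma> \<in> U}"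
proof -
  have "istopology (\<lambda>U. U \<subseteq> range (\<lambda>x. x +o \<Gamma>) \<and> open {x. x +o \<Gamma> \<in> U})"
    unfolding istopology_def
  proof (intro conjI allI impI)
    fix S T :: "'a set set"
    assume "S \<subseteq> range (\<lambda>x. x +o \<Gamma>) \<and> open {x. x +o \<Gamma> \<in> S}"
      and "T \<subseteq> range (\<lambda>x. x +o \<Gamma>) \<and> open {x. x +o \<Gamma> \<in> T}"
    then show "S \<inter> T \<subseteq> range (\<lambda>x. x +o \<Gamma>)" "open {x. x +o \<Gamma> \<in> S \<inter> T}"
      by (auto simp: Collect_conj_eq)
  next
    fix \<K> :: "'a set set set"
    assume *: "\<forall>K\<in>\<K>. K \<subseteq> range (\<lambda>x. x +o \<Gamma>) \<and> open {x. x +o \<Gamma> \<in> K}"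
    have "{x. x +o \<Gamma> \<in> \<Union>\<K>} = (\<Union>K\<in>\<K>. {x. x +o \<Gamma> \<in> K})"
      by blast
    with * show "\<Union>\<K> \<subseteq> range (\<lambda>x. x +o \<Gamma>)" "open {x. x +o \<Gamma> \<in> \<Union>\<K>}"
      by auto
  qed
  then show ?thesis
    by (simp add: coset_topology_def topology_inverse')
qed

lemma topspace_coset_topology: "topspace (coset_topology \<Gamma>) = range (\<lambda>x. x +o \<Gamma>)"
proof
  show "topspace (coset_topology \<Gamma>) \<subseteq> range (\<lambda>x. x +o \<Gamma>)"
    using openin_topspace openin_coset_topology by blast
  have "openin (coset_topology \<Gamma>) (range (\<lambda>x. x +o \<Gamma>))"
    by (simp add: openin_coset_topology)
  then show "range (\<lambda>x. x +o \<Gamma>) \<subseteq> topspace (coset_topology \<Gamma>)"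
    by (rule openin_subset)
qed

text \<open>
  Weil's formula \<open>\<integral>\<^sub>G f = \<integral>\<^sub>G\<^sub>/\<^sub>\<Gamma> \<integral>\<^sub>\<Gamma> f (y + \<gamma>)\<close> for nonnegative Borel functions. The inner integral
  over \<open>\<Gamma>\<close> does not depend on the representative \<open>y\<close> of the coset \<open>c\<close>, by invariance of \<open>\<mu>\<Gamma>\<close>.
\<close>

definition weil_formula ::
    "'g::{topological_space, plus} measure \<Rightarrow> 'g measure \<Rightarrow> 'g set measure \<Rightarrow> bool" where
  "weil_formula \<mu> \<mu>\<Gamma> \<kappa> \<longleftrightarrow>
     (\<forall>f\<in>borel_measurable borel.
        (\<integral>\<^sup>+x. f x \<partial>\<mu>) = (\<integral>\<^sup>+c. (\<integral>\<^sup>+\<gamma>. f ((SOME y. y \<in> c) + \<gamma>) \<partial>\<mu>\<Gamma>) \<partial>\<kappa>))"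


section \<open>The dual group\<close>

typedef (overloaded) ('g::topological_ab_group_add) dual_group =
  "{u. continuous_on UNIV (u :: 'g \<Rightarrow> complex) \<and> (\<forall>x. cmod (u x) = 1) \<and>
      (\<forall>x y. u (x + y) = u x * u y)}"
  morphisms pairing Abs_dual_group
  by (rule exI[of _ "\<lambda>_. 1"]) simp

setup_lifting type_definition_dual_group

text \<open>The group law is pointwise multiplication, written additively; \<open>0\<close> is the trivial character.\<close>

instantiation dual_group :: (topological_ab_group_add) ab_group_add
begin

lift_definition zero_dual_group :: "'a dual_group" is "\<lambda>_. 1"
  by simp

lift_definition plus_dual_group :: "'a dual_group \<Rightarrow> 'a dual_group \<Rightarrow> 'a dual_group"
  is "\<lambda>\<xi> \<eta> x. \<xi> x * \<eta> x"
  by (auto intro!: continuous_intros simp: norm_mult)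

lift_definition uminus_dual_group :: "'a dual_group \<Rightarrow> 'a dual_group" is "\<lambda>\<xi> x. cnj (\<xi> x)"
  by (auto intro!: continuous_intros)

definition minus_dual_group :: "'a dual_group \<Rightarrow> 'a dual_group \<Rightarrow> 'a dual_group" where
  "\<xi> - \<eta> = \<xi> + - \<eta>" for \<xi> \<eta> :: "'a dual_group"

instance
proof
  fix a b c :: "'a dual_group"
  show "a + b + c = a + (b + c)" by transfer (simp add: mult.assoc)
  show "a + b = b + a" by transfer (simp add: mult.commute)
  show "0 + a = a" by transfer simp
  show "- a + a = 0"
  proof transfer
    fix u :: "'a \<Rightarrow> complex"
    assume "continuous_on UNIV u \<and> (\<forall>x. cmod (u x) = 1) \<and> (\<forall>x y. u (x + y) = u x * u y)"
    then have "cmod (u x) = 1" for x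
      by blast
    then show "(\<lambda>x. cnj (u x) * u x) = (\<lambda>_. 1)"
      by (metis complex_norm_square mult.commute of_real_1 one_power2)
  qed
  show "a - b = a + - b" by (rule minus_dual_group_def)
qed

end

text \<open>The compact-open topology.\<close>

instantiation dual_group :: (topological_ab_group_add) topological_space
begin

definition open_dual_group :: "'a dual_group set \<Rightarrow> bool" where
  "open_dual_group =
     generate_topology {{\<xi>. pairing \<xi> ` K \<subseteq> U} | K U. compact K \<and> open U}"

instance
  by standard
    (auto simp: open_dual_group_def intro: generate_topology.UNIV generate_topology.Int
      generate_topology.UN)

end

definition annihilator :: "'g::topological_ab_group_add set \<Rightarrow> 'g dual_group set" where
  "annihilator \<Gamma> = {\<xi>. \<forall>\<gamma>\<in>\<Gamma>. pairing \<xi> \<gamma> = 1}"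


section \<open>Square integrable functions and the Fourier transform\<close>

text \<open>
  Elements of \<open>L\<^sup>2\<close> are represented by functions; a subspace of \<open>L\<^sup>2\<close> is then a set of functions
  that is closed under changes on null sets.
\<close>

definition L2 :: "'a measure \<Rightarrow> ('a \<Rightarrow> complex) set" where
  "L2 M = {f \<in> borel_measurable M. integrable M (\<lambda>x. (cmod (f x))\<^sup>2)}"

definition norm_L2 :: "'a measure \<Rightarrow> ('a \<Rightarrow> complex) \<Rightarrow> real" where
  "norm_L2 M f = sqrt (LINT x|M. (cmod (f x))\<^sup>2)"

definition inner_L2 :: "'a measure \<Rightarrow> ('a \<Rightarrow> complex) \<Rightarrow> ('a \<Rightarrow> complex) \<Rightarrow> complex" where
  "inner_L2 M f g = (LINT x|M. f x * cnj (g x))"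

definition tendsto_L2 :: "'a measure \<Rightarrow> (nat \<Rightarrow> 'a \<Rightarrow> complex) \<Rightarrow> ('a \<Rightarrow> complex) \<Rightarrow> bool" where
  "tendsto_L2 M u f \<longleftrightarrow> (\<lambda>n. \<integral>\<^sup>+x. ennreal ((cmod (u n x - f x))\<^sup>2) \<partial>M) \<longlonglongrightarrow> 0"

text \<open>Constant sequences in the last clause give closure under changes on null sets.\<close>

definition closed_subspace_L2 :: "'a measure \<Rightarrow> ('a \<Rightarrow> complex) set \<Rightarrow> bool" where
  "closed_subspace_L2 M S \<longleftrightarrow>
     S \<subseteq> L2 M \<and>
     (\<lambda>_. 0) \<in> S \<and>
     (\<forall>f\<in>S. \<forall>g\<in>S. (\<lambda>x. f x + g x) \<in> S) \<and>
     (\<forall>c. \<forall>f\<in>S. (\<lambda>x. c * f x) \<in> S) \<and>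
     (\<forall>u f. (\<forall>n. u n \<in> S) \<and> f \<in> L2 M \<and> tendsto_L2 M u f \<longrightarrow> f \<in> S)"

definition fourier ::
    "'g::topological_ab_group_add measure \<Rightarrow> ('g \<Rightarrow> complex) \<Rightarrow> 'g dual_group \<Rightarrow> complex" where
  "fourier \<mu> f \<xi> = (LINT x|\<mu>. f x * cnj (pairing \<xi> x))"

text \<open>
  \<open>is_fourier_L2 \<mu> \<nu> f g\<close>: the function \<open>g\<close> represents the Fourier transform of \<open>f \<in> L\<^sup>2\<close>,
  the continuous extension of \<open>fourier\<close> from \<open>L\<^sup>1 \<inter> L\<^sup>2\<close>.
\<close>

definition is_fourier_L2 ::
    "'g::topological_ab_group_add measure \<Rightarrow> 'g dual_group measure \<Rightarrow>
      ('g \<Rightarrow> complex) \<Rightarrow> ('g dual_group \<Rightarrow> complex) \<Rightarrow> bool" where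
  "is_fourier_L2 \<mu> \<nu> f g \<longleftrightarrow>
     f \<in> L2 \<mu> \<and> g \<in> L2 \<nu> \<and>
     (\<exists>u. (\<forall>n. integrable \<mu> (u n) \<and> u n \<in> L2 \<mu>) \<and>
          tendsto_L2 \<mu> u f \<and> tendsto_L2 \<nu> (\<lambda>n. fourier \<mu> (u n)) g)"

text \<open>
  The Haar measure for which the Fourier transform is unitary: it is isometric on the dense
  subspace \<open>L\<^sup>1 \<inter> L\<^sup>2\<close>, and its extension to \<open>L\<^sup>2\<close> is onto.
\<close>

definition plancherel_measure ::
    "'g::topological_ab_group_add measure \<Rightarrow> 'g dual_group measure \<Rightarrow> bool" where
  "plancherel_measure \<mu> \<nu> \<longleftrightarrow>
     haar_measure euclidean \<nu> \<and>
     (\<forall>f. integrable \<mu> f \<and> f \<in> L2 \<mu> \<longrightarrow>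
        fourier \<mu> f \<in> L2 \<nu> \<and> norm_L2 \<nu> (fourier \<mu> f) = norm_L2 \<mu> f) \<and>
     (\<forall>g\<in>L2 \<nu>. \<exists>f. is_fourier_L2 \<mu> \<nu> f g)"

definition fourier_image ::
    "'g::topological_ab_group_add measure \<Rightarrow> 'g dual_group measure \<Rightarrow>
      ('g \<Rightarrow> complex) set \<Rightarrow> ('g dual_group \<Rightarrow> complex) set" where
  "fourier_image \<mu> \<nu> S = {g. \<exists>f\<in>S. is_fourier_L2 \<mu> \<nu> f g}"


section \<open>The metric on the dual group\<close>

definition compatible_metric :: "('a::{topological_space, plus} \<Rightarrow> 'a \<Rightarrow> real) \<Rightarrow> bool" where
  "compatible_metric d \<longleftrightarrow>
     Metric_space UNIV d \<and>
     Metric_space.mtopology UNIV d = euclidean \<and>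
     (\<forall>\<xi> \<eta> \<zeta>. d (\<xi> + \<zeta>) (\<eta> + \<zeta>) = d \<xi> \<eta>) \<and>
     (\<forall>\<xi> r. compact (Metric_space.mcball UNIV d \<xi> r))"

abbreviation dball :: "('a \<Rightarrow> 'a \<Rightarrow> real) \<Rightarrow> 'a \<Rightarrow> real \<Rightarrow> 'a set" where
  "dball d \<equiv> Metric_space.mball UNIV d"

definition weakly_doubling ::
    "'a::zero measure \<Rightarrow> ('a \<Rightarrow> 'a \<Rightarrow> real) \<Rightarrow> bool" where
  "weakly_doubling \<nu> d \<longleftrightarrow>
     (\<exists>r\<^sub>0>0. \<exists>C>0. \<forall>r<r\<^sub>0.
        emeasure \<nu> (dball d 0 (2 * r)) \<le> ennreal C * emeasure \<nu> (dball d 0 r))"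

definition L1_loc ::
    "'a measure \<Rightarrow> ('a \<Rightarrow> 'a \<Rightarrow> real) \<Rightarrow> 'a set \<Rightarrow> ('a \<Rightarrow> ennreal) set" where
  "L1_loc \<nu> d S =
     {F \<in> borel_measurable \<nu>. \<forall>\<xi>\<^sub>0\<in>S. \<exists>\<epsilon>>0. (\<integral>\<^sup>+\<xi>\<in>dball d \<xi>\<^sub>0 \<epsilon>. F \<xi> \<partial>\<nu>) < \<infinity>}"


section \<open>Automorphisms\<close>

definition topological_automorphism ::
    "('g::{topological_space, plus} \<Rightarrow> 'g) \<Rightarrow> bool" where
  "topological_automorphism a \<longleftrightarrow>
     (\<forall>x y. a (x + y) = a x + a y) \<and> bij a \<and>
     continuous_on UNIV a \<and> continuous_on UNIV (inv a)"

definition dual_automorphism ::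
    "('g::topological_ab_group_add \<Rightarrow> 'g) \<Rightarrow> 'g dual_group \<Rightarrow> 'g dual_group" where
  "dual_automorphism a \<xi> = Abs_dual_group (\<lambda>x. pairing \<xi> (inv a x))"

lemma pairing_dual_automorphism:
  assumes "topological_automorphism a"
  shows "pairing (dual_automorphism a \<xi>) x = pairing \<xi> (inv a x)"
proof -
  have add: "inv a (x + y) = inv a x + inv a y" for x y
    using assms unfolding topological_automorphism_def
    by (metis bij_inv_eq_iff)
  have \<xi>: "continuous_on UNIV (pairing \<xi>)" "\<And>x. cmod (pairing \<xi> x) = 1"
    "\<And>x y. pairing \<xi> (x + y) = pairing \<xi> x * pairing \<xi> y"
    using pairing[of \<xi>] by auto
  have "continuous_on UNIV (\<lambda>x. pairing \<xi> (inv a x))"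
    using assms by (auto simp: topological_automorphism_def
        intro: continuous_on_compose2[OF \<xi>(1)])
  then show ?thesis
    unfolding dual_automorphism_def by (subst Abs_dual_group_inverse) (auto simp: \<xi> add)
qed

definition modulus_function ::
    "'g measure \<Rightarrow> 'h measure \<Rightarrow> ('h \<Rightarrow> 'g \<Rightarrow> 'g) \<Rightarrow> ('h \<Rightarrow> real) \<Rightarrow> bool" where
  "modulus_function \<mu> \<sigma> \<alpha> \<delta> \<longleftrightarrow>
     \<delta> \<in> borel_measurable \<sigma> \<and> (\<forall>h. 0 < \<delta> h) \<and>
     (\<forall>h. \<forall>f :: 'g \<Rightarrow> complex. integrable \<mu> f \<longrightarrow>
        integrable \<mu> (\<lambda>x. f (\<alpha> h x)) \<and>
        (LINT x|\<mu>. f (\<alpha> h x)) = complex_of_real (\<delta> h) * (LINT x|\<mu>. f x))"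

definition measurably_bi_lipschitz ::
    "('g::topological_ab_group_add dual_group \<Rightarrow> 'g dual_group \<Rightarrow> real) \<Rightarrow> 'h measure \<Rightarrow>
      ('h \<Rightarrow> 'g \<Rightarrow> 'g) \<Rightarrow> ('h \<Rightarrow> real) \<Rightarrow> ('h \<Rightarrow> real) \<Rightarrow> bool" where
  "measurably_bi_lipschitz d \<sigma> \<alpha> l L \<longleftrightarrow>
     l \<in> borel_measurable \<sigma> \<and> L \<in> borel_measurable \<sigma> \<and> (\<forall>h. 0 < l h \<and> 0 < L h) \<and>
     (\<forall>h \<xi>. l h * d \<xi> 0 \<le> d (dual_automorphism (\<alpha> h) \<xi>) 0 \<and>
             d (dual_automorphism (\<alpha> h) \<xi>) 0 \<le> L h * d \<xi> 0)"

definition property_X ::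
    "('g::topological_ab_group_add dual_group \<Rightarrow> 'g dual_group \<Rightarrow> real) \<Rightarrow>
      ('h \<Rightarrow> 'g \<Rightarrow> 'g) \<Rightarrow> ('h \<Rightarrow> real) \<Rightarrow> ('h \<Rightarrow> real) \<Rightarrow> 'g dual_group set \<Rightarrow> bool" where
  "property_X d \<alpha> \<delta> L \<Lambda> \<longleftrightarrow>
     (\<exists>r>0. \<exists>M>0. \<exists>C>0. \<forall>h. L h > M \<longrightarrow>
        finite (\<Lambda> \<inter> dual_automorphism (\<alpha> h) ` dball d 0 r) \<and>
        real (card (\<Lambda> \<inter> dual_automorphism (\<alpha> h) ` dball d 0 r)) \<le> 1 + C * \<delta> h)"


section \<open>Affine systems\<close>

definition translation :: "'g::minus \<Rightarrow> ('g \<Rightarrow> complex) \<Rightarrow> 'g \<Rightarrow> complex" where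
  "translation \<gamma> f x = f (x - \<gamma>)"

definition dilation ::
    "('h \<Rightarrow> 'g \<Rightarrow> 'g) \<Rightarrow> ('h \<Rightarrow> real) \<Rightarrow> 'h \<Rightarrow> ('g \<Rightarrow> complex) \<Rightarrow> 'g \<Rightarrow> complex" where
  "dilation \<alpha> \<delta> h f x = complex_of_real (\<delta> h powr (- 1/2)) * f (\<alpha> h x)"

definition dual_dilation ::
    "('h \<Rightarrow> 'g::topological_ab_group_add \<Rightarrow> 'g) \<Rightarrow> ('h \<Rightarrow> real) \<Rightarrow> 'h \<Rightarrow>
      ('g dual_group \<Rightarrow> complex) \<Rightarrow> 'g dual_group \<Rightarrow> complex" where
  "dual_dilation \<alpha> \<delta> h g \<xi> =
     complex_of_real (\<delta> h powr (1/2)) * g (dual_automorphism (\<alpha> h) \<xi>)"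

lemma norm_dual_dilation:
  assumes "0 < \<delta> h"
  shows "(cmod (dual_dilation \<alpha> \<delta> h g \<xi>))\<^sup>2 =
     \<delta> h * (cmod (g (dual_automorphism (\<alpha> h) \<xi>)))\<^sup>2"
  using assms
  by (simp add: dual_dilation_def norm_mult power_mult_distrib powr_half_sqrt)

definition affine_system ::
    "('h \<Rightarrow> 'g::minus \<Rightarrow> 'g) \<Rightarrow> ('h \<Rightarrow> real) \<Rightarrow> 'g set \<Rightarrow> ('g \<Rightarrow> complex) \<Rightarrow> ('g \<Rightarrow> complex) set" where
  "affine_system \<alpha> \<delta> \<Gamma> \<psi> = {dilation \<alpha> \<delta> h (translation \<gamma> \<psi>) | h \<gamma>. \<gamma> \<in> \<Gamma>}"

definition affine_frame ::
    "'g::minus measure \<Rightarrow> 'g set \<Rightarrow> 'g measure \<Rightarrow> 'h measure \<Rightarrow> ('h \<Rightarrow> 'g \<Rightarrow> 'g) \<Rightarrow> ('h \<Rightarrow> real) \<Rightarrow>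
      ('g \<Rightarrow> complex) set \<Rightarrow> ('g \<Rightarrow> complex) \<Rightarrow> real \<Rightarrow> real \<Rightarrow> bool" where
  "affine_frame \<mu> \<Gamma> \<mu>\<Gamma> \<sigma> \<alpha> \<delta> S \<psi> A B \<longleftrightarrow>
     affine_system \<alpha> \<delta> \<Gamma> \<psi> \<subseteq> S \<and>
     (\<forall>f\<in>S.
        let I = (\<integral>\<^sup>+h. (\<integral>\<^sup>+\<gamma>. ennreal
                   ((cmod (inner_L2 \<mu> f (dilation \<alpha> \<delta> h (translation \<gamma> \<psi>))))\<^sup>2) \<partial>\<mu>\<Gamma>) \<partial>\<sigma>)
        in ennreal (A * (norm_L2 \<mu> f)\<^sup>2) \<le> I \<and> I \<le> ennreal (B * (norm_L2 \<mu> f)\<^sup>2))"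

text \<open>Below, \<open>g\<close> stands for (a representative of) the Fourier transform of the generator.\<close>

definition calderon_sum ::
    "'h measure \<Rightarrow> ('h \<Rightarrow> 'g::topological_ab_group_add \<Rightarrow> 'g) \<Rightarrow>
      ('g dual_group \<Rightarrow> complex) \<Rightarrow> 'g dual_group \<Rightarrow> ennreal" where
  "calderon_sum \<sigma> \<alpha> g \<xi> =
     (\<integral>\<^sup>+h. ennreal ((cmod (g (dual_automorphism (\<alpha> h) \<xi>)))\<^sup>2) \<partial>\<sigma>)"

definition Psi ::
    "'h measure \<Rightarrow> ('h \<Rightarrow> 'g::topological_ab_group_add \<Rightarrow> 'g) \<Rightarrow> ('h \<Rightarrow> real) \<Rightarrow> ('h \<Rightarrow> real) \<Rightarrow> real \<Rightarrow>
      ('g dual_group \<Rightarrow> complex) \<Rightarrow> 'g dual_group \<Rightarrow> ennreal" where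
  "Psi \<sigma> \<alpha> \<delta> L M g \<xi> =
     (\<integral>\<^sup>+h\<in>{h. L h > M}. ennreal ((cmod (dual_dilation \<alpha> \<delta> h g \<xi>))\<^sup>2) \<partial>\<sigma>)"

definition good_set ::
    "'g::topological_ab_group_add measure \<Rightarrow> 'g dual_group measure \<Rightarrow>
      ('g dual_group \<Rightarrow> 'g dual_group \<Rightarrow> real) \<Rightarrow> ('g \<Rightarrow> complex) set \<Rightarrow> real \<Rightarrow> 'g dual_group set" where
  "good_set \<mu> \<nu> d S \<epsilon>\<^sub>0 =
     {\<xi>. \<forall>\<epsilon>. 0 < \<epsilon> \<and> \<epsilon> < \<epsilon>\<^sub>0 \<longrightarrow> indicator (dball d \<xi> \<epsilon>) \<in> fourier_image \<mu> \<nu> S}"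

end

theory Submission
  imports Defs
begin

text \<open>
  For \<open>f\<close> with Fourier transform \<open>\<chi>\<close>, the indicator of a ball \<open>B(\<xi>, \<epsilon>)\<close>, the inner integral of the frame
  condition is the squared norm on \<open>\<Gamma>\<close> of the inverse Fourier transform of \<open>\<delta>\<^sup>-\<^sup>1\<^sup>/\<^sup>2 \<psi>h\<close> times the
  conjugate of the indicator of \<open>\<alpha>\<^sub>h(B(\<xi>, \<epsilon>))\<close>. Restriction to \<open>\<Gamma>\<close> of functions with compactly supported
  Fourier transform preserves the norm if the support meets each coset of \<open>\<Gamma>\<^sup>\<bottom>\<close> at most once, and it
  multiplies the squared norm by at most \<open>n\<close> if each coset is met at most \<open>n\<close> times. Property X bounds
  this number by \<open>1 + C \<delta>(h)\<close> when \<open>L(h)\<close> is large, and for bounded \<open>L(h)\<close> it is \<open>1\<close> when \<open>\<epsilon>\<close> is small,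
  because \<open>\<Gamma>\<^sup>\<bottom>\<close> is discrete. Hence the frame inequalities compare \<open>A\<close> and \<open>B\<close> with the averages over
  \<open>B(\<xi>, \<epsilon>)\<close> of the truncated Calderon sum plus an error of at most \<open>2 C \<Psi>\<^sub>m\<close>. Lebesgue differentiation
  turns this into inequalities almost everywhere, and the error vanishes as \<open>m\<close> tends to infinity.
\<close>

section \<open>Spaces with a countable base\<close>

text \<open>Lebesgue differentiation needs a locally integrable integrand, and near a good point
  nothing bounds the whole Calderon sum: a ball may contain points that are not good, and the radius
  below which the frame inequality controls the part with L(h) \<le> m shrinks as m grows. The
  parameters with large L(h) are therefore split once more by the size of C \<delta>(h). If C
  \<delta>(h) < 1, the count in Property X is an integer below 2, so the energy of h is exactly an
  integral over the ball and is bounded through B. If C \<delta>(h) \<ge> 1, then 1 + C \<delta>(h)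
  \<le> 2 C \<delta>(h), so the energy is part of the error, which is locally integrable by
  assumption; this is the origin of the constant 2 C. The upper inequality drops the second kind,
  energies being nonnegative. On the side of \<Gamma> the obstacle is that Stone-Weierstrass lives
  on compact sets, while the pieces of a support that meet every coset of the annihilator at most
  once are only Borel sets. They are approximated from inside, which yields an inequality in place
  of an isometry and suffices for the bound by the count.\<close>

lemma second_countable_imp_topological_basis:
  assumes "second_countable (euclidean :: 'a::topological_space topology)"
  obtains \<B> :: "'a::topological_space set set" where "countable \<B>" "topological_basis \<B>"
proof -
  obtain \<B> :: "'a set set" where \<B>: "countable \<B>" "\<And>V. V \<in> \<B> \<Longrightarrow> open V"
    "\<And>U x. open U \<Longrightarrow> x \<in> U \<Longrightarrow> \<exists>V\<in>\<B>. x \<in> V \<and> V \<subseteq> U"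
    using assms unfolding second_countable_def by auto
  then have "topological_basis \<B>"
    by (intro topological_basisI) auto
  with \<B>(1) that show thesis by blast
qed

lemma second_countable_euclidean:
  "second_countable (euclidean :: 'a::second_countable_topology topology)"
proof -
  obtain B :: "'a set set" where "countable B" "topological_basis B"
    using ex_countable_basis by blast
  then have "\<forall>V\<in>B. open V" "\<forall>U x. open U \<and> x \<in> U \<longrightarrow> (\<exists>V\<in>B. x \<in> V \<and> V \<subseteq> U)"
    by (simp add: topological_basis_open) (metis topological_basisE \<open>topological_basis B\<close>)
  with \<open>countable B\<close> show ?thesis
    unfolding second_countable_def by auto
qed

text \<open>The Lindelof property of the union. It replaces an uncountable family of small
  neighbourhoods by countably many, so that null sets can be united and preimages stay
  measurable.\<close>

lemma countable_open_subcover: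
  fixes \<U> :: "'a::topological_space set set"
  assumes "second_countable (euclidean :: 'a topology)" "\<And>U. U \<in> \<U> \<Longrightarrow> open U"
  obtains \<V> where "countable \<V>" "\<V> \<subseteq> \<U>" "\<Union>\<V> = \<Union>\<U>"
proof -
  have "Lindelof_space (subtopology euclidean (\<Union>\<U>))"
    by (rule second_countable_imp_Lindelof_space[OF second_countable_subtopology[OF assms(1)]])
  then obtain \<V> where "countable \<V>" "\<V> \<subseteq> \<U>" "\<Union>\<U> \<subseteq> \<Union>\<V>"
    using assms(2) unfolding Lindelof_space_subtopology
    by (elim allE[of _ "\<U>"]) auto
  with that show thesis by blast
qed

text \<open>Rectangles from the two bases form a countable base of the product, so an open set is a
  countable union of measurable rectangles. Countability is a hypothesis on the topologies because
  the dual group owes its base to the metric \<open>d\<close> and not to its sort.\<close>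

lemma borel_prod_second_countable:
  assumes "second_countable (euclidean :: 'a::topological_space topology)"
    and "second_countable (euclidean :: 'b::topological_space topology)"
  shows "sets (borel \<Otimes>\<^sub>M borel) = sets (borel :: ('a \<times> 'b) measure)"
proof
  obtain A :: "'a set set" where A: "countable A" "topological_basis A"
    by (rule second_countable_imp_topological_basis[OF assms(1)])
  obtain B :: "'b set set" where B: "countable B" "topological_basis B"
    by (rule second_countable_imp_topological_basis[OF assms(2)])
  have AB: "topological_basis ((\<lambda>(a, b). a \<times> b) ` (A \<times> B))"
    by (rule topological_basis_prod[OF A(2) B(2)])
  have "U \<in> sets (borel \<Otimes>\<^sub>M borel)" if "open U" for U :: "('a \<times> 'b) set"
  proof -
    obtain X where X: "X \<subseteq> (\<lambda>(a, b). a \<times> b) ` (A \<times> B)" "\<Union>X = U"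
      using conjunct2[OF AB[unfolded topological_basis_def]] \<open>open U\<close> by (elim allE[of _ U]) auto
    have "countable X"
      by (rule countable_subset[OF X(1)]) (use A(1) B(1) in simp)
    moreover have "x \<in> sets (borel \<Otimes>\<^sub>M borel)" if "x \<in> X" for x
    proof -
      obtain a b where "x = a \<times> b" "a \<in> A" "b \<in> B" using subsetD[OF X(1) \<open>x \<in> X\<close>] by auto
      with A B show ?thesis
        by (auto intro!: pair_measureI simp: topological_basis_open)
    qed
    ultimately show ?thesis unfolding X(2)[symmetric] by (intro sets.countable_Union) auto
  qed
  then show "sets (borel :: ('a \<times> 'b) measure) \<subseteq> sets (borel \<Otimes>\<^sub>M borel)"
    unfolding borel_def
    by (intro sigma_le_sets[THEN iffD2]) (auto simp: borel_def space_pair_measure)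
next
  have "fst \<in> borel \<rightarrow>\<^sub>M (borel :: 'a measure)" "snd \<in> borel \<rightarrow>\<^sub>M (borel :: 'b measure)"
    by (auto intro!: borel_measurable_continuous_onI continuous_intros)
  then have "(\<lambda>x. x) \<in> (borel :: ('a \<times> 'b) measure) \<rightarrow>\<^sub>M borel \<Otimes>\<^sub>M borel"
    by (subst measurable_pair_iff) (auto simp: o_def)
  then show "sets (borel \<Otimes>\<^sub>M borel) \<subseteq> sets (borel :: ('a \<times> 'b) measure)"
    by (auto simp: measurable_def)
qed

lemma borel_measurable_continuous_pair:
  fixes f :: "'a::topological_space \<times> 'b::topological_space \<Rightarrow> 'c::topological_space"
  assumes "second_countable (euclidean :: 'a topology)"
    and "second_countable (euclidean :: 'b topology)"
    and "continuous_on UNIV f"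
  shows "f \<in> borel \<Otimes>\<^sub>M borel \<rightarrow>\<^sub>M borel"
  using borel_measurable_continuous_onI[OF assms(3)]
  by (simp add: measurable_cong_sets[OF borel_prod_second_countable[OF assms(1,2)] refl])

lemma haar_measure_euclideanD:
  assumes "haar_measure (euclidean :: 'a::{topological_space, plus} topology) M"
  shows "space M = UNIV" "sets M = sets borel" "distr M M ((+) a) = M"
    "compact K \<Longrightarrow> emeasure M K < \<infinity>" "open U \<Longrightarrow> U \<noteq> {} \<Longrightarrow> 0 < emeasure M U"
  using assms unfolding haar_measure_def by (auto simp: borel_def)

section \<open>Groups with a proper invariant metric\<close>

locale proper_metric_group =
  fixes d :: "'a::{topological_space, ab_group_add} \<Rightarrow> 'a \<Rightarrow> real"
  assumes compatible: "compatible_metric d"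

sublocale proper_metric_group \<subseteq> Metric_space UNIV d
  using compatible by (simp add: compatible_metric_def)

context proper_metric_group
begin

lemma mtopology_euclidean: "mtopology = euclidean"
  and dist_add [simp]: "d (x + z) (y + z) = d x y"
  and compact_mcball: "compact (mcball x r)"
  using compatible by (auto simp: compatible_metric_def)

lemma dist_diff: "d (x - z) (y - z) = d x y"
  by (metis dist_add diff_add_cancel)

lemma dist_diff_0: "d (x - y) 0 = d x y"
  by (metis dist_diff cancel_comm_monoid_add_class.diff_cancel)

lemma dist_minus: "d (- x) (- y) = d x y"
  using dist_add[of "-x" "x + y" "-y"] by (simp add: commute)

lemma dist_add_left [simp]: "d (z + x) (z + y) = d x y"
  by (simp add: add.commute)

lemma triangle_UNIV: "d x z \<le> d x y + d y z"
  by (rule triangle) auto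

lemma open_iff: "open U \<longleftrightarrow> (\<forall>x\<in>U. \<exists>r>0. mball x r \<subseteq> U)"
  using openin_mtopology[of U] by (auto simp: mtopology_euclidean)

lemma open_mball [simp]: "open (mball x r)"
  using openin_mball[of x r] by (simp add: mtopology_euclidean)

lemma closed_mcball [simp]: "closed (mcball x r)"
  using closedin_mcball[of x r] by (simp add: mtopology_euclidean)

lemma mball_translation: "mball x r = (+) x ` mball 0 r"
proof -
  have "y \<in> (+) x ` mball 0 r" if "d x y < r" for y
    using that by (intro image_eqI[of _ _ "y - x"])
      (auto simp: dist_diff[of x x y, simplified])
  then show ?thesis using dist_add_left[of x 0] by auto
qed

text \<open>Closed balls are compact, so the ball of radius \<open>n\<close> is covered by finitely
  many balls of radius \<open>1 / Suc k\<close>; all the centres together form a countable dense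
  set.\<close>

lemma second_countable: "second_countable (euclidean :: 'a topology)"
proof -
  have "\<exists>C. finite C \<and> mcball 0 (real n) \<subseteq> (\<Union>c\<in>C. mball c (1 / Suc k))" for n k :: nat
  proof (rule compactE_image[OF compact_mcball, of "UNIV" "\<lambda>c. mball c (1 / Suc k)" 0 "real n"])
    have "x \<in> mball x (1 / real (Suc k))" for x by simp
    then show "mcball 0 (real n) \<subseteq> (\<Union>c\<in>UNIV. mball c (1 / real (Suc k)))" by blast
  qed auto
  then obtain C where C: "\<And>n k. finite (C n k)"
    "\<And>n k. mcball 0 (real n) \<subseteq> (\<Union>c\<in>C n k. mball c (1 / real (Suc k)))"
    by metis
  define D where "D = (\<Union>n k. C n k)"
  have D: "countable D"
    unfolding D_def using C(1) by (intro countable_UN) (auto intro: countable_finite)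
  have dense: "\<exists>c\<in>D. d c x < e" if "e > 0" for x e
  proof -
    obtain k where k: "1 / Suc k < e" using nat_approx_posE[OF \<open>e > 0\<close>] by blast
    obtain n where "d 0 x \<le> real n" using real_arch_simple by blast
    then have "x \<in> mcball 0 (real n)" by simp
    with C(2)[of n k] obtain c where "c \<in> C n k" "d c x < 1 / Suc k" by auto
    with k show ?thesis unfolding D_def by (intro bexI[of _ c]) auto
  qed
  show ?thesis
    unfolding second_countable_def
  proof (intro exI[of _ "(\<lambda>(c, k). mball c (1 / real (Suc k))) ` (D \<times> UNIV)"] conjI ballI allI impI)
    show "countable ((\<lambda>(c, k). mball c (1 / real (Suc k))) ` (D \<times> UNIV))"
      using D by auto
    show "openin euclidean V" if "V \<in> (\<lambda>(c, k). mball c (1 / real (Suc k))) ` (D \<times> UNIV)" for V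
      using that by auto
    fix U x assume "openin euclidean U \<and> (x::'a) \<in> U"
    then obtain r where r: "r > 0" "mball x r \<subseteq> U" using open_iff by auto
    obtain k where k: "1 / Suc k < r / 2" using r nat_approx_posE[of "r/2"] by auto
    obtain c where c: "c \<in> D" "d c x < 1 / Suc k" using dense[of "1 / Suc k" x] by auto
    have "mball c (1 / Suc k) \<subseteq> mball x r"
      using k c by (intro mball_subset) (auto simp del: of_nat_Suc)
    then show "\<exists>V\<in>(\<lambda>(c, k). mball c (1 / real (Suc k))) ` (D \<times> UNIV). x \<in> V \<and> V \<subseteq> U"
      using r c by (intro bexI[of _ "mball c (1 / Suc k)"]) auto
  qed
qed

lemma continuous_onI:
  assumes "\<And>x e. e > 0 \<Longrightarrow> \<exists>r>0. \<forall>y. d x y < r \<longrightarrow> d (f x) (f y) < e"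
  shows "continuous_on UNIV f"
  unfolding continuous_on_open_vimage[OF open_UNIV]
proof (intro allI impI)
  fix U :: "'a set" assume U: "open U"
  show "open (f -` U \<inter> UNIV)"
    unfolding open_iff
  proof
    fix x assume "x \<in> f -` U \<inter> UNIV"
    then obtain e where e: "e > 0" "mball (f x) e \<subseteq> U" using U open_iff by auto
    then obtain r where "r > 0" "\<forall>y. d x y < r \<longrightarrow> d (f x) (f y) < e" using assms by blast
    with e show "\<exists>r>0. mball x r \<subseteq> f -` U \<inter> UNIV"
      by (intro exI[of _ r]) (auto intro!: subsetD[OF e(2)])
  qed
qed

text \<open>Invariance gives \<open>d (x - y) (x' - y') \<le> d x x' + d y y'\<close>. The type is
  only a topological space and a group, so continuity of the operations has to come from
  \<open>d\<close>.\<close>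

lemma continuous_diff: "continuous_on UNIV (\<lambda>z :: 'a \<times> 'a. fst z - snd z)"
  unfolding continuous_on_open_vimage[OF open_UNIV]
proof (intro allI impI)
  fix U :: "'a set" assume U: "open U"
  show "open ((\<lambda>z. fst z - snd z) -` U \<inter> UNIV)"
    unfolding open_prod_def
  proof
    fix z :: "'a \<times> 'a" assume "z \<in> (\<lambda>z. fst z - snd z) -` U \<inter> UNIV"
    then obtain r where r: "r > 0" "mball (fst z - snd z) r \<subseteq> U" using U open_iff by auto
    have "d (fst z - snd z) (x - y) < r" if "d (fst z) x < r / 2" "d (snd z) y < r / 2" for x y
    proof -
      have "d (fst z - snd z) (x - y) \<le> d (fst z - snd z) (x - snd z) + d (x - snd z) (x - y)"
        by (rule triangle_UNIV)
      also have "\<dots> = d (fst z) x + d (snd z) y"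
        using dist_add_left[of x "- snd z" "- y"] dist_minus[of "snd z" y] dist_diff[of "fst z" "snd z" x]
        by (simp del: dist_add_left)
      finally show ?thesis using that by simp
    qed
    then have "mball (fst z) (r/2) \<times> mball (snd z) (r/2) \<subseteq> (\<lambda>z. fst z - snd z) -` U \<inter> UNIV"
      using r(2) by (simp add: subset_iff)
    moreover have "z \<in> mball (fst z) (r/2) \<times> mball (snd z) (r/2)"
      using r(1) by (simp add: mem_Times_iff)
    ultimately show "\<exists>A B. open A \<and> open B \<and> z \<in> A \<times> B \<and> A \<times> B \<subseteq> (\<lambda>z. fst z - snd z) -` U \<inter> UNIV"
      using open_mball by (intro exI[of _ "mball (fst z) (r/2)"] exI[of _ "mball (snd z) (r/2)"] conjI)
  qed
qed

lemma measurable_diff [measurable]: "(\<lambda>z :: 'a \<times> 'a. fst z - snd z) \<in> borel \<Otimes>\<^sub>M borel \<rightarrow>\<^sub>M borel"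
  by (intro borel_measurable_continuous_pair second_countable continuous_diff)

lemma continuous_translation: "continuous_on UNIV ((+) (a::'a))"
  by (intro continuous_onI) auto

lemma measurable_translation [measurable]: "(+) (a::'a) \<in> borel \<rightarrow>\<^sub>M borel"
  by (intro borel_measurable_continuous_onI continuous_translation)

lemma continuous_uminus: "continuous_on UNIV (uminus :: 'a \<Rightarrow> 'a)"
  by (intro continuous_onI) (auto simp: dist_minus)

lemma measurable_uminus [measurable]: "(uminus :: 'a \<Rightarrow> 'a) \<in> borel \<rightarrow>\<^sub>M borel"
  by (intro borel_measurable_continuous_onI continuous_uminus)

section \<open>Borel measures: regularity and covering by balls\<close>

lemma sigma_finite_of_compact:
  assumes "sets M = sets (borel :: 'a measure)" "\<And>K. compact K \<Longrightarrow> emeasure M K < \<infinity>"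
  shows "sigma_finite_measure M"
proof
  have "space M = UNIV" using sets_eq_imp_space_eq[OF assms(1)] by simp
  moreover have "(\<Union>n::nat. mcball 0 (real n)) = UNIV"
    by (auto simp: real_arch_simple)
  moreover have "mcball 0 (real n) \<in> sets M \<and> emeasure M (mcball 0 (real n)) \<noteq> \<infinity>" for n
    using assms compact_mcball[of 0 "real n"] by (simp add: less_top)
  ultimately show "\<exists>A. countable A \<and> A \<subseteq> sets M \<and> \<Union>A = space M \<and> (\<forall>a\<in>A. emeasure M a \<noteq> \<infinity>)"
    by (intro exI[of _ "range (\<lambda>n::nat. mcball 0 (real n))"] conjI) auto
qed

text \<open>The sets that can be squeezed between a closed and an open set with small difference
  form a sigma-algebra. It contains the open sets, since in a metric topology these are increasing
  unions of closed sets.\<close>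

lemma finite_borel_measure_regular:
  assumes sets: "sets M = sets borel" and fin: "emeasure M UNIV \<noteq> \<infinity>"
    and A: "A \<in> sets (borel :: 'a measure)" and "0 < e"
  shows "\<exists>C U. closed C \<and> open U \<and> C \<subseteq> A \<and> A \<subseteq> U \<and> emeasure M (U - C) < ennreal e"
proof -
  have space: "space M = UNIV" using sets_eq_imp_space_eq[OF sets] by simp
  interpret finite_measure M using fin by (intro finite_measureI) (simp add: space)
  have [measurable_cong]: "sets M = sets borel" by (rule sets)
  have "A \<in> sigma_sets UNIV {U. open U}" using A by (simp add: borel_def)
  then show ?thesis using \<open>0 < e\<close>
  proof (induction arbitrary: e rule: sigma_sets.induct)
    case (Basic U)
    then have "fsigma_in mtopology U"
      by (intro open_imp_fsigma_in metrizable_space_mtopology) (simp add: mtopology_euclidean)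
    then obtain C where C: "\<And>n. closed (C n)" "\<And>n. C n \<subseteq> C (Suc n)" "(\<Union>n. C n) = U"
      unfolding fsigma_in_ascending by (auto simp: mtopology_euclidean)
    have "(\<lambda>n. emeasure M (U - C n)) \<longlonglongrightarrow> emeasure M (\<Inter>n. U - C n)"
      using C Basic
      by (intro Lim_emeasure_decseq) (auto simp: decseq_Suc_iff intro!: borel_closed)
    moreover have "(\<Inter>n. U - C n) = {}" using C(3) by auto
    ultimately have "(\<lambda>n. emeasure M (U - C n)) \<longlonglongrightarrow> 0" by (simp only: emeasure_empty)
    from order_tendstoD(2)[OF this, of "ennreal e"] Basic.prems
    obtain n where "emeasure M (U - C n) < ennreal e"
      by (auto simp: eventually_sequentially)
    then show ?case using Basic C by (intro exI[of _ "C n"] exI[of _ U]) auto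
  next
    case Empty
    then show ?case by (intro exI[of _ "{}"]) auto
  next
    case (Compl A)
    from Compl.IH[OF Compl.prems] obtain C U where
      *: "closed C" "open U" "C \<subseteq> A" "A \<subseteq> U" "emeasure M (U - C) < ennreal e" by blast
    moreover have "- C - - U = U - C" by auto
    ultimately show ?case
      by (intro exI[of _ "- U"] exI[of _ "- C"]) auto
  next
    case (Union A)
    \<comment> \<open>These errors add up to \<open>e / 2\<close>. The other half pays for stopping
      the union of the closed sets at a finite \<open>n\<close>, because an infinite union of closed
      sets need not be closed.\<close>
    define \<delta> where "\<delta> i = e / 2 * (1 / 2) ^ Suc i" for i :: nat
    have \<delta>: "\<delta> i > 0" for i using Union.prems by (simp add: \<delta>_def)
    have "\<forall>i. \<exists>C U. closed C \<and> open U \<and> C \<subseteq> A i \<and> A i \<subseteq> U \<and> emeasure M (U - C) < ennreal (\<delta> i)"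
      using Union.IH[OF \<delta>] by blast
    then obtain C U where CU: "\<And>i. closed (C i)" "\<And>i. open (U i)" "\<And>i. C i \<subseteq> A i" "\<And>i. A i \<subseteq> U i"
      "\<And>i. emeasure M (U i - C i) < ennreal (\<delta> i)" by metis
    have [measurable]: "U i \<in> sets borel" "C i \<in> sets borel" for i using CU by auto
    have "(\<Sum>i. ennreal (\<delta> i)) = ennreal (e / 2)"
      using sums_mult[OF power_half_series, of "e/2"] \<delta>
      by (intro suminf_ennreal_eq) (auto simp: \<delta>_def less_imp_le)
    moreover have "emeasure M (\<Union>i. U i - C i) \<le> (\<Sum>i. emeasure M (U i - C i))"
      by (intro emeasure_subadditive_countably) auto
    moreover have "(\<Sum>i. emeasure M (U i - C i)) \<le> (\<Sum>i. ennreal (\<delta> i))"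
      by (intro suminf_le) (auto intro: less_imp_le[OF CU(5)])
    ultimately have half: "emeasure M (\<Union>i. U i - C i) \<le> ennreal (e / 2)" by auto
    have lim: "(\<lambda>n. emeasure M ((\<Union>i. U i) - (\<Union>i<n. C i))) \<longlonglongrightarrow> emeasure M (\<Inter>n. (\<Union>i. U i) - (\<Union>i<n. C i))"
      by (intro Lim_emeasure_decseq) (auto simp: decseq_Suc_iff less_Suc_eq)
    have "emeasure M (\<Inter>n. (\<Union>i. U i) - (\<Union>i<n. C i)) \<le> emeasure M (\<Union>i. U i - C i)"
      by (intro emeasure_mono) auto
    also note half
    also have "ennreal (e / 2) < ennreal e" using Union.prems by (simp add: ennreal_less_iff)
    finally have "\<forall>\<^sub>F n in sequentially. emeasure M ((\<Union>i. U i) - (\<Union>i<n. C i)) < ennreal e"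
      by (rule order_tendstoD(2)[OF lim])
    then obtain n where "emeasure M ((\<Union>i. U i) - (\<Union>i<n. C i)) < ennreal e"
      by (auto simp: eventually_sequentially)
    moreover have "closed (\<Union>i<n. C i)" "open (\<Union>i. U i)" using CU(1,2) by auto
    moreover have "(\<Union>i<n. C i) \<subseteq> (\<Union>i. A i)" "(\<Union>i. A i) \<subseteq> (\<Union>i. U i)" using CU(3,4) by blast+
    ultimately show ?case
      by (intro exI[of _ "\<Union>i<n. C i"] exI[of _ "\<Union>i. U i"] conjI)
  qed
qed

text \<open>Greedy choice by decreasing radius: a ball around \<open>m\<close> of largest radius is
  kept and all balls that meet it are dropped. Those have radius at most \<open>\<rho> m\<close>,
  hence lie in the ball of triple radius; induction treats the rest.\<close>

lemma finite_vitali_covering: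
  assumes "finite J"
  shows "\<exists>J'\<subseteq>J. disjoint_family_on (\<lambda>x. mball x (\<rho> x)) J' \<and>
    (\<Union>x\<in>J. mball x (\<rho> x)) \<subseteq> (\<Union>x\<in>J'. mball x (3 * \<rho> x))"
  using assms
proof (induction "card J" arbitrary: J rule: less_induct)
  case less
  show ?case
  proof (cases "J = {}")
    case False
    have "finite (\<rho> ` J)" "\<rho> ` J \<noteq> {}" using less.prems False by auto
    from Max_in[OF this] Max_ge[OF this(1)]
    obtain m where m: "m \<in> J" "\<And>x. x \<in> J \<Longrightarrow> \<rho> x \<le> \<rho> m" by auto
    \<comment> \<open>\<open>x \<noteq> m\<close> has to be required: with a radius
      \<open>\<rho> m \<le> 0\<close> the ball around \<open>m\<close> is empty and does not meet
      itself, and then \<open>R\<close> would not be smaller than \<open>J\<close>.\<close>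
    define R where "R = {x \<in> J. x \<noteq> m \<and> mball x (\<rho> x) \<inter> mball m (\<rho> m) = {}}"
    have "R \<subset> J" using m(1) by (auto simp: R_def)
    then have "card R < card J" "finite R"
      using less.prems by (auto simp: psubset_card_mono intro: finite_subset)
    from less.hyps[OF this] obtain J' where
      J': "J' \<subseteq> R" "disjoint_family_on (\<lambda>x. mball x (\<rho> x)) J'"
      "(\<Union>x\<in>R. mball x (\<rho> x)) \<subseteq> (\<Union>x\<in>J'. mball x (3 * \<rho> x))" by blast
    have "mball x (\<rho> x) \<subseteq> (\<Union>x\<in>insert m J'. mball x (3 * \<rho> x))" if x: "x \<in> J" for x
    proof (cases "x \<in> R")
      case False
      have "mball x (\<rho> x) \<subseteq> mball m (3 * \<rho> m)"
      proof (cases "x = m")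
        case True
        then have "y \<in> mball m (3 * \<rho> m)" if "y \<in> mball x (\<rho> x)" for y
        proof -
          have "d m y < \<rho> m" using that True by simp
          then have "d m y < 3 * \<rho> m" using nonneg[of m y] by linarith
          then show ?thesis by simp
        qed
        then show ?thesis by blast
      next
        assume "x \<noteq> m"
        with False x obtain z where z: "d x z < \<rho> x" "d m z < \<rho> m" by (auto simp: R_def)
        show ?thesis
        proof
          fix y assume y: "y \<in> mball x (\<rho> x)"
          have "d m y \<le> d m z + d z x + d x y"
            using triangle_UNIV[of m y z] triangle_UNIV[of z y x] by simp
          then show "y \<in> mball m (3 * \<rho> m)"
            using y z m(2)[OF x] by (simp add: commute)
        qed
      qed
      then show ?thesis by blast
    qed (use J'(3) in blast)
    moreover have "disjoint_family_on (\<lambda>x. mball x (\<rho> x)) (insert m J')"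
    proof (subst disjoint_family_on_insert)
      show "m \<notin> J'" using J'(1) by (auto simp: R_def)
      have "mball m (\<rho> m) \<inter> mball x (\<rho> x) = {}" if "x \<in> J'" for x
        using J'(1) that unfolding R_def by blast
      then show "mball m (\<rho> m) \<inter> \<Union> ((\<lambda>x. mball x (\<rho> x)) ` J') = {} \<and>
          disjoint_family_on (\<lambda>x. mball x (\<rho> x)) J'" using J'(2) by blast
    qed
    moreover have "insert m J' \<subseteq> J" using J'(1) m(1) by (auto simp: R_def)
    ultimately show ?thesis by (intro exI[of _ "insert m J'"]) blast
  qed (auto simp: disjoint_family_on_def)
qed

end

section \<open>Haar measure: uniqueness and Lebesgue differentiation\<close>

locale haar_metric_group = proper_metric_group d
  for d :: "'a::{topological_space, ab_group_add} \<Rightarrow> 'a \<Rightarrow> real" +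
  fixes \<nu> :: "'a measure"
  assumes haar: "haar_measure euclidean \<nu>"
begin

lemma space_haar [simp]: "space \<nu> = UNIV"
  and sets_haar [simp, measurable_cong]: "sets \<nu> = sets borel"
  using haar_measure_euclideanD[OF haar] by auto

sublocale sigma_finite_measure \<nu>
  using haar_measure_euclideanD(4)[OF haar] by (intro sigma_finite_of_compact) auto

lemma nn_integral_translation:
  assumes [measurable]: "f \<in> borel_measurable borel"
  shows "(\<integral>\<^sup>+x. f (a + x) \<partial>\<nu>) = (\<integral>\<^sup>+x. f x \<partial>\<nu>)"
proof -
  have "(\<integral>\<^sup>+x. f x \<partial>\<nu>) = (\<integral>\<^sup>+x. f x \<partial>distr \<nu> \<nu> ((+) a))"
    by (simp add: haar_measure_euclideanD(3)[OF haar])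
  also have "\<dots> = (\<integral>\<^sup>+x. f (a + x) \<partial>\<nu>)"
    by (subst nn_integral_distr) auto
  finally show ?thesis by simp
qed

lemma emeasure_translation:
  assumes [measurable]: "A \<in> sets borel"
  shows "emeasure \<nu> ((+) a ` A) = emeasure \<nu> A"
proof -
  have "x \<in> (+) a ` A" if "- a + x \<in> A" for x
    using that by (intro image_eqI[of _ _ "- a + x"]) auto
  then have eq: "(+) a ` A = (+) (- a) -` A \<inter> space \<nu>" by auto
  have "emeasure \<nu> A = emeasure (distr \<nu> \<nu> ((+) (- a))) A"
    by (simp add: haar_measure_euclideanD(3)[OF haar])
  also have "\<dots> = emeasure \<nu> ((+) a ` A)"
    unfolding eq by (subst emeasure_distr) auto
  finally show ?thesis by simp
qed

lemma emeasure_mball: "emeasure \<nu> (mball x r) = emeasure \<nu> (mball 0 r)"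
  by (subst mball_translation) (simp add: emeasure_translation)

lemma emeasure_mball_finite: "emeasure \<nu> (mball x r) < \<infinity>"
proof -
  have "emeasure \<nu> (mball x r) \<le> emeasure \<nu> (mcball x r)"
    by (intro emeasure_mono mball_subset_mcball) auto
  then show ?thesis
    using haar_measure_euclideanD(4)[OF haar compact_mcball[of x r]] by auto
qed

lemma emeasure_mball_pos: "0 < r \<Longrightarrow> 0 < emeasure \<nu> (mball x r)"
  using haar_measure_euclideanD(5)[OF haar open_mball[of x r]] by (auto simp: mball_eq_empty)

text \<open>Fubini's theorem is applied to \<open>f x * g (x + y)\<close>, with \<open>f\<close> the indicator of a symmetric ball.\<close>

lemma haar_measure_unique:
  assumes sets [measurable_cong]: "sets M = sets borel"
    and inv: "\<And>a. distr M M ((+) a) = M" and "sigma_finite_measure M"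
  shows "M = scale_measure (emeasure M (mball 0 1) / emeasure \<nu> (mball 0 1)) \<nu>"
proof -
  interpret M: sigma_finite_measure M by fact
  interpret pair_sigma_finite \<nu> M ..
  define B where "B = mball 0 1"
  have [measurable]: "B \<in> sets borel" by (auto simp: B_def)
  have inv_M: "(\<integral>\<^sup>+x. f (a + x) \<partial>M) = (\<integral>\<^sup>+x. f x \<partial>M)" if [measurable]: "f \<in> borel_measurable borel"
    for a :: 'a and f :: "'a \<Rightarrow> ennreal"
    by (subst (2) inv[symmetric, of a], subst nn_integral_distr) auto
  have [measurable]: "(\<lambda>z :: 'a \<times> 'a. fst z + snd z) \<in> borel \<Otimes>\<^sub>M borel \<rightarrow>\<^sub>M borel"
  proof -
    have "(\<lambda>z :: 'a \<times> 'a. (fst z, - snd z)) \<in> borel \<Otimes>\<^sub>M borel \<rightarrow>\<^sub>M borel \<Otimes>\<^sub>M borel" by measurable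
    from measurable_compose[OF this measurable_diff] show ?thesis by simp
  qed
  have key: "emeasure \<nu> B * emeasure M A = emeasure \<nu> A * emeasure M B"
    if [measurable]: "A \<in> sets borel" for A
  proof -
    have m1: "(\<lambda>(x, y). indicator B x * (indicator A (x + y) :: ennreal)) \<in> borel_measurable (\<nu> \<Otimes>\<^sub>M M)"
      by (simp add: split_beta') 
    have m2: "(\<lambda>(x, y). indicator A x * (indicator B (x - y) :: ennreal)) \<in> borel_measurable (\<nu> \<Otimes>\<^sub>M M)"
      by (simp add: split_beta')
    have "emeasure \<nu> B * emeasure M A = (\<integral>\<^sup>+x. indicator B x * emeasure M A \<partial>\<nu>)"
      by (subst nn_integral_multc) auto
    also have "\<dots> = (\<integral>\<^sup>+x. \<integral>\<^sup>+y. indicator B x * indicator A (x + y) \<partial>M \<partial>\<nu>)"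
      by (intro nn_integral_cong, subst nn_integral_cmult) (auto simp: inv_M)
    also have "\<dots> = (\<integral>\<^sup>+y. \<integral>\<^sup>+x. indicator B x * indicator A (x + y) \<partial>\<nu> \<partial>M)"
      using Fubini'[OF m1] by simp
    also have "\<dots> = (\<integral>\<^sup>+y. \<integral>\<^sup>+x. indicator A x * indicator B (x - y) \<partial>\<nu> \<partial>M)"
    proof (rule nn_integral_cong)
      fix y :: 'a
      have [measurable]: "(\<lambda>x::'a. x - y) \<in> borel \<rightarrow>\<^sub>M borel"
      proof -
        have "(\<lambda>x. x - y) = (+) (- y)" by auto
        then show ?thesis using measurable_translation by simp
      qed
      show "(\<integral>\<^sup>+x. indicator B x * indicator A (x + y) \<partial>\<nu>) = (\<integral>\<^sup>+x. indicator A x * (indicator B (x - y)::ennreal) \<partial>\<nu>)"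
        by (subst (2) nn_integral_translation[symmetric, of _ y]) (auto simp: ac_simps)
    qed
    also have "\<dots> = (\<integral>\<^sup>+x. \<integral>\<^sup>+y. indicator A x * indicator B (x - y) \<partial>M \<partial>\<nu>)"
      using Fubini'[OF m2] by simp
    also have "\<dots> = (\<integral>\<^sup>+x. indicator A x * emeasure M B \<partial>\<nu>)"
    proof (rule nn_integral_cong)
      fix x :: 'a
      have [measurable]: "(\<lambda>y::'a. x - y) \<in> borel \<rightarrow>\<^sub>M borel"
        using measurable_compose[OF measurable_uminus measurable_translation[of x]] by simp
      \<comment> \<open>After translation by \<open>x\<close> the integrand is the indicator of
        \<open>- y \<in> B\<close>. As \<open>B\<close> is symmetric, its integral is the measure of
        \<open>B\<close>; symmetry stands in for invariance of \<open>M\<close> under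
        inversion.\<close>
      have sym: "- y \<in> B \<longleftrightarrow> y \<in> B" for y
        using dist_minus[of 0 y] by (simp add: B_def)
      have "(\<integral>\<^sup>+y. indicator B (x - y) \<partial>M) = (\<integral>\<^sup>+y. (indicator B (- y) :: ennreal) \<partial>M)"
        by (subst inv_M[symmetric, of _ x]) auto
      also have "\<dots> = (\<integral>\<^sup>+y. indicator B y \<partial>M)"
        by (intro nn_integral_cong) (auto simp: indicator_def sym)
      finally show "(\<integral>\<^sup>+y. indicator A x * indicator B (x - y) \<partial>M) = indicator A x * emeasure M B"
        by (subst nn_integral_cmult) auto
    qed
    also have "\<dots> = emeasure \<nu> A * emeasure M B"
      by (subst nn_integral_multc) auto
    finally show ?thesis .
  qed
  show ?thesis
  proof (rule measure_eqI)
    fix A assume A: "A \<in> sets M"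
    have pos: "emeasure \<nu> B \<noteq> 0" and fin: "emeasure \<nu> B \<noteq> \<infinity>"
      using emeasure_mball_pos[of 1 0] emeasure_mball_finite[of 0 1] by (auto simp: B_def)
    have "emeasure M A = emeasure M A * emeasure \<nu> B / emeasure \<nu> B"
      using pos fin by (simp add: ennreal_mult_divide_eq)
    also have "\<dots> = emeasure M B / emeasure \<nu> B * emeasure \<nu> A"
      using key[of A] A sets by (simp add: ac_simps ennreal_times_divide)
    finally show "emeasure M A = emeasure (scale_measure (emeasure M (mball 0 1) / emeasure \<nu> (mball 0 1)) \<nu>) A"
      by (simp add: B_def)
  qed (simp add: sets)
qed

text \<open>
  The form of the Lebesgue differentiation theorem that is used here: the set \<open>T\<close> is covered by
  balls inside an open neighbourhood of \<open>{G = 0}\<close> on which the integral of \<open>G\<close> is small, and a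
  disjoint subfamily of these balls carries a fixed part of the measure.
\<close>

lemma null_set_of_large_averages:
  assumes doubling: "weakly_doubling \<nu> d"
    and G [measurable]: "G \<in> borel_measurable borel"
    and U\<^sub>0: "open U\<^sub>0" "(\<integral>\<^sup>+x\<in>U\<^sub>0. G x \<partial>\<nu>) < \<infinity>"
    and T: "\<And>x. x \<in> T \<Longrightarrow> x \<in> U\<^sub>0 \<and> G x = 0"
    and s: "0 < s"
    and avg: "\<And>x. x \<in> T \<Longrightarrow> \<exists>e>0. \<forall>r. 0 < r \<and> r < e \<longrightarrow>
      ennreal s * emeasure \<nu> (mball x r) \<le> (\<integral>\<^sup>+y\<in>mball x r. G y \<partial>\<nu>)"
  shows "AE x in \<nu>. x \<notin> T"
proof -
  obtain r\<^sub>0 C where r\<^sub>0: "0 < r\<^sub>0" "0 < C"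
    "\<And>r. r < r\<^sub>0 \<Longrightarrow> emeasure \<nu> (mball 0 (2 * r)) \<le> ennreal C * emeasure \<nu> (mball 0 r)"
    using doubling unfolding weakly_doubling_def by blast
  \<comment> \<open>Cutting off to \<open>U\<^sub>0\<close> makes this a finite measure, to which
    regularity applies. It gives measure 0 to \<open>Z\<close>, the zero set of \<open>G\<close> in
    \<open>U\<^sub>0\<close>, and \<open>Z\<close> contains \<open>T\<close>.\<close>
  define m where "m = density \<nu> (\<lambda>x. G x * indicator U\<^sub>0 x)"
  have [measurable]: "U\<^sub>0 \<in> sets borel" using U\<^sub>0 by auto
  have sets_m [simp, measurable_cong]: "sets m = sets borel" by (simp add: m_def)
  have m_eq: "emeasure m A = (\<integral>\<^sup>+x\<in>U\<^sub>0 \<inter> A. G x \<partial>\<nu>)" if "A \<in> sets borel" for A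
    using that unfolding m_def
    by (subst emeasure_density) (auto simp: indicator_inter_arith ac_simps intro!: nn_integral_cong)
  have fin: "emeasure m UNIV \<noteq> \<infinity>" using U\<^sub>0 by (simp add: m_eq)
  define Z where "Z = {x. G x = 0} \<inter> U\<^sub>0"
  have [measurable]: "Z \<in> sets borel" by (auto simp: Z_def)
  have mZ: "emeasure m Z = 0"
    by (subst m_eq) (auto simp: Z_def nn_integral_0_iff_AE indicator_def)
  \<comment> \<open>\<open>T\<close> may fail to be measurable, so it is caught in open sets of
    small measure; their intersection over \<open>\<epsilon> = 1 / Suc n\<close> is the null set in
    the end.\<close>
  have cover: "\<exists>V. open V \<and> T \<subseteq> V \<and> ennreal s * emeasure \<nu> V \<le> ennreal (C\<^sup>2 * \<epsilon>)" if \<epsilon>: "\<epsilon> > 0" for \<epsilon>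
  proof -
    from finite_borel_measure_regular[OF sets_m fin \<open>Z \<in> sets borel\<close> \<epsilon>]
    obtain K U where KU: "closed K" "open U" "K \<subseteq> Z" "Z \<subseteq> U" "emeasure m (U - K) < ennreal \<epsilon>" by blast
    define W where "W = U \<inter> U\<^sub>0"
    have W: "open W" using KU U\<^sub>0 by (auto simp: W_def)
    then have [measurable]: "W \<in> sets borel" by auto
    have "emeasure m W \<le> emeasure m (Z \<union> (U - K))"
      using KU by (intro emeasure_mono) (auto simp: W_def)
    also have "\<dots> \<le> emeasure m Z + emeasure m (U - K)"
      using KU by (intro emeasure_subadditive) auto
    finally have mW: "emeasure m W \<le> ennreal \<epsilon>" using KU(5) mZ by simp
    have "\<exists>\<rho>>0. mball x \<rho> \<subseteq> W \<and> ennreal s * emeasure \<nu> (mball x (3 * \<rho>)) \<le> ennreal (C\<^sup>2) * emeasure m (mball x \<rho>)"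
      if x: "x \<in> T" for x
    proof -
      from avg[OF x] obtain e where e: "e > 0" "\<And>r. 0 < r \<Longrightarrow> r < e \<Longrightarrow>
        ennreal s * emeasure \<nu> (mball x r) \<le> (\<integral>\<^sup>+y\<in>mball x r. G y \<partial>\<nu>)" by blast
      have "x \<in> W" using T[OF x] KU by (auto simp: W_def Z_def)
      then obtain t where t: "t > 0" "mball x t \<subseteq> W" using W open_iff by blast
      \<comment> \<open>\<open>e / 2\<close> keeps the inequality for the averages in force,
        \<open>t\<close> keeps the ball in \<open>W\<close>, and \<open>r\<^sub>0 / 3\<close> gives
        \<open>2 * \<rho> < r\<^sub>0\<close>, so that doubling applies at \<open>\<rho>\<close> and
        at \<open>2 * \<rho>\<close>. The tripled ball lies in the one of radius
        \<open>4 * \<rho>\<close>, whence \<open>C\<^sup>2\<close>.\<close>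
      define \<rho> where "\<rho> = min (min (e / 2) t) (r\<^sub>0 / 3)"
      have \<rho>: "0 < \<rho>" "\<rho> < e" "\<rho> \<le> t" "2 * \<rho> < r\<^sub>0" using e t r\<^sub>0 by (auto simp: \<rho>_def)
      have sub: "mball x \<rho> \<subseteq> W" using t mball_subset_concentric[OF \<rho>(3)] by blast
      have "emeasure \<nu> (mball x (3 * \<rho>)) \<le> emeasure \<nu> (mball x (2 * (2 * \<rho>)))"
        using \<rho> by (intro emeasure_mono mball_subset_concentric) auto
      also have "\<dots> = emeasure \<nu> (mball 0 (2 * (2 * \<rho>)))" by (rule emeasure_mball)
      also have "\<dots> \<le> ennreal C * emeasure \<nu> (mball 0 (2 * \<rho>))" by (rule r\<^sub>0(3)[OF \<rho>(4)])
      also have "\<dots> \<le> ennreal C * (ennreal C * emeasure \<nu> (mball 0 \<rho>))"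
        using \<rho> by (intro mult_left_mono r\<^sub>0(3)) auto
      also have "\<dots> = ennreal (C\<^sup>2) * emeasure \<nu> (mball x \<rho>)"
        using r\<^sub>0 by (subst emeasure_mball[of x]) (simp add: ennreal_mult power2_eq_square mult.assoc)
      finally have "ennreal s * emeasure \<nu> (mball x (3 * \<rho>)) \<le> ennreal s * (ennreal (C\<^sup>2) * emeasure \<nu> (mball x \<rho>))"
        by (rule mult_left_mono) simp
      also have "\<dots> = ennreal (C\<^sup>2) * (ennreal s * emeasure \<nu> (mball x \<rho>))" by (simp add: ac_simps)
      also have "\<dots> \<le> ennreal (C\<^sup>2) * (\<integral>\<^sup>+y\<in>mball x \<rho>. G y \<partial>\<nu>)"
        using e(2)[OF \<rho>(1,2)] by (rule mult_left_mono) simp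
      also have "(\<integral>\<^sup>+y\<in>mball x \<rho>. G y \<partial>\<nu>) = emeasure m (mball x \<rho>)"
      proof -
        have "U\<^sub>0 \<inter> mball x \<rho> = mball x \<rho>" using sub by (auto simp: W_def)
        then show ?thesis by (simp add: m_eq)
      qed
      finally show ?thesis using \<rho>(1) sub by blast
    qed
    then obtain \<rho> where \<rho>: "\<And>x. x \<in> T \<Longrightarrow> \<rho> x > 0" "\<And>x. x \<in> T \<Longrightarrow> mball x (\<rho> x) \<subseteq> W"
      "\<And>x. x \<in> T \<Longrightarrow> ennreal s * emeasure \<nu> (mball x (3 * \<rho> x)) \<le> ennreal (C\<^sup>2) * emeasure m (mball x (\<rho> x))"
      by metis
    \<comment> \<open>The covering lemma is finite. The bound passes to a countable union by
      continuity of the measure along the increasing finite unions \<open>V n\<close> below.\<close>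
    have finite_bound: "ennreal s * emeasure \<nu> (\<Union>x\<in>J. mball x (\<rho> x)) \<le> ennreal (C\<^sup>2 * \<epsilon>)"
      if J: "finite J" "J \<subseteq> T" for J
    proof -
      from finite_vitali_covering[OF J(1), of \<rho>] obtain J' where
        J': "J' \<subseteq> J" "disjoint_family_on (\<lambda>x. mball x (\<rho> x)) J'"
        "(\<Union>x\<in>J. mball x (\<rho> x)) \<subseteq> (\<Union>x\<in>J'. mball x (3 * \<rho> x))" by blast
      have fJ': "finite J'" using J'(1) J(1) finite_subset by blast
      have "emeasure \<nu> (\<Union>x\<in>J. mball x (\<rho> x)) \<le> emeasure \<nu> (\<Union>x\<in>J'. mball x (3 * \<rho> x))"
        using J'(3) fJ' by (intro emeasure_mono) auto
      also have "\<dots> \<le> (\<Sum>x\<in>J'. emeasure \<nu> (mball x (3 * \<rho> x)))"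
        using fJ' by (intro emeasure_subadditive_finite) auto
      finally have "ennreal s * emeasure \<nu> (\<Union>x\<in>J. mball x (\<rho> x)) \<le> ennreal s * (\<Sum>x\<in>J'. emeasure \<nu> (mball x (3 * \<rho> x)))"
        by (rule mult_left_mono) simp
      also have "\<dots> = (\<Sum>x\<in>J'. ennreal s * emeasure \<nu> (mball x (3 * \<rho> x)))" by (rule sum_distrib_left)
      also have "\<dots> \<le> (\<Sum>x\<in>J'. ennreal (C\<^sup>2) * emeasure m (mball x (\<rho> x)))"
        using J'(1) J(2) by (intro sum_mono \<rho>(3)) auto
      also have "\<dots> = ennreal (C\<^sup>2) * (\<Sum>x\<in>J'. emeasure m (mball x (\<rho> x)))"
        by (rule sum_distrib_left[symmetric])
      also have "(\<Sum>x\<in>J'. emeasure m (mball x (\<rho> x))) = emeasure m (\<Union>x\<in>J'. mball x (\<rho> x))"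
        using fJ' J'(2) by (intro sum_emeasure) auto
      also have "emeasure m (\<Union>x\<in>J'. mball x (\<rho> x)) \<le> emeasure m W"
        using \<rho>(2) J'(1) J(2) by (intro emeasure_mono UN_least) (auto simp: subset_iff)
      also note mW
      finally show ?thesis using \<epsilon> by (simp add: ennreal_mult mult_left_mono)
    qed
    obtain \<V> where \<V>: "countable \<V>" "\<V> \<subseteq> (\<lambda>x. mball x (\<rho> x)) ` T" "\<Union>\<V> = (\<Union>x\<in>T. mball x (\<rho> x))"
    proof (rule countable_open_subcover[OF second_countable, of "(\<lambda>x. mball x (\<rho> x)) ` T"])
      show "open U" if "U \<in> (\<lambda>x. mball x (\<rho> x)) ` T" for U using that by auto
    qed (rule that)
    obtain Q where Q: "Q \<subseteq> T" "countable Q" "\<V> = (\<lambda>x. mball x (\<rho> x)) ` Q"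
      using iffD1[OF countable_subset_image conjI[OF \<V>(1,2)]] by blast
    have "ennreal s * emeasure \<nu> (\<Union>\<V>) \<le> ennreal (C\<^sup>2 * \<epsilon>)"
    proof (cases "Q = {}")
      case True
      then show ?thesis using Q by simp
    next
      case False
      then have q: "range (from_nat_into Q) = Q" using Q(2) by (rule range_from_nat_into)
      define V where "V n = (\<Union>x\<in>from_nat_into Q ` {..<n}. mball x (\<rho> x))" for n :: nat
      have VV: "\<Union>\<V> = (\<Union>x\<in>range (from_nat_into Q). mball x (\<rho> x))"
        using q Q(3) by simp
      have V: "(\<Union>n. V n) = \<Union>\<V>"
      proof
        show "(\<Union>n. V n) \<subseteq> \<Union>\<V>"
          unfolding VV V_def by blast
        have "mball (from_nat_into Q i) (\<rho> (from_nat_into Q i)) \<subseteq> V (Suc i)" for i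
          by (auto simp: V_def)
        then show "\<Union>\<V> \<subseteq> (\<Union>n. V n)"
          unfolding VV by blast
      qed
      have "incseq V"
        unfolding V_def incseq_def by (intro allI impI UN_mono image_mono) auto
      moreover have "range V \<subseteq> sets \<nu>" by (auto simp: V_def)
      ultimately have "(SUP n. emeasure \<nu> (V n)) = emeasure \<nu> (\<Union>\<V>)"
        unfolding V[symmetric] by (intro SUP_emeasure_incseq)
      moreover have "ennreal s * (SUP n. emeasure \<nu> (V n)) = (SUP n. ennreal s * emeasure \<nu> (V n))"
        by (rule SUP_mult_left_ennreal)
      moreover have "\<dots> \<le> ennreal (C\<^sup>2 * \<epsilon>)"
        unfolding V_def using q Q(1) by (intro SUP_least finite_bound) auto
      ultimately show ?thesis by simp
    qed
    moreover have "open (\<Union>\<V>)" using \<V>(2) by (intro open_Union) auto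
    moreover have "T \<subseteq> \<Union>\<V>" unfolding \<V>(3) using \<rho>(1) by auto
    ultimately show ?thesis by blast
  qed
  have "\<forall>n::nat. \<exists>V. open V \<and> T \<subseteq> V \<and> ennreal s * emeasure \<nu> V \<le> ennreal (C\<^sup>2 * (1 / Suc n))"
    by (intro allI cover) simp
  then obtain V where V: "\<And>n::nat. open (V n)" "\<And>n. T \<subseteq> V n"
    "\<And>n. ennreal s * emeasure \<nu> (V n) \<le> ennreal (C\<^sup>2 * (1 / Suc n))"
    by (subst (asm) choice_iff) blast
  have [measurable]: "V n \<in> sets borel" for n using V(1) by auto
  have le: "ennreal s * emeasure \<nu> (\<Inter>n. V n) \<le> ennreal (C\<^sup>2 * (1 / Suc n))" for n
  proof -
    have "emeasure \<nu> (\<Inter>n. V n) \<le> emeasure \<nu> (V n)"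
      by (intro emeasure_mono) auto
    then have "ennreal s * emeasure \<nu> (\<Inter>n. V n) \<le> ennreal s * emeasure \<nu> (V n)"
      by (rule mult_left_mono) simp
    also note V(3)
    finally show ?thesis .
  qed
  have "(\<lambda>n. 1 / real (Suc n)) \<longlonglongrightarrow> 0"
    using LIMSEQ_Suc[OF lim_1_over_n] by simp
  then have "(\<lambda>n. ennreal (C\<^sup>2 * (1 / Suc n))) \<longlonglongrightarrow> ennreal (C\<^sup>2 * 0)"
    by (intro tendsto_ennrealI tendsto_mult tendsto_const)
  then have "ennreal s * emeasure \<nu> (\<Inter>n. V n) \<le> ennreal (C\<^sup>2 * 0)"
    by (rule LIMSEQ_le_const) (use le in blast)
  then have "emeasure \<nu> (\<Inter>n. V n) = 0" using s by simp
  then show ?thesis using V(2)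
    by (intro AE_I[of _ _ "\<Inter>n. V n"]) auto
qed

text \<open>The finite term \<open>b * \<nu> B\<close> is cancelled from a sum, because subtraction
  of extended nonnegative numbers truncates at 0. Both differentiation lemmas use it: with
  \<open>H\<close> constant for the upper bound and with \<open>F\<close> constant for the lower
  one.\<close>

lemma set_nn_integral_average_diff:
  assumes [measurable]: "F \<in> borel_measurable borel" "G \<in> borel_measurable borel" "B \<in> sets borel"
    and fin: "emeasure \<nu> B < \<infinity>" and b: "0 \<le> b" "0 \<le> s"
    and "\<And>x. H x \<le> G x + F x"
    and "ennreal (b + s) * emeasure \<nu> B \<le> (\<integral>\<^sup>+x\<in>B. H x \<partial>\<nu>)"
    and "(\<integral>\<^sup>+x\<in>B. F x \<partial>\<nu>) \<le> ennreal b * emeasure \<nu> B"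
  shows "ennreal s * emeasure \<nu> B \<le> (\<integral>\<^sup>+x\<in>B. G x \<partial>\<nu>)"
proof -
  have "ennreal b * emeasure \<nu> B + ennreal s * emeasure \<nu> B = ennreal (b + s) * emeasure \<nu> B"
    using b by (simp add: distrib_right)
  also note assms(8)
  also have "(\<integral>\<^sup>+x\<in>B. H x \<partial>\<nu>) \<le> (\<integral>\<^sup>+x. G x * indicator B x + F x * indicator B x \<partial>\<nu>)"
    using assms(7) by (intro nn_integral_mono) (auto simp: indicator_def)
  also have "\<dots> = (\<integral>\<^sup>+x\<in>B. G x \<partial>\<nu>) + (\<integral>\<^sup>+x\<in>B. F x \<partial>\<nu>)"
    by (intro nn_integral_add) auto
  also have "\<dots> \<le> (\<integral>\<^sup>+x\<in>B. G x \<partial>\<nu>) + ennreal b * emeasure \<nu> B"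
    by (intro add_left_mono assms)
  finally have "ennreal b * emeasure \<nu> B + ennreal s * emeasure \<nu> B
      \<le> ennreal b * emeasure \<nu> B + (\<integral>\<^sup>+x\<in>B. G x \<partial>\<nu>)" by (simp only: add.commute)
  moreover have "ennreal b * emeasure \<nu> B \<noteq> \<infinity>"
    using fin by (simp add: ennreal_mult_eq_top_iff)
  ultimately show ?thesis by (simp add: ennreal_add_left_cancel_le)
qed

text \<open>A point where \<open>F\<close> is at least \<open>b + 1 / Suc n\<close> is a zero of the
  truncated difference \<open>(b + 1 / Suc n) - F\<close>, whose small averages there stay above
  \<open>1 / Suc n\<close>. The difference is bounded by a constant, hence integrable on balls
  whatever \<open>F\<close> is.\<close>

lemma AE_le_of_averages:
  assumes doubling: "weakly_doubling \<nu> d"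
    and F [measurable]: "F \<in> borel_measurable borel" and b: "0 \<le> b"
    and avg: "\<And>x. x \<in> S \<Longrightarrow> \<exists>e>0. \<forall>r. 0 < r \<and> r < e \<longrightarrow>
      (\<integral>\<^sup>+y\<in>mball x r. F y \<partial>\<nu>) \<le> ennreal b * emeasure \<nu> (mball x r)"
  shows "AE x in \<nu>. x \<in> S \<longrightarrow> F x \<le> ennreal b"
proof -
  have "AE x in \<nu>. x \<notin> {x \<in> S \<inter> mball 0 (real k). ennreal (b + 1 / Suc n) \<le> F x}" for k n :: nat
  proof (rule null_set_of_large_averages[OF doubling, of "\<lambda>x. ennreal (b + 1 / Suc n) - F x" "mball 0 (real k)" _ "1 / Suc n"])
    have "(\<integral>\<^sup>+x\<in>mball 0 (real k). (ennreal (b + 1 / Suc n) - F x) \<partial>\<nu>)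
        \<le> (\<integral>\<^sup>+x\<in>mball 0 (real k). ennreal (b + 1 / Suc n) \<partial>\<nu>)"
      by (intro nn_integral_mono mult_right_mono diff_le_self_ennreal) auto
    also have "\<dots> = ennreal (b + 1 / Suc n) * emeasure \<nu> (mball 0 (real k))"
      by (subst nn_integral_cmult_indicator) auto
    also have "\<dots> < \<infinity>"
      using emeasure_mball_finite[of 0 "real k"] by (simp add: ennreal_mult_less_top)
    finally show "(\<integral>\<^sup>+x\<in>mball 0 (real k). (ennreal (b + 1 / Suc n) - F x) \<partial>\<nu>) < \<infinity>" .
  next
    fix x assume "x \<in> {x \<in> S \<inter> mball 0 (real k). ennreal (b + 1 / Suc n) \<le> F x}"
    then have x: "x \<in> S" by auto
    have "ennreal (1 / Suc n) * emeasure \<nu> (mball x r) \<le> (\<integral>\<^sup>+y\<in>mball x r. (ennreal (b + 1 / Suc n) - F y) \<partial>\<nu>)"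
      if "(\<integral>\<^sup>+y\<in>mball x r. F y \<partial>\<nu>) \<le> ennreal b * emeasure \<nu> (mball x r)" for r
    proof (rule set_nn_integral_average_diff[where F = F and H = "\<lambda>_. ennreal (b + 1 / Suc n)"])
      show "ennreal (b + 1 / Suc n) \<le> ennreal (b + 1 / Suc n) - F y + F y" for y
        by (metis diff_add_cancel_ennreal le_add1 add.commute linorder_le_cases ennreal_ineq_diff_add add_increasing zero_le)
      show "ennreal (b + 1 / Suc n) * emeasure \<nu> (mball x r) \<le> (\<integral>\<^sup>+y\<in>mball x r. ennreal (b + 1 / Suc n) \<partial>\<nu>)"
        by (subst nn_integral_cmult_indicator) auto
    qed (use that b emeasure_mball_finite[of x r] in auto)
    with avg[OF x] show "\<exists>e>0. \<forall>r. 0 < r \<and> r < e \<longrightarrow> ennreal (1 / Suc n) * emeasure \<nu> (mball x r)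
        \<le> (\<integral>\<^sup>+y\<in>mball x r. (ennreal (b + 1 / Suc n) - F y) \<partial>\<nu>)" by blast
  qed (auto simp: diff_eq_0_iff_ennreal)
  then have "AE x in \<nu>. \<forall>k n. x \<notin> {x \<in> S \<inter> mball 0 (real k). ennreal (b + 1 / Suc n) \<le> F x}"
    by (simp only: AE_all_countable) simp
  then show ?thesis
  proof eventually_elim
    case (elim x)
    show ?case
    proof
      assume x: "x \<in> S"
      obtain k where "d 0 x < real k" using reals_Archimedean2 by blast
      with elim x have "F x \<le> ennreal (b + 1 / Suc n)" for n by (auto simp: not_le less_imp_le)
      moreover have "(\<lambda>n. b + 1 / real (Suc n)) \<longlonglongrightarrow> b + 0"
        using LIMSEQ_Suc[OF lim_1_over_n] by (intro tendsto_add tendsto_const) simp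
      then have "(\<lambda>n. ennreal (b + 1 / real (Suc n))) \<longlonglongrightarrow> ennreal b"
        by (intro tendsto_ennrealI) simp
      ultimately show "F x \<le> ennreal b" by (intro LIMSEQ_le_const) blast+
    qed
  qed
qed

text \<open>Now the exceptional points are zeros of the truncated difference \<open>F - c\<close>
  with \<open>c < a\<close>. This is dominated only by \<open>F\<close>, so local integrability
  enters, through countably many open sets with finite integral that cover \<open>S\<close>.\<close>

lemma AE_ge_of_averages:
  assumes doubling: "weakly_doubling \<nu> d"
    and F [measurable]: "F \<in> borel_measurable borel" and a: "0 \<le> a"
    and loc: "\<And>x. x \<in> S \<Longrightarrow> \<exists>e>0. (\<integral>\<^sup>+y\<in>mball x e. F y \<partial>\<nu>) < \<infinity>"
    and avg: "\<And>x. x \<in> S \<Longrightarrow> \<exists>e>0. \<forall>r. 0 < r \<and> r < e \<longrightarrow>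
      ennreal a * emeasure \<nu> (mball x r) \<le> (\<integral>\<^sup>+y\<in>mball x r. F y \<partial>\<nu>)"
  shows "AE x in \<nu>. x \<in> S \<longrightarrow> ennreal a \<le> F x"
proof (cases "a = 0")
  case False
  with a have a: "a > 0" by simp
  obtain \<V> where \<V>: "countable \<V>" "\<V> \<subseteq> {U. open U \<and> (\<integral>\<^sup>+y\<in>U. F y \<partial>\<nu>) < \<infinity>}"
    "\<Union>\<V> = \<Union>{U. open U \<and> (\<integral>\<^sup>+y\<in>U. F y \<partial>\<nu>) < \<infinity>}"
  proof (rule countable_open_subcover[OF second_countable, of "{U. open U \<and> (\<integral>\<^sup>+y\<in>U. F y \<partial>\<nu>) < \<infinity>}"])
    show "open U" if "U \<in> {U. open U \<and> (\<integral>\<^sup>+y\<in>U. F y \<partial>\<nu>) < \<infinity>}" for U using that by auto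
  qed (rule that)
  \<comment> \<open>\<open>c n\<close> increases to \<open>a\<close>, so a point with
    \<open>F x < a\<close> has \<open>F x \<le> c n\<close> for some \<open>n\<close>; the gap
    \<open>s n\<close> is the positive lower bound for the averages of the difference.\<close>
  define c where "c n = a * (1 - 1 / Suc n)" for n :: nat
  define s where "s n = a * (1 / Suc n)" for n :: nat
  have cs: "c n \<ge> 0" "s n > 0" "c n + s n = a" for n
    using a unfolding c_def s_def distrib_left[symmetric] by auto
  have "AE x in \<nu>. x \<notin> {x \<in> S \<inter> U. F x \<le> ennreal (c n)}" if U: "U \<in> \<V>" for U and n :: nat
  proof (rule null_set_of_large_averages[OF doubling, of "\<lambda>x. F x - ennreal (c n)" U _ "s n"])
    show "open U" using U \<V> by auto
    have "(\<integral>\<^sup>+x\<in>U. (F x - ennreal (c n)) \<partial>\<nu>) \<le> (\<integral>\<^sup>+x\<in>U. F x \<partial>\<nu>)"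
      by (intro nn_integral_mono mult_right_mono diff_le_self_ennreal) auto
    also have "\<dots> < \<infinity>" using U \<V> by auto
    finally show "(\<integral>\<^sup>+x\<in>U. (F x - ennreal (c n)) \<partial>\<nu>) < \<infinity>" .
  next
    fix x assume "x \<in> {x \<in> S \<inter> U. F x \<le> ennreal (c n)}"
    then have x: "x \<in> S" by auto
    have "ennreal (s n) * emeasure \<nu> (mball x r) \<le> (\<integral>\<^sup>+y\<in>mball x r. (F y - ennreal (c n)) \<partial>\<nu>)"
      if "ennreal a * emeasure \<nu> (mball x r) \<le> (\<integral>\<^sup>+y\<in>mball x r. F y \<partial>\<nu>)" for r
    proof (rule set_nn_integral_average_diff[where F = "\<lambda>_. ennreal (c n)" and H = F])
      show "F y \<le> F y - ennreal (c n) + ennreal (c n)" for y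
        by (metis diff_add_cancel_ennreal linorder_le_cases add_increasing zero_le)
      show "(\<integral>\<^sup>+y\<in>mball x r. ennreal (c n) \<partial>\<nu>) \<le> ennreal (c n) * emeasure \<nu> (mball x r)"
        by (subst nn_integral_cmult_indicator) auto
    qed (use that cs less_imp_le[OF cs(2)] emeasure_mball_finite[of x r] in auto)
    with avg[OF x] show "\<exists>e>0. \<forall>r. 0 < r \<and> r < e \<longrightarrow> ennreal (s n) * emeasure \<nu> (mball x r)
        \<le> (\<integral>\<^sup>+y\<in>mball x r. (F y - ennreal (c n)) \<partial>\<nu>)" by blast
  qed (auto simp: diff_eq_0_iff_ennreal cs intro: le_less_trans[OF _ ennreal_less_top])
  then have "AE x in \<nu>. \<forall>U\<in>\<V>. \<forall>n. x \<notin> {x \<in> S \<inter> U. F x \<le> ennreal (c n)}"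
    by (simp only: AE_ball_countable[OF \<V>(1)] AE_all_countable) blast
  then show ?thesis
  proof eventually_elim
    case (elim x)
    show ?case
    proof
      assume x: "x \<in> S"
      then obtain e where "e > 0" "(\<integral>\<^sup>+y\<in>mball x e. F y \<partial>\<nu>) < \<infinity>" using loc by blast
      then have "x \<in> \<Union>\<V>" unfolding \<V>(3) by (intro UnionI[of "mball x e"]) auto
      with elim x have "ennreal (c n) \<le> F x" for n by (auto simp: not_le less_imp_le)
      moreover have "(\<lambda>n. a * (1 - 1 / real (Suc n))) \<longlonglongrightarrow> a * (1 - 0)"
        using LIMSEQ_Suc[OF lim_1_over_n] by (intro tendsto_mult tendsto_diff tendsto_const) simp
      then have "(\<lambda>n. ennreal (c n)) \<longlonglongrightarrow> ennreal a"
        unfolding c_def by (intro tendsto_ennrealI) simp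
      ultimately show "ennreal a \<le> F x" by (intro LIMSEQ_le_const2) blast+
    qed
  qed
qed simp

end

section \<open>Square integrable functions\<close>

text \<open>Extended nonnegative values allow Tonelli, Weil's formula and estimates before
  membership in \<open>L2\<close> is known.\<close>

definition sq_norm :: "'a measure \<Rightarrow> ('a \<Rightarrow> complex) \<Rightarrow> ennreal" where
  "sq_norm M f = (\<integral>\<^sup>+x. ennreal ((cmod (f x))\<^sup>2) \<partial>M)"

lemma L2_iff: "f \<in> L2 M \<longleftrightarrow> f \<in> borel_measurable M \<and> sq_norm M f < \<infinity>"
  unfolding L2_def sq_norm_def
  by (auto simp: integrable_iff_bounded borel_measurable_power borel_measurable_norm)

lemma norm_L2_nonneg [simp]: "0 \<le> norm_L2 M f"
  by (simp add: norm_L2_def)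

lemma norm_L2_sq: "(norm_L2 M f)\<^sup>2 = (LINT x|M. (cmod (f x))\<^sup>2)"
  by (simp add: norm_L2_def)

lemma sq_norm_eq: "f \<in> L2 M \<Longrightarrow> sq_norm M f = ennreal ((norm_L2 M f)\<^sup>2)"
  unfolding norm_L2_sq sq_norm_def by (subst nn_integral_eq_integral) (auto simp: L2_def)

lemma norm_L2_eq: "f \<in> L2 M \<Longrightarrow> norm_L2 M f = sqrt (enn2real (sq_norm M f))"
  by (simp add: sq_norm_eq real_sqrt_abs)

lemma cmod_add_sq_le: "(cmod (a + b))\<^sup>2 \<le> 2 * (cmod a)\<^sup>2 + 2 * (cmod b)\<^sup>2"
proof -
  have "(cmod (a + b))\<^sup>2 \<le> (cmod a + cmod b)\<^sup>2"
    by (intro power_mono norm_triangle_ineq) simp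
  also have "\<dots> \<le> 2 * (cmod a)\<^sup>2 + 2 * (cmod b)\<^sup>2"
    using sum_squares_bound[of "cmod a" "cmod b"] by (simp add: power2_sum)
  finally show ?thesis .
qed

lemma L2_add:
  assumes "f \<in> L2 M" "g \<in> L2 M"
  shows "(\<lambda>x. f x + g x) \<in> L2 M"
proof -
  have [measurable]: "f \<in> borel_measurable M" "g \<in> borel_measurable M" using assms by (auto simp: L2_def)
  have "integrable M (\<lambda>x. 2 * (cmod (f x))\<^sup>2 + 2 * (cmod (g x))\<^sup>2)"
    using assms by (auto simp: L2_def)
  then have "integrable M (\<lambda>x. (cmod (f x + g x))\<^sup>2)"
    by (rule Bochner_Integration.integrable_bound) (auto intro!: order_trans[OF cmod_add_sq_le])
  then show ?thesis by (simp add: L2_def)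
qed

lemma L2_cmult: "f \<in> L2 M \<Longrightarrow> (\<lambda>x. c * f x) \<in> L2 M"
  by (auto simp: L2_def norm_mult power_mult_distrib)

lemma L2_diff: "f \<in> L2 M \<Longrightarrow> g \<in> L2 M \<Longrightarrow> (\<lambda>x. f x - g x) \<in> L2 M"
  using L2_add[OF _ L2_cmult[of g M "-1"], of f] by simp

lemma L2_bound:
  assumes "g \<in> L2 M" "f \<in> borel_measurable M" "\<And>x. x \<in> space M \<Longrightarrow> cmod (f x) \<le> c * cmod (g x)"
  shows "f \<in> L2 M"
proof -
  have [measurable]: "f \<in> borel_measurable M" "g \<in> borel_measurable M" using assms by (auto simp: L2_def)
  have "integrable M (\<lambda>x. c\<^sup>2 * (cmod (g x))\<^sup>2)" using assms by (auto simp: L2_def)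
  then have "integrable M (\<lambda>x. (cmod (f x))\<^sup>2)"
    by (rule Bochner_Integration.integrable_bound)
      (auto intro!: AE_I2 order_trans[OF power_mono[OF assms(3), of _ 2]] simp: power_mult_distrib)
  then show ?thesis by (simp add: L2_def)
qed

lemma cmod_mult_sq_le: "cmod (a * cnj b) \<le> (cmod a)\<^sup>2 + (cmod b)\<^sup>2"
proof -
  have "0 \<le> cmod a * cmod b" by simp
  then show ?thesis
    using sum_squares_bound[of "cmod a" "cmod b"] unfolding norm_mult complex_mod_cnj by linarith
qed

lemma measurable_cnj [measurable]: "cnj \<in> borel \<rightarrow>\<^sub>M borel"
  by (intro borel_measurable_continuous_onI continuous_intros)

lemma integrable_L2_inner:
  assumes "f \<in> L2 M" "g \<in> L2 M"
  shows "integrable M (\<lambda>x. f x * cnj (g x))"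
proof -
  have [measurable]: "f \<in> borel_measurable M" "g \<in> borel_measurable M" using assms by (auto simp: L2_def)
  have "integrable M (\<lambda>x. (cmod (f x))\<^sup>2 + (cmod (g x))\<^sup>2)"
    using assms by (auto simp: L2_def)
  then show ?thesis
    by (rule Bochner_Integration.integrable_bound)
      (auto intro!: AE_I2 order_trans[OF cmod_mult_sq_le])
qed

lemma inner_L2_add_left:
  assumes "f \<in> L2 M" "g \<in> L2 M" "h \<in> L2 M"
  shows "inner_L2 M (\<lambda>x. f x + g x) h = inner_L2 M f h + inner_L2 M g h"
  using assms by (simp add: inner_L2_def distrib_right integrable_L2_inner)

lemma inner_L2_diff_left:
  assumes "f \<in> L2 M" "g \<in> L2 M" "h \<in> L2 M"
  shows "inner_L2 M (\<lambda>x. f x - g x) h = inner_L2 M f h - inner_L2 M g h"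
  using assms by (simp add: inner_L2_def left_diff_distrib integrable_L2_inner)

lemma inner_L2_diff_right:
  assumes "f \<in> L2 M" "g \<in> L2 M" "h \<in> L2 M"
  shows "inner_L2 M h (\<lambda>x. f x - g x) = inner_L2 M h f - inner_L2 M h g"
  using assms by (simp add: inner_L2_def right_diff_distrib integrable_L2_inner)

lemma inner_L2_self: "inner_L2 M f f = complex_of_real ((norm_L2 M f)\<^sup>2)"
proof -
  have "inner_L2 M f f = (LINT x|M. complex_of_real ((cmod (f x))\<^sup>2))"
    by (simp only: inner_L2_def complex_norm_square)
  then show ?thesis unfolding norm_L2_sq by (simp only: integral_complex_of_real)
qed

lemma cmod_inner_L2_le:
  assumes "f \<in> L2 M" "g \<in> L2 M"
  shows "cmod (inner_L2 M f g) \<le> norm_L2 M f * norm_L2 M g"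
proof -
  have [measurable]: "f \<in> borel_measurable M" "g \<in> borel_measurable M" using assms by (auto simp: L2_def)
  have "ennreal (cmod (inner_L2 M f g)) \<le> (\<integral>\<^sup>+x. ennreal (cmod (f x * cnj (g x))) \<partial>M)"
    unfolding inner_L2_def by (rule integral_norm_bound_ennreal[OF integrable_L2_inner[OF assms]])
  also have "\<dots> = (\<integral>\<^sup>+x. ennreal (cmod (f x)) * ennreal (cmod (g x)) \<partial>M)"
    by (simp add: norm_mult ennreal_mult)
  finally have "(ennreal (cmod (inner_L2 M f g)))\<^sup>2 \<le> (\<integral>\<^sup>+x. ennreal (cmod (f x)) * ennreal (cmod (g x)) \<partial>M)\<^sup>2"
    by (intro power_mono) auto
  also have "\<dots> \<le> (\<integral>\<^sup>+x. (ennreal (cmod (f x)))\<^sup>2 \<partial>M) * (\<integral>\<^sup>+x. (ennreal (cmod (g x)))\<^sup>2 \<partial>M)"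
    by (rule Cauchy_Schwarz_nn_integral) auto
  also have "\<dots> = sq_norm M f * sq_norm M g"
    by (simp add: sq_norm_def ennreal_power)
  also have "\<dots> = ennreal ((norm_L2 M f * norm_L2 M g)\<^sup>2)"
    using assms by (simp add: sq_norm_eq ennreal_mult power_mult_distrib)
  finally have "(cmod (inner_L2 M f g))\<^sup>2 \<le> (norm_L2 M f * norm_L2 M g)\<^sup>2"
    by (simp add: ennreal_power)
  then show ?thesis by (rule power2_le_imp_le) simp
qed

lemma norm_L2_add_sq:
  assumes "f \<in> L2 M" "g \<in> L2 M"
  shows "(norm_L2 M (\<lambda>x. f x + g x))\<^sup>2 = (norm_L2 M f)\<^sup>2 + (norm_L2 M g)\<^sup>2 + 2 * Re (inner_L2 M f g)"
proof -
  have "(cmod (a + b))\<^sup>2 = (cmod a)\<^sup>2 + (cmod b)\<^sup>2 + 2 * Re (a * cnj b)" for a b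
    unfolding cmod_power2 by (simp add: power2_sum)
  then have "(norm_L2 M (\<lambda>x. f x + g x))\<^sup>2 =
      (LINT x|M. (cmod (f x))\<^sup>2 + (cmod (g x))\<^sup>2 + 2 * Re (f x * cnj (g x)))"
    unfolding norm_L2_sq by simp
  also have "\<dots> = (LINT x|M. (cmod (f x))\<^sup>2) + (LINT x|M. (cmod (g x))\<^sup>2) + (LINT x|M. 2 * Re (f x * cnj (g x)))"
    using assms integrable_mult_right[OF integrable_Re[OF integrable_L2_inner[OF assms]], of 2]
    by (subst Bochner_Integration.integral_add, simp_all only: L2_def mem_Collect_eq Bochner_Integration.integrable_add)+
  also have "(LINT x|M. 2 * Re (f x * cnj (g x))) = 2 * Re (inner_L2 M f g)"
    unfolding inner_L2_def integral_Re[OF integrable_L2_inner[OF assms], symmetric]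
    by (rule integral_mult_right_zero)
  finally have "(norm_L2 M (\<lambda>x. f x + g x))\<^sup>2 =
      (LINT x|M. (cmod (f x))\<^sup>2) + (LINT x|M. (cmod (g x))\<^sup>2) + 2 * Re (inner_L2 M f g)" .
  then show ?thesis unfolding norm_L2_sq .
qed

lemma norm_L2_triangle:
  assumes "f \<in> L2 M" "g \<in> L2 M"
  shows "norm_L2 M (\<lambda>x. f x + g x) \<le> norm_L2 M f + norm_L2 M g"
proof (rule power2_le_imp_le)
  have "Re (inner_L2 M f g) \<le> norm_L2 M f * norm_L2 M g"
    using cmod_inner_L2_le[OF assms] complex_Re_le_cmod[of "inner_L2 M f g"] by simp
  then show "(norm_L2 M (\<lambda>x. f x + g x))\<^sup>2 \<le> (norm_L2 M f + norm_L2 M g)\<^sup>2"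
    by (simp add: norm_L2_add_sq[OF assms] power2_sum)
qed simp

lemma norm_L2_cmult: "norm_L2 M (\<lambda>x. c * f x) = cmod c * norm_L2 M f"
  by (simp add: norm_L2_def norm_mult power_mult_distrib real_sqrt_mult)

lemma inner_L2_cmult_right: "inner_L2 M f (\<lambda>x. c * g x) = cnj c * inner_L2 M f g"
  by (simp add: inner_L2_def mult.left_commute)

lemma inner_L2_cmult_left: "inner_L2 M (\<lambda>x. c * f x) g = c * inner_L2 M f g"
  by (simp add: inner_L2_def mult.assoc)

text \<open>The real part is read off from \<open>f + g\<close> and the imaginary part from
  \<open>f + \<i> * g\<close>. Hence a linear map that preserves \<open>norm_L2\<close> preserves
  \<open>inner_L2\<close>.\<close>

lemma inner_L2_polarization:
  assumes "f \<in> L2 M" "g \<in> L2 M"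
  shows "inner_L2 M f g = Complex
    (((norm_L2 M (\<lambda>x. f x + g x))\<^sup>2 - (norm_L2 M f)\<^sup>2 - (norm_L2 M g)\<^sup>2) / 2)
    (((norm_L2 M (\<lambda>x. f x + \<i> * g x))\<^sup>2 - (norm_L2 M f)\<^sup>2 - (norm_L2 M g)\<^sup>2) / 2)"
proof (rule complex_eqI)
  show "Im (inner_L2 M f g) = Im (Complex
    (((norm_L2 M (\<lambda>x. f x + g x))\<^sup>2 - (norm_L2 M f)\<^sup>2 - (norm_L2 M g)\<^sup>2) / 2)
    (((norm_L2 M (\<lambda>x. f x + \<i> * g x))\<^sup>2 - (norm_L2 M f)\<^sup>2 - (norm_L2 M g)\<^sup>2) / 2))"
    using assms by (simp add: norm_L2_add_sq L2_cmult norm_L2_cmult inner_L2_cmult_right)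
qed (use assms in \<open>simp add: norm_L2_add_sq\<close>)

lemma tendsto_L2_norm:
  assumes "\<And>n. u n \<in> L2 M" "f \<in> L2 M" "tendsto_L2 M u f"
  shows "(\<lambda>n. norm_L2 M (\<lambda>x. u n x - f x)) \<longlonglongrightarrow> 0"
proof -
  have "(\<lambda>n. sq_norm M (\<lambda>x. u n x - f x)) \<longlonglongrightarrow> ennreal 0"
    using assms(3) by (simp add: tendsto_L2_def sq_norm_def)
  then have "(\<lambda>n. sqrt (enn2real (sq_norm M (\<lambda>x. u n x - f x)))) \<longlonglongrightarrow> sqrt 0"
    by (intro tendsto_real_sqrt tendsto_enn2real) auto
  then show ?thesis using assms by (simp add: norm_L2_eq L2_diff)
qed

text \<open>Cauchy-Schwarz leaves a factor \<open>norm_L2 M (v n)\<close> that varies with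
  \<open>n\<close>; the triangle inequality replaces it by \<open>norm_L2 M g\<close> plus a null
  sequence.\<close>

lemma tendsto_inner_L2:
  assumes u: "\<And>n. u n \<in> L2 M" "f \<in> L2 M" "tendsto_L2 M u f"
    and v: "\<And>n. v n \<in> L2 M" "g \<in> L2 M" "tendsto_L2 M v g"
  shows "(\<lambda>n. inner_L2 M (u n) (v n)) \<longlonglongrightarrow> inner_L2 M f g"
proof -
  let ?a = "\<lambda>n. norm_L2 M (\<lambda>x. u n x - f x)" and ?b = "\<lambda>n. norm_L2 M (\<lambda>x. v n x - g x)"
  have bound: "cmod (inner_L2 M (u n) (v n) - inner_L2 M f g) \<le> ?a n * (?b n + norm_L2 M g) + norm_L2 M f * ?b n" for n
  proof -
    have "inner_L2 M (u n) (v n) - inner_L2 M f g =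
        inner_L2 M (\<lambda>x. u n x - f x) (v n) + inner_L2 M f (\<lambda>x. v n x - g x)"
      using u v by (simp add: inner_L2_diff_left inner_L2_diff_right)
    also have "cmod \<dots> \<le> ?a n * norm_L2 M (v n) + norm_L2 M f * ?b n"
      using u v by (intro order_trans[OF norm_triangle_ineq] add_mono cmod_inner_L2_le L2_diff)
    also have "norm_L2 M (v n) \<le> ?b n + norm_L2 M g"
      using norm_L2_triangle[OF L2_diff[OF v(1)[of n] v(2)] v(2)] by simp
    finally show ?thesis by (simp add: mult_left_mono)
  qed
  have "(\<lambda>n. ?a n * (?b n + norm_L2 M g) + norm_L2 M f * ?b n) \<longlonglongrightarrow> 0 * (0 + norm_L2 M g) + norm_L2 M f * 0"
    by (intro tendsto_add tendsto_mult tendsto_const tendsto_L2_norm[OF u] tendsto_L2_norm[OF v])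
  then have "(\<lambda>n. ?a n * (?b n + norm_L2 M g) + norm_L2 M f * ?b n) \<longlonglongrightarrow> 0" by simp
  then have "(\<lambda>n. inner_L2 M (u n) (v n) - inner_L2 M f g) \<longlonglongrightarrow> 0"
    by (rule Lim_null_comparison[OF always_eventually, rotated]) (use bound in blast)
  then show ?thesis by (simp add: LIM_zero_iff)
qed

lemma inner_L2_add_right:
  assumes "f \<in> L2 M" "g \<in> L2 M" "h \<in> L2 M"
  shows "inner_L2 M h (\<lambda>x. f x + g x) = inner_L2 M h f + inner_L2 M h g"
  using assms by (simp add: inner_L2_def distrib_left integrable_L2_inner)

lemma norm_L2_mono: "f \<in> L2 M \<Longrightarrow> g \<in> L2 N \<Longrightarrow> sq_norm M f \<le> sq_norm N g \<Longrightarrow> norm_L2 M f \<le> norm_L2 N g"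
  by (rule power2_le_imp_le) (simp_all add: sq_norm_eq)

lemma sq_norm_cmult: "g \<in> borel_measurable M \<Longrightarrow> sq_norm M (\<lambda>x. c * g x) = ennreal ((cmod c)\<^sup>2) * sq_norm M g"
  unfolding sq_norm_def
  by (subst nn_integral_cmult[symmetric]) (auto simp: norm_mult power_mult_distrib ennreal_mult)

lemma sq_norm_unimodular_mult:
  "(\<And>x. cmod (c x) = 1) \<Longrightarrow> sq_norm M (\<lambda>x. g x * c x) = sq_norm M g"
  by (simp add: sq_norm_def norm_mult)

lemma integrable_complex_indicator:
  assumes "A \<in> sets M" "emeasure M A < \<infinity>"
  shows "integrable M (indicator A :: _ \<Rightarrow> complex)"
proof -
  have "(indicator A :: _ \<Rightarrow> complex) = (\<lambda>x. complex_of_real (indicator A x))"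
    by (auto simp: indicator_def)
  then show ?thesis
    using assms by (simp only:) (intro integrable_of_real, simp)
qed

lemma sq_norm_indicator:
  assumes "A \<in> sets M"
  shows "sq_norm M (indicator A) = emeasure M A"
proof -
  have "ennreal ((cmod (indicator A x))\<^sup>2) = indicator A x" for x
    by (simp add: indicator_def)
  then show ?thesis using assms by (simp add: sq_norm_def)
qed

section \<open>The dual group and the Fourier transform\<close>

lemma continuous_pairing: "continuous_on UNIV (pairing \<xi>)"
  and cmod_pairing [simp]: "cmod (pairing \<xi> x) = 1"
  and pairing_add: "pairing \<xi> (x + y) = pairing \<xi> x * pairing \<xi> y"
  using pairing[of \<xi>] by auto

lemma pairing_plus: "pairing (\<xi> + \<eta>) x = pairing \<xi> x * pairing \<eta> x"
  by transfer simp

lemma pairing_uminus: "pairing (- \<xi>) x = cnj (pairing \<xi> x)"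
  by transfer simp

lemma pairing_diff: "pairing (\<xi> - \<eta>) x = pairing \<xi> x * cnj (pairing \<eta> x)"
  by (simp only: diff_conv_add_uminus pairing_plus pairing_uminus)

lemma pairing_dual_0 [simp]: "pairing 0 x = 1"
  by transfer simp

lemma pairing_mult_cnj [simp]: "pairing \<xi> x * cnj (pairing \<xi> x) = 1"
  by (simp add: complex_norm_square[symmetric])

lemma pairing_0 [simp]: "pairing \<xi> 0 = 1"
proof -
  have "pairing \<xi> 0 * pairing \<xi> 0 = pairing \<xi> 0" using pairing_add[of \<xi> 0 0] by simp
  moreover have "pairing \<xi> 0 \<noteq> 0" using cmod_pairing[of \<xi> 0] by (metis norm_zero zero_neq_one)
  ultimately show ?thesis by simp
qed

lemma pairing_minus: "pairing \<xi> (- x) = cnj (pairing \<xi> x)"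
proof -
  have "pairing \<xi> (- x) * pairing \<xi> x = 1" using pairing_add[of \<xi> "- x" x] by simp
  then have "pairing \<xi> (- x) * (pairing \<xi> x * cnj (pairing \<xi> x)) = cnj (pairing \<xi> x)"
    by (simp only: mult.assoc[symmetric] mult_1_left)
  then show ?thesis by simp
qed

lemma pairing_eqI: "(\<And>x. pairing \<xi> x = pairing \<eta> x) \<Longrightarrow> \<xi> = \<eta>"
  by (metis ext pairing_inject)

lemma open_subbasic_dual: "compact K \<Longrightarrow> open U \<Longrightarrow> open {\<xi>. pairing \<xi> ` K \<subseteq> U}"
  unfolding open_dual_group_def by (rule generate_topology.Basis) blast

text \<open>Points are compact, so evaluation at a point where two characters differ gives subbasic
  sets that separate them.\<close>

instance dual_group :: (topological_ab_group_add) t2_space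
proof
  fix \<xi> \<eta> :: "'a dual_group" assume "\<xi> \<noteq> \<eta>"
  then obtain x where x: "pairing \<xi> x \<noteq> pairing \<eta> x" using pairing_eqI by blast
  obtain U V where UV: "open U" "open V" "pairing \<xi> x \<in> U" "pairing \<eta> x \<in> V" "U \<inter> V = {}"
    using hausdorff[OF x] by blast
  have "open {\<zeta>. pairing \<zeta> ` {x} \<subseteq> U}" "open {\<zeta>. pairing \<zeta> ` {x} \<subseteq> V}"
    using UV by (auto intro!: open_subbasic_dual simp del: image_subset_iff image_insert)
  then show "\<exists>U V. open U \<and> open V \<and> \<xi> \<in> U \<and> \<eta> \<in> V \<and> U \<inter> V = {}"
    using UV by (intro exI[of _ "{\<zeta>. pairing \<zeta> ` {x} \<subseteq> U}"] exI[of _ "{\<zeta>. pairing \<zeta> ` {x} \<subseteq> V}"]) auto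
qed

lemma Hausdorff_space_t2: "Hausdorff_space (euclidean :: 'a::t2_space topology)"
  using hausdorff unfolding Hausdorff_space_def disjnt_def by (metis open_openin)

lemma locally_compactE:
  assumes "locally_compact_space (euclidean :: 'a::t2_space topology)" "open W" "(x::'a) \<in> W"
  obtains V K where "open V" "compact K" "x \<in> V" "V \<subseteq> K" "K \<subseteq> W"
proof -
  have "neighbourhood_base_of (compactin euclidean) (euclidean :: 'a topology)"
    using assms(1) by (subst locally_compact_space_neighbourhood_base[symmetric]) (simp_all add: Hausdorff_space_t2)
  then have "\<exists>V K. open V \<and> compact K \<and> x \<in> V \<and> V \<subseteq> K \<and> K \<subseteq> W"
    using assms(2,3) unfolding neighbourhood_base_of open_openin[symmetric] compactin_euclidean_iff by blast
  then show thesis using that by blast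
qed

text \<open>Local compactness of the group supplies a compact neighbourhood \<open>K\<close> that
  \<open>pairing (fst z)\<close> maps into \<open>U\<close>. The characters mapping \<open>K\<close>
  into \<open>U\<close> are a subbasic open set, and on its product with
  \<open>V \<subseteq> K\<close> the pairing stays in \<open>U\<close>.\<close>

lemma continuous_pairing_prod:
  assumes "locally_compact_space (euclidean :: 'g::{topological_ab_group_add, t2_space} topology)"
  shows "continuous_on UNIV (\<lambda>z :: 'g dual_group \<times> 'g. pairing (fst z) (snd z))"
  unfolding continuous_on_open_vimage[OF open_UNIV]
proof (intro allI impI)
  fix U :: "complex set" assume U: "open U"
  show "open ((\<lambda>z :: 'g dual_group \<times> 'g. pairing (fst z) (snd z)) -` U \<inter> UNIV)"
    unfolding open_prod_def
  proof
    fix z :: "'g dual_group \<times> 'g"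
    assume z: "z \<in> (\<lambda>z. pairing (fst z) (snd z)) -` U \<inter> UNIV"
    have "open (pairing (fst z) -` U)"
      using continuous_pairing[of "fst z"] U by (simp add: continuous_on_open_vimage)
    moreover have "snd z \<in> pairing (fst z) -` U" using z by simp
    ultimately obtain V K where VK: "open V" "compact K" "snd z \<in> V" "V \<subseteq> K" "K \<subseteq> pairing (fst z) -` U"
      by (rule locally_compactE[OF assms])
    let ?O = "{\<xi>. pairing \<xi> ` K \<subseteq> U}"
    have "z \<in> ?O \<times> V" using VK by (auto simp: mem_Times_iff)
    moreover have "?O \<times> V \<subseteq> (\<lambda>z. pairing (fst z) (snd z)) -` U \<inter> UNIV" using VK(4) by fastforce
    ultimately show "\<exists>A B. open A \<and> open B \<and> z \<in> A \<times> B \<and> A \<times> B \<subseteq> (\<lambda>z. pairing (fst z) (snd z)) -` U \<inter> UNIV"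
      using open_subbasic_dual[OF VK(2) U] VK(1) by (intro exI[of _ ?O] exI[of _ V] conjI)
  qed
qed

lemma sigma_finite_of_locally_compact:
  assumes "locally_compact_space (euclidean :: 'a::{t2_space, second_countable_topology} topology)"
    and sets: "sets M = sets (borel :: 'a measure)" and "\<And>K. compact K \<Longrightarrow> emeasure M K < \<infinity>"
  shows "sigma_finite_measure M"
proof
  let ?F = "{V :: 'a set. open V \<and> emeasure M V \<noteq> \<infinity>}"
  obtain \<V> where \<V>: "countable \<V>" "\<V> \<subseteq> ?F" "\<Union>\<V> = \<Union>?F"
  proof (rule countable_open_subcover[OF second_countable_euclidean, of ?F])
    show "open U" if "U \<in> ?F" for U using that by auto
  qed (rule that)
  have "x \<in> \<Union>?F" for x
  proof -
    obtain V K where "open V" "compact K" "x \<in> V" "V \<subseteq> K" "K \<subseteq> UNIV"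
      by (rule locally_compactE[OF assms(1) open_UNIV UNIV_I])
    moreover from this have "emeasure M V \<le> emeasure M K"
      by (intro emeasure_mono) (auto simp: sets compact_imp_closed borel_closed)
    ultimately show ?thesis using assms(3)[of K] by (auto simp: less_top)
  qed
  then show "\<exists>A. countable A \<and> A \<subseteq> sets M \<and> \<Union>A = space M \<and> (\<forall>a\<in>A. emeasure M a \<noteq> \<infinity>)"
    using \<V> sets_eq_imp_space_eq[OF sets] by (intro exI[of _ \<V>]) (auto simp: sets)
qed

lemma dual_automorphism_add:
  assumes "topological_automorphism a"
  shows "dual_automorphism a (\<xi> + \<eta>) = dual_automorphism a \<xi> + dual_automorphism a \<eta>"
  by (rule pairing_eqI) (simp add: pairing_dual_automorphism[OF assms] pairing_plus)

lemma dual_automorphism_diff: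
  assumes "topological_automorphism a"
  shows "dual_automorphism a (\<xi> - \<eta>) = dual_automorphism a \<xi> - dual_automorphism a \<eta>"
  by (rule pairing_eqI) (simp add: pairing_dual_automorphism[OF assms] pairing_diff)

lemma dual_automorphism_0:
  assumes "topological_automorphism a"
  shows "dual_automorphism a 0 = 0"
  using dual_automorphism_diff[OF assms, of 0 0] by simp

lemma topological_automorphism_inv:
  assumes "topological_automorphism a"
  shows "topological_automorphism (inv a)"
  unfolding topological_automorphism_def
proof (intro conjI allI)
  have a: "bij a" "\<And>x y. a (x + y) = a x + a y" "continuous_on UNIV a" "continuous_on UNIV (inv a)"
    using assms by (auto simp: topological_automorphism_def)
  show "inv a (x + y) = inv a x + inv a y" for x y
    using a by (metis bij_inv_eq_iff)
  show "bij (inv a)" using a by (simp add: bij_imp_bij_inv)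
  show "continuous_on UNIV (inv a)" by (rule a)
  show "continuous_on UNIV (inv (inv a))" using a by (simp add: inv_inv_eq)
qed

lemma dual_automorphism_inverse:
  assumes "topological_automorphism a"
  shows "dual_automorphism a (dual_automorphism (inv a) \<xi>) = \<xi>"
    and "dual_automorphism (inv a) (dual_automorphism a \<xi>) = \<xi>"
proof -
  have "bij a" using assms by (simp add: topological_automorphism_def)
  then have "inv (inv a) (inv a x) = x" "inv a (inv (inv a) x) = x" for x
    by (simp_all add: inv_inv_eq bij_is_inj bij_is_surj surj_f_inv_f)
  then show "dual_automorphism a (dual_automorphism (inv a) \<xi>) = \<xi>"
    and "dual_automorphism (inv a) (dual_automorphism a \<xi>) = \<xi>"
    by (auto intro!: pairing_eqI
        simp: pairing_dual_automorphism assms topological_automorphism_inv)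
qed

lemma bij_dual_automorphism:
  assumes "topological_automorphism a"
  shows "bij (dual_automorphism a)"
  by (rule o_bij[of "dual_automorphism (inv a)"]) (auto simp: fun_eq_iff dual_automorphism_inverse[OF assms])

section \<open>Parseval, inversion for integrable functions, and measurability in the
  parameter\<close>

locale lca_plancherel = haar_metric_group d \<nu>
  for d :: "'g::{topological_ab_group_add, t2_space, second_countable_topology} dual_group \<Rightarrow> 'g dual_group \<Rightarrow> real"
    and \<nu> :: "'g dual_group measure" +
  fixes \<mu> :: "'g measure"
  assumes locally_compact: "locally_compact_space (euclidean :: 'g topology)"
    and haar_\<mu>: "haar_measure euclidean \<mu>"
    and plancherel: "plancherel_measure \<mu> \<nu>"
begin

lemma space_\<mu> [simp]: "space \<mu> = UNIV"
  and sets_\<mu> [simp, measurable_cong]: "sets \<mu> = sets borel"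
  using haar_measure_euclideanD[OF haar_\<mu>] by auto

sublocale \<mu>: sigma_finite_measure \<mu>
  using haar_measure_euclideanD(4)[OF haar_\<mu>]
  by (intro sigma_finite_of_locally_compact locally_compact) auto

sublocale pair_sigma_finite \<nu> \<mu> ..

lemma measurable_pairing_prod [measurable]:
  "(\<lambda>z :: 'g dual_group \<times> 'g. pairing (fst z) (snd z)) \<in> borel \<Otimes>\<^sub>M borel \<rightarrow>\<^sub>M borel"
  by (intro borel_measurable_continuous_pair second_countable second_countable_euclidean
      continuous_pairing_prod locally_compact)

lemma measurable_pairing' [measurable (raw)]:
  assumes [measurable]: "f \<in> M \<rightarrow>\<^sub>M (borel :: 'g dual_group measure)" "g \<in> M \<rightarrow>\<^sub>M (borel :: 'g measure)"
  shows "(\<lambda>x. pairing (f x) (g x)) \<in> borel_measurable M"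
  using measurable_compose[OF measurable_Pair[OF assms] measurable_pairing_prod] by simp

text \<open>An integral at every single \<open>x\<close>, not a class modulo null sets: its values
  on \<open>\<Gamma>\<close>, which may be a null set, have to make sense.\<close>

definition inv_fourier :: "('g dual_group \<Rightarrow> complex) \<Rightarrow> 'g \<Rightarrow> complex" where
  "inv_fourier F x = (LINT \<xi>|\<nu>. F \<xi> * pairing \<xi> x)"

lemma measurable_inv_fourier [measurable]:
  assumes [measurable]: "F \<in> borel_measurable borel"
  shows "inv_fourier F \<in> borel_measurable borel"
  unfolding inv_fourier_def by measurable

lemma measurable_fourier [measurable]:
  assumes [measurable]: "f \<in> borel_measurable borel"
  shows "fourier \<mu> f \<in> borel_measurable borel"
  unfolding fourier_def by measurable

lemma integrable_mult_pairing:
  "integrable \<nu> F \<Longrightarrow> integrable \<nu> (\<lambda>\<xi>. F \<xi> * pairing \<xi> x)"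
  by (rule Bochner_Integration.integrable_bound) (auto simp: norm_mult)

lemma integrable_mult_cnj_pairing:
  "integrable \<mu> f \<Longrightarrow> integrable \<mu> (\<lambda>x. f x * cnj (pairing \<xi> x))"
  by (rule Bochner_Integration.integrable_bound) (auto simp: norm_mult)

lemma fourier_add_cmult:
  assumes "integrable \<mu> f" "integrable \<mu> g"
  shows "fourier \<mu> (\<lambda>x. f x + c * g x) \<xi> = fourier \<mu> f \<xi> + c * fourier \<mu> g \<xi>"
  using assms[THEN integrable_mult_cnj_pairing]
  by (simp add: fourier_def distrib_right mult.assoc)

lemma parseval_L1_L2:
  assumes f: "integrable \<mu> f" "f \<in> L2 \<mu>" and g: "integrable \<mu> g" "g \<in> L2 \<mu>"
  shows "inner_L2 \<nu> (fourier \<mu> f) (fourier \<mu> g) = inner_L2 \<mu> f g"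
proof -
  have P: "fourier \<mu> h \<in> L2 \<nu>" "norm_L2 \<nu> (fourier \<mu> h) = norm_L2 \<mu> h"
    if "integrable \<mu> h" "h \<in> L2 \<mu>" for h
    using plancherel that by (auto simp: plancherel_measure_def)
  have "norm_L2 \<nu> (\<lambda>\<xi>. fourier \<mu> f \<xi> + c * fourier \<mu> g \<xi>) = norm_L2 \<mu> (\<lambda>x. f x + c * g x)" for c
  proof -
    have "fourier \<mu> (\<lambda>x. f x + c * g x) = (\<lambda>\<xi>. fourier \<mu> f \<xi> + c * fourier \<mu> g \<xi>)"
      using f g by (intro ext fourier_add_cmult)
    then show ?thesis
      using P(2)[of "\<lambda>x. f x + c * g x"] f g by (simp add: L2_add L2_cmult)
  qed
  from this[of 1] this[of \<i>] show ?thesis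
    using f g P by (simp add: inner_L2_polarization)
qed

lemma parseval:
  assumes "is_fourier_L2 \<mu> \<nu> f F" "is_fourier_L2 \<mu> \<nu> g G"
  shows "inner_L2 \<mu> f g = inner_L2 \<nu> F G"
proof -
  obtain u where u: "\<And>n. integrable \<mu> (u n)" "\<And>n. u n \<in> L2 \<mu>" "tendsto_L2 \<mu> u f"
    "tendsto_L2 \<nu> (\<lambda>n. fourier \<mu> (u n)) F" "f \<in> L2 \<mu>" "F \<in> L2 \<nu>"
    using assms(1) unfolding is_fourier_L2_def by blast
  obtain v where v: "\<And>n. integrable \<mu> (v n)" "\<And>n. v n \<in> L2 \<mu>" "tendsto_L2 \<mu> v g"
    "tendsto_L2 \<nu> (\<lambda>n. fourier \<mu> (v n)) G" "g \<in> L2 \<mu>" "G \<in> L2 \<nu>"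
    using assms(2) unfolding is_fourier_L2_def by blast
  have P: "fourier \<mu> h \<in> L2 \<nu>" if "integrable \<mu> h" "h \<in> L2 \<mu>" for h
    using plancherel that by (auto simp: plancherel_measure_def)
  have "(\<lambda>n. inner_L2 \<mu> (u n) (v n)) \<longlonglongrightarrow> inner_L2 \<mu> f g"
    by (intro tendsto_inner_L2 u v)
  moreover have "(\<lambda>n. inner_L2 \<nu> (fourier \<mu> (u n)) (fourier \<mu> (v n))) \<longlonglongrightarrow> inner_L2 \<nu> F G"
    by (intro tendsto_inner_L2 u v P)
  ultimately show ?thesis
    using LIMSEQ_unique by (simp add: parseval_L1_L2 u v) blast
qed

lemma is_fourier_L2_fourier:
  assumes "integrable \<mu> f" "f \<in> L2 \<mu>"
  shows "is_fourier_L2 \<mu> \<nu> f (fourier \<mu> f)"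
  using plancherel assms unfolding is_fourier_L2_def plancherel_measure_def
  by (auto intro!: exI[of _ "\<lambda>_. f"] simp: tendsto_L2_def)

lemma is_fourier_L2_AE_cong:
  assumes "is_fourier_L2 \<mu> \<nu> f F" and [measurable]: "g \<in> borel_measurable borel"
    and AE: "AE x in \<mu>. f x = g x"
  shows "is_fourier_L2 \<mu> \<nu> g F"
proof -
  have f: "f \<in> L2 \<mu>" using assms(1) by (simp add: is_fourier_L2_def)
  then have [measurable]: "f \<in> borel_measurable borel" by (auto simp: L2_def)
  have "sq_norm \<mu> g = sq_norm \<mu> f"
    unfolding sq_norm_def using AE by (intro nn_integral_cong_AE) auto
  then have "g \<in> L2 \<mu>" using f by (auto simp: L2_iff)
  moreover have "(\<integral>\<^sup>+x. ennreal ((cmod (u x - g x))\<^sup>2) \<partial>\<mu>) = (\<integral>\<^sup>+x. ennreal ((cmod (u x - f x))\<^sup>2) \<partial>\<mu>)" for u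
    using AE by (intro nn_integral_cong_AE) auto
  ultimately show ?thesis
    using assms(1) unfolding is_fourier_L2_def tendsto_L2_def by simp
qed

text \<open>Fubini, with the integrable majorant \<open>cmod (F \<xi>) * cmod (u x)\<close>, moves
  the transform from \<open>u\<close> to \<open>F\<close>.\<close>

lemma inner_L2_fourier_eq:
  assumes F: "integrable \<nu> F" and u: "integrable \<mu> u"
  shows "inner_L2 \<nu> F (fourier \<mu> u) = inner_L2 \<mu> (inv_fourier F) u"
proof -
  have [measurable]: "F \<in> borel_measurable borel" "u \<in> borel_measurable borel"
    using assms by (auto dest: borel_measurable_integrable)
  have int: "integrable (\<nu> \<Otimes>\<^sub>M \<mu>) (\<lambda>(\<xi>, x). F \<xi> * (cnj (u x) * pairing \<xi> x))"
  proof (rule Fubini_integrable)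
    have "(\<lambda>\<xi>. LINT x|\<mu>. norm (F \<xi> * (cnj (u x) * pairing \<xi> x))) = (\<lambda>\<xi>. norm (F \<xi>) * (LINT x|\<mu>. norm (u x)))"
      by (simp add: norm_mult)
    then show "integrable \<nu> (\<lambda>\<xi>. LINT x|\<mu>. norm (case (\<xi>, x) of (\<xi>, x) \<Rightarrow> F \<xi> * (cnj (u x) * pairing \<xi> x)))"
      using F by simp
    have "integrable \<mu> (\<lambda>x. cnj (u x) * pairing \<xi> x)" for \<xi>
      using integrable_cnj[OF integrable_mult_cnj_pairing[OF u, of \<xi>]] by simp
    then show "AE \<xi> in \<nu>. integrable \<mu> (\<lambda>x. case (\<xi>, x) of (\<xi>, x) \<Rightarrow> F \<xi> * (cnj (u x) * pairing \<xi> x))"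
      by simp
  qed measurable
  have "inner_L2 \<nu> F (fourier \<mu> u) = (LINT \<xi>|\<nu>. LINT x|\<mu>. F \<xi> * (cnj (u x) * pairing \<xi> x))"
  proof -
    have "cnj (fourier \<mu> u \<xi>) = (LINT x|\<mu>. cnj (u x) * pairing \<xi> x)" for \<xi>
      using Bochner_Integration.integral_cnj[of \<mu> "\<lambda>x. u x * cnj (pairing \<xi> x)"] by (simp add: fourier_def)
    then show ?thesis by (simp add: inner_L2_def)
  qed
  also have "\<dots> = (LINT x|\<mu>. LINT \<xi>|\<nu>. F \<xi> * (cnj (u x) * pairing \<xi> x))"
    using Fubini_integral[OF int] by simp
  also have "\<dots> = inner_L2 \<mu> (inv_fourier F) u"
    unfolding inner_L2_def inv_fourier_def
    by (simp add: mult.left_commute[of _ "cnj _"] mult.commute[of _ "cnj _"])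
  finally show ?thesis .
qed

lemma cmod_inv_fourier_le:
  "cmod (inv_fourier F x) \<le> (LINT \<xi>|\<nu>. cmod (F \<xi>))"
  unfolding inv_fourier_def
  by (rule order_trans[OF integral_norm_bound]) (simp add: norm_mult)

text \<open>Surjectivity of the extended transform yields some preimage \<open>f\<close> of
  \<open>F\<close>. It is identified with the explicit integral by testing both against integrable
  functions in \<open>L2\<close>, where Parseval on one side and Fubini on the other give equal
  inner products.\<close>

lemma is_fourier_L2_inv_fourier:
  assumes F: "integrable \<nu> F" "F \<in> L2 \<nu>"
  shows "is_fourier_L2 \<mu> \<nu> (inv_fourier F) F"
proof -
  have [measurable]: "F \<in> borel_measurable borel" using F by (auto simp: L2_def)
  obtain f where f: "is_fourier_L2 \<mu> \<nu> f F"
    using plancherel F by (auto simp: plancherel_measure_def)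
  then have f2: "f \<in> L2 \<mu>" by (simp add: is_fourier_L2_def)
  then have [measurable]: "f \<in> borel_measurable borel" by (auto simp: L2_def)
  define g where "g x = f x - inv_fourier F x" for x
  have [measurable]: "g \<in> borel_measurable borel" unfolding g_def by measurable
  obtain A :: "nat \<Rightarrow> 'g set" where A: "range A \<subseteq> sets \<mu>" "(\<Union>i. A i) = space \<mu>" "\<And>i. emeasure \<mu> (A i) \<noteq> \<infinity>"
    using \<mu>.sigma_finite by metis
  have "AE x in \<mu>. x \<in> A i \<longrightarrow> g x = 0" for i
  proof -
    have [measurable]: "A i \<in> sets borel" using A by auto
    \<comment> \<open>The test function is the difference itself, cut off to a set of finite
      measure. There \<open>inv_fourier F\<close> is square integrable because it is bounded, and
      square integrable functions are integrable.\<close>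
    define u where "u x = indicator (A i) x * g x" for x
    have [measurable]: "u \<in> borel_measurable borel" unfolding u_def by measurable
    have ind: "indicator (A i) \<in> L2 \<mu>"
    proof -
      have "ennreal ((cmod (indicator (A i) x))\<^sup>2) = indicator (A i) x" for x
        by (simp add: indicator_def)
      then show ?thesis using A(3)[of i] by (simp add: L2_iff sq_norm_def less_top)
    qed
    have "(\<lambda>x. indicator (A i) x * f x) \<in> L2 \<mu>"
      by (rule L2_bound[OF f2, where c = 1]) (auto simp: indicator_def)
    moreover have "(\<lambda>x. indicator (A i) x * inv_fourier F x) \<in> L2 \<mu>"
      by (rule L2_bound[OF ind, where c = "LINT \<xi>|\<nu>. cmod (F \<xi>)"]) (auto simp: indicator_def cmod_inv_fourier_le)
    ultimately have u2: "u \<in> L2 \<mu>"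
      using L2_diff[of "\<lambda>x. indicator (A i) x * f x" \<mu> "\<lambda>x. indicator (A i) x * inv_fourier F x"]
      by (simp add: u_def[abs_def] g_def right_diff_distrib)
    have u1: "integrable \<mu> u"
    proof -
      have "(\<lambda>x. u x * cnj (indicator (A i) x)) = u" by (auto simp: u_def indicator_def)
      then show ?thesis using integrable_L2_inner[OF u2 ind] by simp
    qed
    have "inner_L2 \<mu> f u = inner_L2 \<nu> F (fourier \<mu> u)"
      by (rule parseval[OF f is_fourier_L2_fourier[OF u1 u2]])
    also have "\<dots> = inner_L2 \<mu> (inv_fourier F) u" by (rule inner_L2_fourier_eq[OF F(1) u1])
    finally have eq: "inner_L2 \<mu> f u = inner_L2 \<mu> (inv_fourier F) u" .
    have int2: "integrable \<mu> (\<lambda>x. inv_fourier F x * cnj (u x))"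
    proof (rule Bochner_Integration.integrable_bound)
      show "integrable \<mu> (\<lambda>x. complex_of_real (LINT \<xi>|\<nu>. cmod (F \<xi>)) * u x)" using u1 by simp
    qed (auto simp: norm_mult intro!: AE_I2 mult_right_mono cmod_inv_fourier_le)
    have "inner_L2 \<mu> u u = (LINT x|\<mu>. f x * cnj (u x) - inv_fourier F x * cnj (u x))"
      unfolding inner_L2_def by (intro Bochner_Integration.integral_cong) (auto simp: u_def g_def indicator_def algebra_simps)
    also have "\<dots> = 0"
      using eq int2 integrable_L2_inner[OF f2 u2] by (simp add: inner_L2_def)
    finally have "norm_L2 \<mu> u = 0" by (simp add: inner_L2_self)
    then have "sq_norm \<mu> u = 0" using sq_norm_eq[OF u2] by simp
    then have "AE x in \<mu>. u x = 0" by (simp add: sq_norm_def nn_integral_0_iff_AE)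
    then show ?thesis by eventually_elim (auto simp: u_def indicator_def)
  qed
  then have "AE x in \<mu>. \<forall>i. x \<in> A i \<longrightarrow> g x = 0" by (simp only: AE_all_countable) simp
  then have "AE x in \<mu>. f x = inv_fourier F x"
  proof eventually_elim
    case (elim x)
    have "x \<in> (\<Union>i. A i)" using A(2) by simp
    with elim show ?case by (auto simp: g_def)
  qed
  then show ?thesis by (intro is_fourier_L2_AE_cong[OF f]) auto
qed

lemma measurable_translation_\<mu> [measurable]: "(\<lambda>x :: 'g. x - c) \<in> borel \<rightarrow>\<^sub>M borel"
  by (intro borel_measurable_continuous_onI continuous_intros)

lemma distr_translation_\<mu>: "distr \<mu> \<mu> (\<lambda>x. x - c) = \<mu>"
proof -
  have "(\<lambda>x :: 'g. x - c) = (+) (- c)" by auto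
  then show ?thesis using haar_measure_euclideanD(3)[OF haar_\<mu>, of "- c"] by simp
qed

lemma integrable_translation_\<mu>:
  fixes f :: "'g \<Rightarrow> complex"
  assumes "integrable \<mu> f"
  shows "integrable \<mu> (\<lambda>x. f (x - c))" "(LINT x|\<mu>. f (x - c)) = (LINT x|\<mu>. f x)"
proof -
  have [measurable]: "f \<in> borel_measurable borel" using assms by auto
  have "integrable (distr \<mu> \<mu> (\<lambda>x. x - c)) f" using assms by (simp add: distr_translation_\<mu>)
  then show "integrable \<mu> (\<lambda>x. f (x - c))"
    by (subst (asm) integrable_distr_eq) auto
  have "(LINT x|\<mu>. f x) = (LINT x|distr \<mu> \<mu> (\<lambda>x. x - c). f x)" by (simp add: distr_translation_\<mu>)
  also have "\<dots> = (LINT x|\<mu>. f (x - c))" by (subst integral_distr) auto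
  finally show "(LINT x|\<mu>. f (x - c)) = (LINT x|\<mu>. f x)" ..
qed

lemma nn_integral_translation_\<mu>:
  assumes [measurable]: "f \<in> borel_measurable borel"
  shows "(\<integral>\<^sup>+x. f (x - c) \<partial>\<mu>) = (\<integral>\<^sup>+x. f x \<partial>\<mu>)"
proof -
  have "(\<integral>\<^sup>+x. f x \<partial>\<mu>) = (\<integral>\<^sup>+x. f x \<partial>distr \<mu> \<mu> (\<lambda>x. x - c))" by (simp add: distr_translation_\<mu>)
  also have "\<dots> = (\<integral>\<^sup>+x. f (x - c) \<partial>\<mu>)" by (subst nn_integral_distr) auto
  finally show ?thesis ..
qed

lemma inv_fourier_indicator_translation:
  assumes [measurable]: "V \<in> sets borel"
  shows "inv_fourier (indicator ((+) \<zeta> ` V)) x = pairing \<zeta> x * inv_fourier (indicator V) x"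
proof -
  have dist: "distr \<nu> \<nu> ((+) \<zeta>) = \<nu>" by (rule haar_measure_euclideanD(3)[OF haar])
  have "(+) \<zeta> ` V = (+) (- \<zeta>) -` V"
  proof -
    have "x \<in> (+) \<zeta> ` V" if "- \<zeta> + x \<in> V" for x
      using that by (intro image_eqI[of _ _ "- \<zeta> + x"]) auto
    then show ?thesis by auto
  qed
  then have [measurable]: "(+) \<zeta> ` V \<in> sets borel"
    using measurable_sets[OF measurable_translation[of "- \<zeta>"], of V] by simp
  have "inv_fourier (indicator ((+) \<zeta> ` V)) x = (LINT \<xi>|distr \<nu> \<nu> ((+) \<zeta>). indicator ((+) \<zeta> ` V) \<xi> * pairing \<xi> x)"
    by (simp add: inv_fourier_def dist)
  also have "\<dots> = (LINT \<xi>|\<nu>. indicator ((+) \<zeta> ` V) (\<zeta> + \<xi>) * pairing (\<zeta> + \<xi>) x)"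
    by (subst integral_distr) auto
  also have "\<dots> = (LINT \<xi>|\<nu>. pairing \<zeta> x * (indicator V \<xi> * pairing \<xi> x))"
    by (intro Bochner_Integration.integral_cong) (auto simp: indicator_def pairing_plus)
  finally show ?thesis by (simp add: inv_fourier_def)
qed

lemma L1_L2_indicator:
  assumes "V \<in> sets borel" and "emeasure \<nu> V < \<infinity>"
  shows "integrable \<nu> (indicator V :: _ \<Rightarrow> complex)" "indicator V \<in> L2 \<nu>"
  using assms by (auto intro!: integrable_complex_indicator simp: L2_iff sq_norm_indicator)

text \<open>With \<open>W\<close> a translate of \<open>V\<close> this expresses an overlap in the
  dual group by an integral over the group itself; it is the link through which measurability of the
  automorphisms passes to their duals.\<close>

lemma inner_L2_inv_fourier_indicator:
  assumes [measurable]: "V \<in> sets borel" "W \<in> sets borel" and fin: "emeasure \<nu> V < \<infinity>" "emeasure \<nu> W < \<infinity>"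
  shows "inner_L2 \<mu> (inv_fourier (indicator W)) (inv_fourier (indicator V)) = complex_of_real (measure \<nu> (W \<inter> V))"
proof -
  have "inner_L2 \<mu> (inv_fourier (indicator W)) (inv_fourier (indicator V)) = inner_L2 \<nu> (indicator W) (indicator V)"
    by (intro parseval is_fourier_L2_inv_fourier L1_L2_indicator fin) measurable
  also have "\<dots> = (LINT x|\<nu>. complex_of_real (indicator (W \<inter> V) x))"
    unfolding inner_L2_def by (intro Bochner_Integration.integral_cong) (auto simp: indicator_def)
  also have "\<dots> = complex_of_real (measure \<nu> (W \<inter> V))"
    by (simp only: integral_complex_of_real) simp
  finally show ?thesis .
qed

text \<open>
  The sets \<open>\<zeta> + V - V\<close> with \<open>V\<close> a ball around \<open>0\<close> form a base of the topology, and
  \<open>\<alpha>\<^sub>h\<close> of the dual group maps \<open>\<xi>\<close> into such a set iff an integral over \<open>G\<close> that depends measurably on \<open>(h, \<xi>)\<close>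
  does not vanish.
\<close>

lemma measurable_dual_automorphism_prod:
  assumes aut: "\<And>h. topological_automorphism (\<alpha> h)"
    and \<alpha>: "(\<lambda>(x, h). \<alpha> h x) \<in> \<mu> \<Otimes>\<^sub>M \<sigma> \<rightarrow>\<^sub>M borel"
    and modulus: "modulus_function \<mu> \<sigma> \<alpha> \<delta>"
  shows "(\<lambda>(h, \<xi>). dual_automorphism (\<alpha> h) \<xi>) \<in> \<sigma> \<Otimes>\<^sub>M \<nu> \<rightarrow>\<^sub>M borel"
proof (rule borel_measurableI)
  have [measurable]: "(\<lambda>z. \<alpha> (snd z) (fst z)) \<in> \<mu> \<Otimes>\<^sub>M \<sigma> \<rightarrow>\<^sub>M borel"
    using \<alpha> by (simp add: split_beta')
  let ?T = "\<lambda>(h, \<xi>). dual_automorphism (\<alpha> h) \<xi>"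
  define P where "P \<zeta> r = (\<Union>v\<in>mball 0 r. mball (\<zeta> - v) r)" for \<zeta> r
  have P_open: "open (P \<zeta> r)" for \<zeta> r by (auto simp: P_def)
  have P_mem: "\<zeta> \<in> P \<zeta> r" if "r > 0" for \<zeta> r
    using that by (auto simp: P_def intro!: bexI[of _ 0])
  have P_sub: "P \<zeta> r \<subseteq> mball \<zeta> (2 * r)" for \<zeta> r
  proof
    fix x assume "x \<in> P \<zeta> r"
    then obtain v where v: "d 0 v < r" "d (\<zeta> - v) x < r" by (auto simp: P_def)
    have "d \<zeta> x \<le> d \<zeta> (\<zeta> - v) + d (\<zeta> - v) x" by (rule triangle_UNIV)
    also have "d \<zeta> (\<zeta> - v) = d 0 v"
      using dist_add_left[of \<zeta> 0 "- v"] dist_minus[of 0 v] by simp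
    finally show "x \<in> mball \<zeta> (2 * r)" using v by simp
  qed
  have P_iff: "\<xi> \<in> P \<zeta> r \<longleftrightarrow> (+) (\<zeta> - \<xi>) ` mball 0 r \<inter> mball 0 r \<noteq> {}" for \<zeta> \<xi> r
  proof -
    have e1: "d (\<zeta> - v) \<xi> = d 0 (\<zeta> - \<xi> + - v)" for v
    proof -
      have "d 0 (\<zeta> - \<xi> + - v) = d (0 + \<xi>) (\<zeta> - \<xi> + - v + \<xi>)" by (simp only: dist_add)
      also have "\<zeta> - \<xi> + - v + \<xi> = \<zeta> - v" by simp
      finally show ?thesis by (simp add: commute)
    qed
    have e2: "d 0 (- v) = d 0 v" for v using dist_minus[of 0 v] by simp
    have "\<xi> \<in> P \<zeta> r \<longleftrightarrow> (\<exists>v. d 0 v < r \<and> d 0 (\<zeta> - \<xi> + - v) < r)"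
      by (auto simp: P_def e1)
    also have "\<dots> \<longleftrightarrow> (\<exists>u. d 0 u < r \<and> d 0 (\<zeta> - \<xi> + u) < r)"
      by (metis minus_minus e2)
    also have "\<dots> \<longleftrightarrow> (+) (\<zeta> - \<xi>) ` mball 0 r \<inter> mball 0 r \<noteq> {}"
      by (auto simp: set_eq_iff image_iff Bex_def)
    finally show ?thesis .
  qed
  have P_meas: "?T -` P \<zeta> r \<inter> space (\<sigma> \<Otimes>\<^sub>M \<nu>) \<in> sets (\<sigma> \<Otimes>\<^sub>M \<nu>)" for \<zeta> r
  proof -
    define V where "V = mball 0 r"
    have [measurable]: "V \<in> sets borel" by (simp add: V_def)
    have finV: "emeasure \<nu> V < \<infinity>" unfolding V_def by (rule emeasure_mball_finite)
    define g where "g = inv_fourier (indicator V)"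
    have [measurable]: "g \<in> borel_measurable borel" unfolding g_def by measurable
    have g2: "g \<in> L2 \<mu>"
      using is_fourier_L2_inv_fourier[OF L1_L2_indicator[OF _ finV]] by (simp add: g_def is_fourier_L2_def)
    \<comment> \<open>Only \<open>\<alpha> h x\<close> enters the integrand, so \<open>w\<close> is
      jointly measurable. The two pairings together are the character
      \<open>\<zeta> - dual_automorphism (\<alpha> h) \<xi>\<close> evaluated at
      \<open>\<alpha> h x\<close>; the modulus and Parseval then turn \<open>w\<close> into
      \<open>\<delta> h\<close> times the measure of an overlap.\<close>
    define w where "w h \<xi> = (LINT x|\<mu>. pairing \<zeta> (\<alpha> h x) * cnj (pairing \<xi> x) * (g (\<alpha> h x) * cnj (g (\<alpha> h x))))" for h \<xi>
    have w: "w h \<xi> = complex_of_real (\<delta> h) * complex_of_real (measure \<nu> ((+) (\<zeta> - dual_automorphism (\<alpha> h) \<xi>) ` V \<inter> V))" for h \<xi>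
    proof -
      let ?\<eta> = "\<zeta> - dual_automorphism (\<alpha> h) \<xi>"
      define k where "k x = pairing ?\<eta> x * (g x * cnj (g x))" for x
      have "integrable \<mu> k"
        unfolding k_def by (rule Bochner_Integration.integrable_bound[OF integrable_L2_inner[OF g2 g2]])
          (auto simp: norm_mult)
      then have "(LINT x|\<mu>. k (\<alpha> h x)) = complex_of_real (\<delta> h) * (LINT x|\<mu>. k x)"
        using modulus by (auto simp: modulus_function_def)
      moreover have "bij (\<alpha> h)" using aut[of h] by (simp add: topological_automorphism_def)
      then have "k (\<alpha> h x) = pairing \<zeta> (\<alpha> h x) * cnj (pairing \<xi> x) * (g (\<alpha> h x) * cnj (g (\<alpha> h x)))" for x
        by (simp add: k_def pairing_diff pairing_dual_automorphism[OF aut] inv_f_f bij_is_inj)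
      then have "w h \<xi> = (LINT x|\<mu>. k (\<alpha> h x))" by (simp add: w_def)
      moreover have "(LINT x|\<mu>. k x) = inner_L2 \<mu> (inv_fourier (indicator ((+) ?\<eta> ` V))) (inv_fourier (indicator V))"
        by (simp add: inner_L2_def inv_fourier_indicator_translation k_def g_def mult.assoc)
      moreover have "\<dots> = complex_of_real (measure \<nu> ((+) ?\<eta> ` V \<inter> V))"
      proof (rule inner_L2_inv_fourier_indicator)
        show "(+) ?\<eta> ` V \<in> sets borel" unfolding V_def mball_translation[symmetric] by simp
        show "emeasure \<nu> ((+) ?\<eta> ` V) < \<infinity>"
          unfolding V_def mball_translation[symmetric] by (rule emeasure_mball_finite)
      qed (use finV in auto)
      ultimately show ?thesis by simp
    qed
    have [measurable]: "(\<lambda>z. w (fst z) (snd z)) \<in> borel_measurable (\<sigma> \<Otimes>\<^sub>M \<nu>)"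
    proof -
      have [measurable]: "(\<lambda>z. \<alpha> (fst (fst z)) (snd z)) \<in> (\<sigma> \<Otimes>\<^sub>M \<nu>) \<Otimes>\<^sub>M \<mu> \<rightarrow>\<^sub>M borel"
      proof -
        have "(\<lambda>z. (snd z, fst (fst z))) \<in> (\<sigma> \<Otimes>\<^sub>M \<nu>) \<Otimes>\<^sub>M \<mu> \<rightarrow>\<^sub>M \<mu> \<Otimes>\<^sub>M \<sigma>" by measurable
        from measurable_compose[OF this \<open>(\<lambda>z. \<alpha> (snd z) (fst z)) \<in> \<mu> \<Otimes>\<^sub>M \<sigma> \<rightarrow>\<^sub>M borel\<close>]
        show ?thesis by simp
      qed
      show ?thesis
        unfolding w_def
        by (rule \<mu>.borel_measurable_lebesgue_integral) (simp add: split_beta')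
    qed
    \<comment> \<open>The overlap is open and Haar measure charges every nonempty open set, so a
      null overlap is empty.\<close>
    have "measure \<nu> ((+) \<eta> ` V \<inter> V) = 0 \<longleftrightarrow> (+) \<eta> ` V \<inter> V = {}" for \<eta>
    proof
      assume *: "measure \<nu> ((+) \<eta> ` V \<inter> V) = 0"
      have "emeasure \<nu> ((+) \<eta> ` V \<inter> V) \<noteq> \<infinity>"
        using finV emeasure_mono[of "(+) \<eta> ` V \<inter> V" V \<nu>] by (auto simp: top_unique)
      then have "emeasure \<nu> ((+) \<eta> ` V \<inter> V) = 0" using * by (simp add: emeasure_eq_ennreal_measure)
      moreover have "open ((+) \<eta> ` V \<inter> V)"
        unfolding V_def mball_translation[symmetric] by (intro open_Int open_mball)
      ultimately show "(+) \<eta> ` V \<inter> V = {}"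
        using haar_measure_euclideanD(5)[OF haar] by fastforce
    qed simp
    moreover have "\<delta> h \<noteq> 0" for h using modulus by (simp add: modulus_function_def less_imp_neq[symmetric])
    ultimately have "w h \<xi> \<noteq> 0 \<longleftrightarrow> dual_automorphism (\<alpha> h) \<xi> \<in> P \<zeta> r" for h \<xi>
      by (simp add: w P_iff V_def)
    then have "?T -` P \<zeta> r \<inter> space (\<sigma> \<Otimes>\<^sub>M \<nu>) = {z \<in> space (\<sigma> \<Otimes>\<^sub>M \<nu>). w (fst z) (snd z) \<noteq> 0}"
      by auto
    moreover have "{z \<in> space (\<sigma> \<Otimes>\<^sub>M \<nu>). w (fst z) (snd z) \<noteq> 0} \<in> sets (\<sigma> \<Otimes>\<^sub>M \<nu>)" by measurable
    ultimately show ?thesis by (simp only:)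
  qed
  fix W :: "'g dual_group set" assume W: "open W"
  let ?F = "{U. \<exists>\<zeta> r. U = P \<zeta> r \<and> P \<zeta> r \<subseteq> W}"
  obtain \<V> where \<V>: "countable \<V>" "\<V> \<subseteq> ?F" "\<Union>\<V> = \<Union>?F"
  proof (rule countable_open_subcover[OF second_countable, of ?F])
    show "open U" if "U \<in> ?F" for U using that P_open by auto
  qed (rule that)
  have "\<Union>?F = W"
  proof
    show "W \<subseteq> \<Union>?F"
    proof
      fix \<zeta> assume "\<zeta> \<in> W"
      then obtain r where r: "r > 0" "mball \<zeta> r \<subseteq> W" using W open_iff by blast
      have "P \<zeta> (r / 2) \<subseteq> W" using P_sub[of \<zeta> "r/2"] r by auto
      then show "\<zeta> \<in> \<Union>?F" using P_mem[of "r/2" \<zeta>] r by auto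
    qed
  qed auto
  then have "?T -` W \<inter> space (\<sigma> \<Otimes>\<^sub>M \<nu>) = (\<Union>U\<in>\<V>. ?T -` U \<inter> space (\<sigma> \<Otimes>\<^sub>M \<nu>))"
    using \<V>(3) by auto
  also have "\<dots> \<in> sets (\<sigma> \<Otimes>\<^sub>M \<nu>)"
    using \<V>(2) P_meas by (intro sets.countable_UN'[OF \<V>(1)]) auto
  finally show "?T -` W \<inter> space (\<sigma> \<Otimes>\<^sub>M \<nu>) \<in> sets (\<sigma> \<Otimes>\<^sub>M \<nu>)" .
qed

end

section \<open>A single automorphism: its modulus on the dual group and the transform of affine
  images\<close>

locale lca_automorphism = lca_plancherel d \<nu> \<mu>
  for d :: "'g::{topological_ab_group_add, t2_space, second_countable_topology} dual_group \<Rightarrow> 'g dual_group \<Rightarrow> real"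
    and \<nu> \<mu> +
  fixes a :: "'g \<Rightarrow> 'g" and \<delta> l L :: real
  assumes aut: "topological_automorphism a"
    and \<delta>_pos: "0 < \<delta>"
    and integrable_modulus: "integrable \<mu> f \<Longrightarrow> integrable \<mu> (\<lambda>x. f (a x))"
    and integral_modulus: "integrable \<mu> f \<Longrightarrow>
      (LINT x|\<mu>. f (a x)) = complex_of_real \<delta> * (LINT x|\<mu>. (f x :: complex))"
    and l_pos: "0 < l" and L_pos: "0 < L"
    and lipschitz: "l * d \<xi> 0 \<le> d (dual_automorphism a \<xi>) 0" "d (dual_automorphism a \<xi>) 0 \<le> L * d \<xi> 0"
begin

abbreviation "ah \<equiv> dual_automorphism a"
abbreviation "ahi \<equiv> dual_automorphism (inv a)"

lemma ah_ahi [simp]: "ah (ahi \<xi>) = \<xi>" "ahi (ah \<xi>) = \<xi>"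
  by (rule dual_automorphism_inverse[OF aut])+

text \<open>Additivity of \<open>ah\<close> and invariance of \<open>d\<close> carry the Lipschitz
  bound from pairs \<open>\<xi>\<close>, 0 to all pairs.\<close>

lemma dist_ah_le: "d (ah \<xi>) (ah \<eta>) \<le> L * d \<xi> \<eta>"
  using lipschitz(2)[of "\<xi> - \<eta>"] by (simp add: dual_automorphism_diff[OF aut] dist_diff_0)

lemma dist_ah_ge: "l * d \<xi> \<eta> \<le> d (ah \<xi>) (ah \<eta>)"
  using lipschitz(1)[of "\<xi> - \<eta>"] by (simp add: dual_automorphism_diff[OF aut] dist_diff_0)

lemma continuous_ah: "continuous_on UNIV ah"
proof (rule continuous_onI)
  fix \<xi> :: "'g dual_group" and e :: real assume "e > 0"
  have "d (ah \<xi>) (ah \<eta>) < e" if "d \<xi> \<eta> < e / L" for \<eta>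
    using dist_ah_le[of \<xi> \<eta>] that L_pos by (simp add: field_simps)
  with \<open>e > 0\<close> L_pos show "\<exists>r>0. \<forall>\<eta>. d \<xi> \<eta> < r \<longrightarrow> d (ah \<xi>) (ah \<eta>) < e"
    by (intro exI[of _ "e / L"]) auto
qed

lemma continuous_ahi: "continuous_on UNIV ahi"
proof (rule continuous_onI)
  fix \<xi> :: "'g dual_group" and e :: real assume "e > 0"
  have "d (ahi \<xi>) (ahi \<eta>) < e" if "d \<xi> \<eta> < e * l" for \<eta>
    using dist_ah_ge[of "ahi \<xi>" "ahi \<eta>"] that l_pos
    by (simp add: field_simps) (metis l_pos le_less_trans mult.commute mult_less_cancel_left_pos)
  with \<open>e > 0\<close> l_pos show "\<exists>r>0. \<forall>\<eta>. d \<xi> \<eta> < r \<longrightarrow> d (ahi \<xi>) (ahi \<eta>) < e"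
    by (intro exI[of _ "e * l"]) auto
qed

lemma measurable_ah [measurable]: "ah \<in> borel \<rightarrow>\<^sub>M borel" "ahi \<in> borel \<rightarrow>\<^sub>M borel"
  by (intro borel_measurable_continuous_onI continuous_ah continuous_ahi)+

lemma ah_image_eq: "ah ` A = ahi -` A" and ah_vimage_eq: "ah -` A = ahi ` A"
proof -
  have "x \<in> ah ` A" if "ahi x \<in> A" for x using that by (intro image_eqI[of _ _ "ahi x"]) auto
  then show "ah ` A = ahi -` A" by auto
  have "x \<in> ahi ` A" if "ah x \<in> A" for x using that by (intro image_eqI[of _ _ "ah x"]) auto
  then show "ah -` A = ahi ` A" by auto
qed

lemma measurable_a [measurable]: "a \<in> borel \<rightarrow>\<^sub>M borel"
  using aut by (intro borel_measurable_continuous_onI) (simp add: topological_automorphism_def)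

lemma sq_norm_modulus:
  assumes "f \<in> L2 \<mu>"
  shows "(\<lambda>x. f (a x)) \<in> L2 \<mu>" "sq_norm \<mu> (\<lambda>x. f (a x)) = ennreal \<delta> * sq_norm \<mu> f"
proof -
  have [measurable]: "f \<in> borel_measurable borel" using assms by (auto simp: L2_def)
  have int: "integrable \<mu> (\<lambda>x. complex_of_real ((cmod (f x))\<^sup>2))"
    using assms unfolding L2_def by (intro integrable_of_real) auto
  have "integrable \<mu> (\<lambda>x. complex_of_real ((cmod (f (a x)))\<^sup>2))"
    by (rule integrable_modulus[OF int])
  then have "integrable \<mu> (\<lambda>x. (cmod (f (a x)))\<^sup>2)"
    by (simp only: complex_of_real_integrable_eq)
  then show L2: "(\<lambda>x. f (a x)) \<in> L2 \<mu>" by (simp add: L2_def)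
  have "complex_of_real (LINT x|\<mu>. (cmod (f (a x)))\<^sup>2) = complex_of_real (\<delta> * (LINT x|\<mu>. (cmod (f x))\<^sup>2))"
    using integral_modulus[OF int] by (simp only: integral_complex_of_real of_real_mult)
  then have "(LINT x|\<mu>. (cmod (f (a x)))\<^sup>2) = \<delta> * (LINT x|\<mu>. (cmod (f x))\<^sup>2)"
    by (simp only: of_real_eq_iff)
  then show "sq_norm \<mu> (\<lambda>x. f (a x)) = ennreal \<delta> * sq_norm \<mu> f"
    using \<delta>_pos by (simp add: sq_norm_eq L2 assms norm_L2_sq ennreal_mult)
qed

text \<open>\<open>pairing (ah \<xi>) (a x) = pairing \<xi> x\<close>, so the integrand is a
  function of \<open>a x\<close> and the modulus applies.\<close>

lemma fourier_modulus:
  assumes u: "integrable \<mu> u"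
  shows "fourier \<mu> (\<lambda>x. u (a x)) \<xi> = complex_of_real \<delta> * fourier \<mu> u (ah \<xi>)"
proof -
  have "inv a (a x) = x" for x using aut by (simp add: topological_automorphism_def bij_is_inj)
  then show ?thesis
    using integral_modulus[OF integrable_mult_cnj_pairing[OF u, of "ah \<xi>"]]
    by (simp add: fourier_def pairing_dual_automorphism[OF aut])
qed

text \<open>Supplies a function of nonzero norm, from which the constant in \<open>distr_ah\<close>
  is read off.\<close>

lemma L1_L2_nonzero: obtains u where "integrable \<mu> u" "u \<in> L2 \<mu>" "sq_norm \<mu> u \<noteq> 0"
proof -
  obtain V K where VK: "open V" "compact K" "(0::'g) \<in> V" "V \<subseteq> K" "K \<subseteq> UNIV"
    by (rule locally_compactE[OF locally_compact open_UNIV UNIV_I])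
  have [measurable]: "V \<in> sets borel" "K \<in> sets borel" using VK by (auto simp: compact_imp_closed borel_closed)
  have fin: "emeasure \<mu> V < \<infinity>"
    using emeasure_mono[of V K \<mu>] haar_measure_euclideanD(4)[OF haar_\<mu> VK(2)] VK(4) by auto
  have "0 < emeasure \<mu> V" using haar_measure_euclideanD(5)[OF haar_\<mu> VK(1)] VK(3) by blast
  with fin show thesis
    by (intro that[of "indicator V"] integrable_complex_indicator) (auto simp: L2_iff sq_norm_indicator)
qed

text \<open>The image measure is invariant, because translation by \<open>b\<close> after
  \<open>ah\<close> is \<open>ah\<close> after translation by \<open>ahi b\<close>; by uniqueness it
  is a multiple of \<open>\<nu>\<close>. The factor comes from Plancherel for one \<open>u\<close>:
  composition with \<open>a\<close> multiplies the squared norm by \<open>\<delta>\<close> and turns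
  the transform into \<open>\<delta>\<close> times the transform of \<open>u\<close> after
  \<open>ah\<close>, so \<open>\<delta>\<^sup>2\<close> times the factor is
  \<open>\<delta>\<close>.\<close>

lemma distr_ah: "distr \<nu> \<nu> ah = scale_measure (ennreal (1 / \<delta>)) \<nu>"
proof -
  define M where "M = distr \<nu> \<nu> ah"
  have sets_M [measurable_cong]: "sets M = sets borel" by (simp add: M_def)
  have "M = scale_measure (emeasure M (mball 0 1) / emeasure \<nu> (mball 0 1)) \<nu>"
  proof (rule haar_measure_unique[OF sets_M])
    show "distr M M ((+) b) = M" for b
    proof -
      have "distr M M ((+) b) = distr \<nu> \<nu> ((+) b \<circ> ah)"
        unfolding M_def by (subst distr_distr) (auto intro!: distr_cong)
      also have "(+) b \<circ> ah = ah \<circ> (+) (ahi b)"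
        by (auto simp: fun_eq_iff dual_automorphism_add[OF aut])
      also have "distr \<nu> \<nu> (ah \<circ> (+) (ahi b)) = distr (distr \<nu> \<nu> ((+) (ahi b))) \<nu> ah"
        by (subst distr_distr) auto
      also have "\<dots> = M" by (simp add: M_def haar_measure_euclideanD(3)[OF haar])
      finally show ?thesis .
    qed
    show "sigma_finite_measure M"
    proof (rule sigma_finite_of_compact[OF sets_M])
      fix K :: "'g dual_group set" assume K: "compact K"
      then have "compact (ahi ` K)"
        by (intro compact_continuous_image continuous_on_subset[OF continuous_ahi]) auto
      moreover have "emeasure M K = emeasure \<nu> (ahi ` K)"
        unfolding M_def using K
        by (subst emeasure_distr) (auto simp: ah_vimage_eq compact_imp_closed borel_closed)
      ultimately show "emeasure M K < \<infinity>" using haar_measure_euclideanD(4)[OF haar] by simp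
    qed
  qed
  then obtain c where c: "M = scale_measure c \<nu>" by blast
  obtain u where u: "integrable \<mu> u" "u \<in> L2 \<mu>" "sq_norm \<mu> u \<noteq> 0" by (rule L1_L2_nonzero)
  have [measurable]: "u \<in> borel_measurable borel" using u by auto
  have P: "sq_norm \<nu> (fourier \<mu> h) = sq_norm \<mu> h" if "integrable \<mu> h" "h \<in> L2 \<mu>" for h
    using plancherel that by (auto simp: plancherel_measure_def sq_norm_eq)
  have "c * sq_norm \<mu> u = c * sq_norm \<nu> (fourier \<mu> u)" using P u by simp
  also have "\<dots> = (\<integral>\<^sup>+\<xi>. ennreal ((cmod (fourier \<mu> u \<xi>))\<^sup>2) \<partial>M)"
    unfolding c sq_norm_def by (subst nn_integral_scale_measure) auto
  also have "\<dots> = (\<integral>\<^sup>+\<xi>. ennreal ((cmod (fourier \<mu> u (ah \<xi>)))\<^sup>2) \<partial>\<nu>)"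
    unfolding M_def by (subst nn_integral_distr) auto
  also have "\<dots> = (\<integral>\<^sup>+\<xi>. ennreal (1 / \<delta>\<^sup>2) * ennreal ((cmod (fourier \<mu> (\<lambda>x. u (a x)) \<xi>))\<^sup>2) \<partial>\<nu>)"
    using \<delta>_pos by (simp add: fourier_modulus[OF u(1)] norm_mult power_mult_distrib ennreal_mult[symmetric])
  also have "\<dots> = ennreal (1 / \<delta>\<^sup>2) * sq_norm \<nu> (fourier \<mu> (\<lambda>x. u (a x)))"
    unfolding sq_norm_def by (subst nn_integral_cmult) auto
  also have "\<dots> = ennreal (1 / \<delta>\<^sup>2) * (ennreal \<delta> * sq_norm \<mu> u)"
    using P[OF integrable_modulus[OF u(1)] sq_norm_modulus(1)[OF u(2)]] sq_norm_modulus(2)[OF u(2)] by simp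
  also have "\<dots> = ennreal (1 / \<delta>) * sq_norm \<mu> u"
    using \<delta>_pos by (simp add: mult.assoc[symmetric] ennreal_mult[symmetric] power2_eq_square)
  finally have "c * sq_norm \<mu> u = ennreal (1 / \<delta>) * sq_norm \<mu> u" .
  then have "c = ennreal (1 / \<delta>)"
    using u(2,3) by (auto simp: L2_iff mult.commute[of _ "sq_norm \<mu> u"] ennreal_mult_cancel_left)
  with c show ?thesis by (simp add: M_def)
qed

lemma nn_integral_ah:
  assumes [measurable]: "f \<in> borel_measurable borel"
  shows "(\<integral>\<^sup>+\<xi>. f (ah \<xi>) \<partial>\<nu>) = ennreal (1 / \<delta>) * (\<integral>\<^sup>+\<xi>. f \<xi> \<partial>\<nu>)"
proof -
  have "(\<integral>\<^sup>+\<xi>. f (ah \<xi>) \<partial>\<nu>) = (\<integral>\<^sup>+\<xi>. f \<xi> \<partial>distr \<nu> \<nu> ah)"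
    by (subst nn_integral_distr) auto
  also have "\<dots> = ennreal (1 / \<delta>) * (\<integral>\<^sup>+\<xi>. f \<xi> \<partial>\<nu>)"
    unfolding distr_ah by (subst nn_integral_scale_measure) auto
  finally show ?thesis .
qed

lemma integral_ah:
  fixes f :: "'g dual_group \<Rightarrow> complex"
  assumes [measurable]: "f \<in> borel_measurable borel"
  shows "(LINT \<xi>|\<nu>. f (ah \<xi>)) = complex_of_real (1 / \<delta>) * (LINT \<xi>|\<nu>. f \<xi>)"
proof -
  have dens: "distr \<nu> \<nu> ah = density \<nu> (\<lambda>_. ennreal (1 / \<delta>))"
    unfolding distr_ah by (rule measure_eqI) (auto simp: emeasure_density_const)
  have "(LINT \<xi>|\<nu>. f (ah \<xi>)) = (LINT \<xi>|distr \<nu> \<nu> ah. f \<xi>)"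
    by (subst integral_distr) auto
  also have "\<dots> = (LINT \<xi>|\<nu>. (1 / \<delta>) *\<^sub>R f \<xi>)"
    unfolding dens using \<delta>_pos by (subst integral_density) auto
  also have "\<dots> = complex_of_real (1 / \<delta>) * (LINT \<xi>|\<nu>. f \<xi>)"
    by (simp only: scaleR_conv_of_real integral_mult_right_zero)
  finally show ?thesis .
qed

lemma sq_norm_ah:
  assumes "g \<in> L2 \<nu>"
  shows "(\<lambda>\<xi>. g (ah \<xi>)) \<in> L2 \<nu>" "sq_norm \<nu> (\<lambda>\<xi>. g (ah \<xi>)) = ennreal (1 / \<delta>) * sq_norm \<nu> g"
proof -
  have [measurable]: "g \<in> borel_measurable borel" using assms by (auto simp: L2_def)
  show eq: "sq_norm \<nu> (\<lambda>\<xi>. g (ah \<xi>)) = ennreal (1 / \<delta>) * sq_norm \<nu> g"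
    unfolding sq_norm_def by (rule nn_integral_ah) auto
  show "(\<lambda>\<xi>. g (ah \<xi>)) \<in> L2 \<nu>"
    using assms by (auto simp: L2_iff eq ennreal_mult_less_top)
qed

text \<open>\<open>T\<close> and \<open>S\<close> below preserve the norms of the two
  \<open>L2\<close> spaces, and \<open>fourier \<mu> (T u) = S (fourier \<mu> u)\<close> for
  integrable \<open>u\<close>; an approximating sequence for \<open>f\<close> is thus carried to one
  for the affine image.\<close>

lemma is_fourier_L2_affine:
  assumes f: "is_fourier_L2 \<mu> \<nu> f F"
  shows "is_fourier_L2 \<mu> \<nu> (\<lambda>x. complex_of_real (\<delta> powr (- 1/2)) * f (a x - \<gamma>))
    (\<lambda>\<xi>. complex_of_real (\<delta> powr (1/2)) * (F (ah \<xi>) * cnj (pairing (ah \<xi>) \<gamma>)))"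
proof -
  define T where "T f x = complex_of_real (\<delta> powr (- 1/2)) * f (a x - \<gamma>)" for f :: "'g \<Rightarrow> complex" and x
  define S where "S F \<xi> = complex_of_real (\<delta> powr (1/2)) * (F (ah \<xi>) * cnj (pairing (ah \<xi>) \<gamma>))"
    for F :: "'g dual_group \<Rightarrow> complex" and \<xi>
  have c1: "(cmod (complex_of_real (\<delta> powr (- 1/2))))\<^sup>2 = 1 / \<delta>"
  proof -
    have "(cmod (complex_of_real (\<delta> powr (- 1/2))))\<^sup>2 = \<delta> powr (- 1/2) * \<delta> powr (- 1/2)"
      by (simp only: norm_of_real power2_abs power2_eq_square)
    also have "\<dots> = \<delta> powr (- 1/2 + - 1/2)" by (rule powr_add[symmetric])
    also have "- 1/2 + - 1/2 = (- 1 :: real)" by simp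
    also have "\<delta> powr (- 1) = 1 / \<delta>" using \<delta>_pos by (simp add: powr_minus_divide)
    finally show ?thesis .
  qed
  have c2: "(cmod (complex_of_real (\<delta> powr (1/2))))\<^sup>2 = \<delta>"
    using \<delta>_pos by (simp add: powr_half_sqrt)
  have T: "T g \<in> L2 \<mu>" "sq_norm \<mu> (T g) = sq_norm \<mu> g" if g: "g \<in> L2 \<mu>" for g
  proof -
    have [measurable]: "g \<in> borel_measurable borel" using g by (auto simp: L2_def)
    have eq: "sq_norm \<mu> (\<lambda>x. g (x - \<gamma>)) = sq_norm \<mu> g"
      unfolding sq_norm_def by (rule nn_integral_translation_\<mu>) auto
    moreover have "(\<lambda>x. g (x - \<gamma>)) \<in> borel_measurable \<mu>" by measurable
    ultimately have L2: "(\<lambda>x. g (x - \<gamma>)) \<in> L2 \<mu>" using g by (simp add: L2_iff)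
    show "T g \<in> L2 \<mu>" unfolding T_def[abs_def] by (rule L2_cmult[OF sq_norm_modulus(1)[OF L2]])
    show "sq_norm \<mu> (T g) = sq_norm \<mu> g"
    proof -
      have "sq_norm \<mu> (T g) = ennreal (1 / \<delta>) * (ennreal \<delta> * sq_norm \<mu> g)"
        unfolding T_def[abs_def] by (subst sq_norm_cmult) (measurable, simp only: c1 eq sq_norm_modulus(2)[OF L2])
      then show ?thesis using \<delta>_pos by (simp add: mult.assoc[symmetric] ennreal_mult[symmetric])
    qed
  qed
  have S: "S g \<in> L2 \<nu>" "sq_norm \<nu> (S g) = sq_norm \<nu> g" if g: "g \<in> L2 \<nu>" for g
  proof -
    have [measurable]: "g \<in> borel_measurable borel" using g by (auto simp: L2_def)
    have m: "(\<lambda>\<xi>. g (ah \<xi>) * cnj (pairing (ah \<xi>) \<gamma>)) \<in> borel_measurable \<nu>" by measurable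
    show eq: "sq_norm \<nu> (S g) = sq_norm \<nu> g"
    proof -
      have "sq_norm \<nu> (S g) = ennreal \<delta> * (ennreal (1 / \<delta>) * sq_norm \<nu> g)"
        unfolding S_def[abs_def] by (subst sq_norm_cmult[OF m], subst sq_norm_unimodular_mult)
          (simp, simp only: c2 sq_norm_ah(2)[OF g])
      then show ?thesis using \<delta>_pos by (simp add: mult.assoc[symmetric] ennreal_mult[symmetric])
    qed
    show "S g \<in> L2 \<nu>" using g unfolding L2_iff eq by (auto simp: S_def[abs_def])
  qed
  have TS: "integrable \<mu> (T u)" "fourier \<mu> (T u) = S (fourier \<mu> u)" if u: "integrable \<mu> u" for u
  proof -
    note tr = integrable_translation_\<mu>[OF u, of \<gamma>]
    show "integrable \<mu> (T u)"
      unfolding T_def[abs_def] by (intro integrable_mult_right integrable_modulus[OF tr(1)])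
    have four: "fourier \<mu> (\<lambda>x. u (x - \<gamma>)) \<xi> = fourier \<mu> u \<xi> * cnj (pairing \<xi> \<gamma>)" for \<xi>
    proof -
      have "u (x - \<gamma>) * cnj (pairing \<xi> x) = u (x - \<gamma>) * cnj (pairing \<xi> (x - \<gamma>)) * cnj (pairing \<xi> \<gamma>)" for x
        using pairing_add[of \<xi> "x - \<gamma>" \<gamma>] by simp
      then have "fourier \<mu> (\<lambda>x. u (x - \<gamma>)) \<xi> = (LINT x|\<mu>. u (x - \<gamma>) * cnj (pairing \<xi> (x - \<gamma>)) * cnj (pairing \<xi> \<gamma>))"
        unfolding fourier_def by (intro Bochner_Integration.integral_cong) auto
      also have "\<dots> = (LINT x|\<mu>. u (x - \<gamma>) * cnj (pairing \<xi> (x - \<gamma>))) * cnj (pairing \<xi> \<gamma>)"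
        by (rule integral_mult_left_zero)
      also have "(LINT x|\<mu>. u (x - \<gamma>) * cnj (pairing \<xi> (x - \<gamma>))) = fourier \<mu> u \<xi>"
        unfolding fourier_def
        by (rule integrable_translation_\<mu>(2)[of "\<lambda>x. u x * cnj (pairing \<xi> x)" \<gamma>, OF integrable_mult_cnj_pairing[OF u]])
      finally show ?thesis .
    qed
    \<comment> \<open>The normalizing factor of the dilation meets the \<open>\<delta>\<close> from
      the change of variables, which explains the exponent \<open>1/2\<close> on the dual
      side.\<close>
    have "\<delta> powr (- 1/2 + 1) = \<delta> powr (- 1/2) * \<delta> powr 1" by (rule powr_add)
    moreover have "\<delta> powr 1 = \<delta>" using \<delta>_pos by (intro powr_one) simp
    moreover have "- 1/2 + 1 = (1/2 :: real)" by simp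
    ultimately have half: "\<delta> powr (- 1/2) * \<delta> = \<delta> powr (1/2)" by (simp only:)
    show "fourier \<mu> (T u) = S (fourier \<mu> u)"
    proof
      fix \<xi>
      have "fourier \<mu> (T u) \<xi> = complex_of_real (\<delta> powr (- 1/2)) * fourier \<mu> (\<lambda>x. u (a x - \<gamma>)) \<xi>"
        unfolding fourier_def T_def mult.assoc by (rule integral_mult_right_zero)
      also have "fourier \<mu> (\<lambda>x. u (a x - \<gamma>)) \<xi> = complex_of_real \<delta> * (fourier \<mu> u (ah \<xi>) * cnj (pairing (ah \<xi>) \<gamma>))"
        unfolding fourier_modulus[OF tr(1)] four ..
      finally show "fourier \<mu> (T u) \<xi> = S (fourier \<mu> u) \<xi>"
        by (simp only: S_def of_real_mult mult.assoc flip: half)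
    qed
  qed
  obtain u where u: "\<And>n. integrable \<mu> (u n)" "\<And>n. u n \<in> L2 \<mu>" "tendsto_L2 \<mu> u f"
    "tendsto_L2 \<nu> (\<lambda>n. fourier \<mu> (u n)) F" "f \<in> L2 \<mu>" "F \<in> L2 \<nu>"
    using f unfolding is_fourier_L2_def by blast
  have Fu: "fourier \<mu> (u n) \<in> L2 \<nu>" for n
    using plancherel u by (auto simp: plancherel_measure_def)
  have T_diff: "T g x - T h x = T (\<lambda>x. g x - h x) x" for g h x
    by (simp add: T_def right_diff_distrib)
  have S_diff: "S g \<xi> - S h \<xi> = S (\<lambda>\<xi>. g \<xi> - h \<xi>) \<xi>" for g h \<xi>
    by (simp add: S_def right_diff_distrib left_diff_distrib)
  have "tendsto_L2 \<mu> (\<lambda>n. T (u n)) (T f)"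
    using u(3) T(2)[OF L2_diff[OF u(2) u(5)]] unfolding tendsto_L2_def sq_norm_def T_diff by simp
  moreover have "tendsto_L2 \<nu> (\<lambda>n. S (fourier \<mu> (u n))) (S F)"
    using u(4) S(2)[OF L2_diff[OF Fu u(6)]] unfolding tendsto_L2_def sq_norm_def S_diff by simp
  then have "tendsto_L2 \<nu> (\<lambda>n. fourier \<mu> (T (u n))) (S F)"
    by (simp only: TS(2)[OF u(1)])
  ultimately have "is_fourier_L2 \<mu> \<nu> (T f) (S F)"
    unfolding is_fourier_L2_def
    by (intro conjI exI[of _ "\<lambda>n. T (u n)"] allI T(1) S(1) TS(1) u(1,2,5,6))
  then show ?thesis by (simp add: T_def[abs_def] S_def[abs_def])
qed

end

section \<open>The cocompact subgroup and its Haar measure\<close>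

locale lca_lattice = lca_plancherel d \<nu> \<mu>
  for d :: "'g::{topological_ab_group_add, t2_space, second_countable_topology} dual_group \<Rightarrow> 'g dual_group \<Rightarrow> real"
    and \<nu> \<mu> +
  fixes \<Gamma> :: "'g set" and \<mu>\<Gamma> :: "'g measure" and \<kappa> :: "'g set measure"
  assumes closed_subgroup: "closed_subgroup \<Gamma>"
    and cocompact: "compact_space (coset_topology \<Gamma>)"
    and haar_\<Gamma>: "haar_measure (top_of_set \<Gamma>) \<mu>\<Gamma>"
    and prob_\<kappa>: "prob_space \<kappa>"
    and weil: "weil_formula \<mu> \<mu>\<Gamma> \<kappa>"
begin

lemma zero_\<Gamma> [simp]: "0 \<in> \<Gamma>"
  and diff_\<Gamma>: "x \<in> \<Gamma> \<Longrightarrow> y \<in> \<Gamma> \<Longrightarrow> x - y \<in> \<Gamma>"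
  and closed_\<Gamma>: "closed \<Gamma>"
  using closed_subgroup by (auto simp: closed_subgroup_def)

lemma uminus_\<Gamma>: "x \<in> \<Gamma> \<Longrightarrow> - x \<in> \<Gamma>"
  using diff_\<Gamma>[of 0 x] by simp

lemma add_\<Gamma>: "x \<in> \<Gamma> \<Longrightarrow> y \<in> \<Gamma> \<Longrightarrow> x + y \<in> \<Gamma>"
  using diff_\<Gamma>[of x "- y"] uminus_\<Gamma>[of y] by simp

lemma space_\<Gamma> [simp]: "space \<mu>\<Gamma> = \<Gamma>"
  and sets_\<Gamma>: "sets \<mu>\<Gamma> = sigma_sets \<Gamma> {U. openin (top_of_set \<Gamma>) U}"
  and distr_\<Gamma>: "\<gamma> \<in> \<Gamma> \<Longrightarrow> distr \<mu>\<Gamma> \<mu>\<Gamma> ((+) \<gamma>) = \<mu>\<Gamma>"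
  using haar_\<Gamma> by (auto simp: haar_measure_def)

lemma measurable_ident_\<Gamma>: "(\<lambda>x. x) \<in> \<mu>\<Gamma> \<rightarrow>\<^sub>M borel"
proof (rule borel_measurableI)
  fix U :: "'g set" assume "open U"
  then have "(\<lambda>x. x) -` U \<inter> space \<mu>\<Gamma> \<in> {U. openin (top_of_set \<Gamma>) U}"
    by (auto simp: openin_open)
  then show "(\<lambda>x. x) -` U \<inter> space \<mu>\<Gamma> \<in> sets \<mu>\<Gamma>"
    unfolding sets_\<Gamma> by (rule sigma_sets.Basic)
qed

lemma measurable_\<Gamma>: "f \<in> borel \<rightarrow>\<^sub>M N \<Longrightarrow> f \<in> \<mu>\<Gamma> \<rightarrow>\<^sub>M N"
  by (rule measurable_compose[OF measurable_ident_\<Gamma>])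

lemma measurable_translation_\<Gamma>:
  assumes "\<gamma> \<in> \<Gamma>"
  shows "(+) \<gamma> \<in> \<mu>\<Gamma> \<rightarrow>\<^sub>M \<mu>\<Gamma>"
proof (rule measurable_sigma_sets[OF sets_\<Gamma>])
  show "(+) \<gamma> \<in> space \<mu>\<Gamma> \<rightarrow> \<Gamma>" using assms add_\<Gamma> by auto
  fix U assume "U \<in> {U. openin (top_of_set \<Gamma>) U}"
  then obtain T where T: "open T" "U = \<Gamma> \<inter> T" by (auto simp: openin_open)
  have "open ((+) \<gamma> -` T)"
    using T(1) continuous_on_add[OF continuous_on_const continuous_on_id, of UNIV \<gamma>]
    by (simp add: continuous_on_open_vimage)
  moreover have "(+) \<gamma> -` U \<inter> space \<mu>\<Gamma> = \<Gamma> \<inter> ((+) \<gamma> -` T)"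
    using T(2) assms add_\<Gamma> by auto
  ultimately show "(+) \<gamma> -` U \<inter> space \<mu>\<Gamma> \<in> sets \<mu>\<Gamma>"
    unfolding sets_\<Gamma> by (intro sigma_sets.Basic) (auto simp: openin_open)
qed (auto simp: openin_subset openin_open)

lemma nn_integral_translation_\<Gamma>:
  assumes "\<gamma> \<in> \<Gamma>" and f: "f \<in> borel_measurable borel"
  shows "(\<integral>\<^sup>+x. f (\<gamma> + x) \<partial>\<mu>\<Gamma>) = (\<integral>\<^sup>+x. f x \<partial>\<mu>\<Gamma>)"
proof -
  have "(\<integral>\<^sup>+x. f x \<partial>\<mu>\<Gamma>) = (\<integral>\<^sup>+x. f x \<partial>distr \<mu>\<Gamma> \<mu>\<Gamma> ((+) \<gamma>))" by (simp add: distr_\<Gamma> assms)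
  also have "\<dots> = (\<integral>\<^sup>+x. f (\<gamma> + x) \<partial>\<mu>\<Gamma>)"
    using measurable_\<Gamma>[OF f] measurable_translation_\<Gamma>[OF assms(1)] by (subst nn_integral_distr) auto
  finally show ?thesis ..
qed

lemma integral_translation_\<Gamma>:
  fixes f :: "'g \<Rightarrow> complex"
  assumes "\<gamma> \<in> \<Gamma>" and f: "f \<in> borel_measurable borel"
  shows "(LINT x|\<mu>\<Gamma>. f (\<gamma> + x)) = (LINT x|\<mu>\<Gamma>. f x)"
proof -
  have "(LINT x|\<mu>\<Gamma>. f x) = (LINT x|distr \<mu>\<Gamma> \<mu>\<Gamma> ((+) \<gamma>). f x)" by (simp add: distr_\<Gamma> assms)
  also have "\<dots> = (LINT x|\<mu>\<Gamma>. f (\<gamma> + x))"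
    using measurable_\<Gamma>[OF f] measurable_translation_\<Gamma>[OF assms(1)] by (subst integral_distr) auto
  finally show ?thesis ..
qed

lemma emeasure_\<Gamma>_compact:
  assumes "compact K"
  shows "\<Gamma> \<inter> K \<in> sets \<mu>\<Gamma>" "emeasure \<mu>\<Gamma> (\<Gamma> \<inter> K) < \<infinity>"
proof -
  have "K \<in> sets borel" using assms by (simp add: compact_imp_closed)
  from measurable_sets[OF measurable_ident_\<Gamma> this] show "\<Gamma> \<inter> K \<in> sets \<mu>\<Gamma>"
    by (simp add: Int_commute vimage_ident)
  have "compactin (top_of_set \<Gamma>) (\<Gamma> \<inter> K)"
    using compact_Int_closed[OF assms closed_\<Gamma>] by (simp add: compactin_subtopology Int_commute)
  then show "emeasure \<mu>\<Gamma> (\<Gamma> \<inter> K) < \<infinity>" using haar_\<Gamma> by (simp add: haar_measure_def)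
qed

sublocale \<mu>\<Gamma>: sigma_finite_measure \<mu>\<Gamma>
proof
  let ?F = "{V :: 'g set. open V \<and> (\<exists>K. compact K \<and> V \<subseteq> K)}"
  obtain \<V> where \<V>: "countable \<V>" "\<V> \<subseteq> ?F" "\<Union>\<V> = \<Union>?F"
  proof (rule countable_open_subcover[OF second_countable_euclidean, of ?F])
    show "open U" if "U \<in> ?F" for U using that by auto
  qed (rule that)
  have UN: "\<Union>?F = UNIV"
  proof -
    have "x \<in> \<Union>?F" for x
    proof -
      obtain V K where "open V" "compact K" "x \<in> V" "V \<subseteq> K" "K \<subseteq> UNIV"
        by (rule locally_compactE[OF locally_compact open_UNIV UNIV_I])
      then show ?thesis by blast
    qed
    then show ?thesis by blast
  qed
  have "\<Gamma> \<inter> V \<in> sets \<mu>\<Gamma> \<and> emeasure \<mu>\<Gamma> (\<Gamma> \<inter> V) \<noteq> \<infinity>" if V: "V \<in> \<V>" for V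
  proof
    obtain K where K: "compact K" "V \<subseteq> K" "open V" using V \<V>(2) by blast
    have "openin (top_of_set \<Gamma>) (\<Gamma> \<inter> V)" using K(3) by (auto simp: openin_open)
    then show 1: "\<Gamma> \<inter> V \<in> sets \<mu>\<Gamma>" unfolding sets_\<Gamma> by (intro sigma_sets.Basic) simp
    have "emeasure \<mu>\<Gamma> (\<Gamma> \<inter> V) \<le> emeasure \<mu>\<Gamma> (\<Gamma> \<inter> K)"
      using K emeasure_\<Gamma>_compact by (intro emeasure_mono) auto
    then show "emeasure \<mu>\<Gamma> (\<Gamma> \<inter> V) \<noteq> \<infinity>" using emeasure_\<Gamma>_compact(2)[OF K(1)] by auto
  qed
  moreover have "\<Union>((\<inter>) \<Gamma> ` \<V>) = space \<mu>\<Gamma>" using \<V>(3) UN by auto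
  ultimately show "\<exists>A. countable A \<and> A \<subseteq> sets \<mu>\<Gamma> \<and> \<Union>A = space \<mu>\<Gamma> \<and> (\<forall>a\<in>A. emeasure \<mu>\<Gamma> a \<noteq> \<infinity>)"
    using \<V>(1) by (intro exI[of _ "(\<inter>) \<Gamma> ` \<V>"] conjI) auto
qed

sublocale \<mu>\<Gamma>: pair_sigma_finite \<mu>\<Gamma> \<mu> ..

lemma weil_nn_integral:
  "f \<in> borel_measurable borel \<Longrightarrow>
    (\<integral>\<^sup>+x. f x \<partial>\<mu>) = (\<integral>\<^sup>+c. (\<integral>\<^sup>+\<gamma>. f ((SOME y. y \<in> c) + \<gamma>) \<partial>\<mu>\<Gamma>) \<partial>\<kappa>)"
  using weil by (simp add: weil_formula_def)

lemma measurable_fst_\<Gamma> [measurable]: "fst \<in> \<mu>\<Gamma> \<Otimes>\<^sub>M M \<rightarrow>\<^sub>M borel"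
  by (rule measurable_compose[OF measurable_fst measurable_ident_\<Gamma>])

lemma measurable_snd_\<Gamma> [measurable]: "snd \<in> M \<Otimes>\<^sub>M \<mu>\<Gamma> \<rightarrow>\<^sub>M borel"
  by (rule measurable_compose[OF measurable_snd measurable_ident_\<Gamma>])

section \<open>Sampling on a cocompact subgroup\<close>

text \<open>Vanishing off \<open>E\<close> is required at every point, not merely almost everywhere,
  so that multiplication by functions bounded only on \<open>E\<close> is harmless.\<close>

definition supported_L2 :: "'g dual_group set \<Rightarrow> ('g dual_group \<Rightarrow> complex) set" where
  "supported_L2 E = {F \<in> L2 \<nu>. \<forall>\<xi>. \<xi> \<notin> E \<longrightarrow> F \<xi> = 0}"

lemma supported_L2D:
  assumes "F \<in> supported_L2 E"
  shows "F \<in> L2 \<nu>" "\<xi> \<notin> E \<Longrightarrow> F \<xi> = 0" "F \<in> borel_measurable borel"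
  using assms by (auto simp: supported_L2_def L2_def)

lemma supported_L2_integrable:
  assumes "F \<in> supported_L2 E" "compact E"
  shows "integrable \<nu> F"
proof -
  have E: "E \<in> sets borel" "emeasure \<nu> E < \<infinity>"
    using assms(2) haar_measure_euclideanD(4)[OF haar] by (auto simp: compact_imp_closed)
  have "(\<lambda>\<xi>. F \<xi> * cnj (indicator E \<xi>)) = F"
    using supported_L2D(2)[OF assms(1)] by (auto simp: indicator_def fun_eq_iff)
  then show ?thesis
    using integrable_L2_inner[OF supported_L2D(1)[OF assms(1)] L1_L2_indicator(2)[OF E]] by simp
qed

lemma supported_L2_mult:
  assumes F: "F \<in> supported_L2 E" and f: "f \<in> borel_measurable borel" "\<And>\<xi>. \<xi> \<in> E \<Longrightarrow> cmod (f \<xi>) \<le> c"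
  shows "(\<lambda>\<xi>. f \<xi> * F \<xi>) \<in> supported_L2 E"
    and "sq_norm \<nu> (\<lambda>\<xi>. f \<xi> * F \<xi>) \<le> ennreal (c\<^sup>2) * sq_norm \<nu> F"
proof -
  have [measurable]: "F \<in> borel_measurable borel" "f \<in> borel_measurable borel"
    using supported_L2D(3)[OF F] f by auto
  have bound: "cmod (f \<xi> * F \<xi>) \<le> c * cmod (F \<xi>)" for \<xi>
    using f(2)[of \<xi>] supported_L2D(2)[OF F, of \<xi>]
    by (cases "\<xi> \<in> E") (auto simp: norm_mult intro: mult_right_mono)
  have "(\<lambda>\<xi>. f \<xi> * F \<xi>) \<in> L2 \<nu>"
    by (rule L2_bound[OF supported_L2D(1)[OF F], where c = c]) (auto simp: bound)
  then show "(\<lambda>\<xi>. f \<xi> * F \<xi>) \<in> supported_L2 E"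
    using supported_L2D(2)[OF F] by (auto simp: supported_L2_def)
  have "(cmod (f \<xi> * F \<xi>))\<^sup>2 \<le> c\<^sup>2 * (cmod (F \<xi>))\<^sup>2" for \<xi>
    using power_mono[OF bound, of \<xi> 2] by (simp add: power_mult_distrib)
  then have "sq_norm \<nu> (\<lambda>\<xi>. f \<xi> * F \<xi>) \<le> (\<integral>\<^sup>+\<xi>. ennreal (c\<^sup>2) * ennreal ((cmod (F \<xi>))\<^sup>2) \<partial>\<nu>)"
    unfolding sq_norm_def by (intro nn_integral_mono) (simp add: ennreal_mult[symmetric])
  also have "\<dots> = ennreal (c\<^sup>2) * sq_norm \<nu> F"
    unfolding sq_norm_def by (subst nn_integral_cmult) auto
  finally show "sq_norm \<nu> (\<lambda>\<xi>. f \<xi> * F \<xi>) \<le> ennreal (c\<^sup>2) * sq_norm \<nu> F" .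
qed

lemma sq_norm_inv_fourier:
  assumes "F \<in> supported_L2 E" "compact E"
  shows "sq_norm \<mu> (inv_fourier F) = sq_norm \<nu> F"
proof -
  have f: "is_fourier_L2 \<mu> \<nu> (inv_fourier F) F"
    using is_fourier_L2_inv_fourier supported_L2_integrable[OF assms] supported_L2D(1)[OF assms(1)] by blast
  have "complex_of_real ((norm_L2 \<mu> (inv_fourier F))\<^sup>2) = complex_of_real ((norm_L2 \<nu> F)\<^sup>2)"
    using parseval[OF f f] by (simp only: inner_L2_self)
  then show ?thesis
    using f by (simp only: of_real_eq_iff is_fourier_L2_def sq_norm_eq)
qed

lemma inv_fourier_modulation:
  "inv_fourier (\<lambda>\<xi>. pairing \<xi> y * F \<xi>) x = inv_fourier F (y + x)"
  unfolding inv_fourier_def by (simp add: pairing_add mult_ac)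

lemma measurable_inv_fourier_\<Gamma>:
  assumes "F \<in> borel_measurable borel"
  shows "inv_fourier F \<in> borel_measurable \<mu>\<Gamma>"
  using assms by (intro measurable_\<Gamma> measurable_inv_fourier)

text \<open>Weil's formula for the squared modulus, then Parseval. Once the sampled norm is known
  not to depend on the coset, it must equal the full norm, because \<open>\<kappa>\<close> is a
  probability measure.\<close>

lemma sq_norm_\<Gamma>_weil:
  assumes F: "F \<in> supported_L2 E" "compact E"
  shows "(\<integral>\<^sup>+c. sq_norm \<mu>\<Gamma> (\<lambda>\<gamma>. inv_fourier F ((SOME y. y \<in> c) + \<gamma>)) \<partial>\<kappa>) = sq_norm \<nu> F"
proof -
  have [measurable]: "F \<in> borel_measurable borel" using supported_L2D(3)[OF F(1)] .
  have "sq_norm \<mu> (inv_fourier F) = (\<integral>\<^sup>+c. sq_norm \<mu>\<Gamma> (\<lambda>\<gamma>. inv_fourier F ((SOME y. y \<in> c) + \<gamma>)) \<partial>\<kappa>)"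
    unfolding sq_norm_def by (rule weil_nn_integral) measurable
  then show ?thesis by (simp add: sq_norm_inv_fourier[OF F])
qed

text \<open>On a compact \<open>E\<close> the average of \<open>pairing \<xi> y\<close> over a small
  neighbourhood \<open>V\<close> of 0 is bounded away from 0. Dividing \<open>F\<close> by it gives
  \<open>F'\<close> of comparable norm such that \<open>inv_fourier F\<close> is a local average of
  \<open>inv_fourier F'\<close>; by Weil's formula local averages can be sampled on
  \<open>\<Gamma>\<close> at the cost of a constant.\<close>

lemma sampling_bounded:
  assumes E: "compact E"
  shows "\<exists>C\<ge>0. \<forall>F\<in>supported_L2 E. sq_norm \<mu>\<Gamma> (inv_fourier F) \<le> ennreal C * sq_norm \<nu> F"
proof -
  let ?W = "{z :: 'g \<times> 'g dual_group. cmod (pairing (snd z) (fst z) - 1) < 1/2}"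
  have "continuous_on UNIV (\<lambda>z :: 'g \<times> 'g dual_group. (snd z, fst z))" by (intro continuous_intros)
  from continuous_on_compose2[OF continuous_pairing_prod[OF locally_compact] this]
  have "continuous_on UNIV (\<lambda>z :: 'g \<times> 'g dual_group. pairing (snd z) (fst z))" by simp
  then have "continuous_on UNIV (\<lambda>z :: 'g \<times> 'g dual_group. cmod (pairing (snd z) (fst z) - 1))"
    by (intro continuous_intros)
  from open_Collect_less[OF this continuous_on_const] have W: "open ?W" .
  have "{0} \<times> E \<subseteq> ?W" by auto
  \<comment> \<open>Every character is 1 at 0; compactness of \<open>E\<close> makes one
    neighbourhood of 0 serve all characters in \<open>E\<close>.\<close>
  from Elementary_Topology.tube_lemma[OF E W this] obtain X where X: "0 \<in> X" "open X" "X \<times> E \<subseteq> ?W" by blast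
  obtain V K\<^sub>0 where V: "open V" "compact K\<^sub>0" "0 \<in> V" "V \<subseteq> K\<^sub>0" "K\<^sub>0 \<subseteq> X"
    by (rule locally_compactE[OF locally_compact X(2,1)])
  have near: "cmod (pairing \<xi> y - 1) < 1/2" if "\<xi> \<in> E" "y \<in> V" for \<xi> y
    using that V X(3) by (auto simp: subset_iff)
  have [measurable]: "V \<in> sets borel" "K\<^sub>0 \<in> sets borel" using V by (auto simp: compact_imp_closed)
  have fin: "emeasure \<mu> V < \<infinity>"
    using emeasure_mono[of V K\<^sub>0 \<mu>] haar_measure_euclideanD(4)[OF haar_\<mu> V(2)] V(4) by auto
  define m where "m = measure \<mu> V"
  have emV: "emeasure \<mu> V = ennreal m" using fin by (simp add: m_def emeasure_eq_ennreal_measure)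
  have "0 < emeasure \<mu> V" using haar_measure_euclideanD(5)[OF haar_\<mu> V(1)] V(3) by blast
  then have m: "m > 0" by (simp add: emV)
  have indV: "integrable \<mu> (indicator V :: _ \<Rightarrow> complex)" using fin by (intro integrable_complex_indicator) auto
  have indV_pair: "integrable \<mu> (\<lambda>y. indicator V y * pairing \<xi> y)" for \<xi>
    by (rule Bochner_Integration.integrable_bound[OF indV]) (measurable, simp add: norm_mult)
  define u where "u \<xi> = (LINT y|\<mu>. indicator V y * pairing \<xi> y) / complex_of_real m" for \<xi>
  have [measurable]: "u \<in> borel_measurable borel" unfolding u_def by measurable
  have u_half: "1/2 \<le> cmod (u \<xi>)" if \<xi>: "\<xi> \<in> E" for \<xi>
  proof -
    have "(LINT y|\<mu>. (indicator V y :: complex)) = complex_of_real m"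
    proof -
      have "(LINT y|\<mu>. (indicator V y :: complex)) = (LINT y|\<mu>. complex_of_real (indicator V y))"
        by (intro Bochner_Integration.integral_cong) (auto simp: indicator_def)
      then show ?thesis by (simp only: integral_complex_of_real) (simp add: m_def)
    qed
    then have "u \<xi> - 1 = (LINT y|\<mu>. indicator V y * pairing \<xi> y - indicator V y) / complex_of_real m"
      using m indV indV_pair by (simp add: u_def field_simps)
    also have "cmod \<dots> \<le> (LINT y|\<mu>. cmod (indicator V y * pairing \<xi> y - indicator V y)) / m"
      using m by (simp add: norm_divide divide_right_mono)
    also have "\<dots> \<le> (LINT y|\<mu>. indicator V y * (1/2)) / m"
    proof (intro divide_right_mono integral_mono)
      show "integrable \<mu> (\<lambda>y. cmod (indicator V y * pairing \<xi> y - indicator V y))"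
        using indV indV_pair by (intro integrable_norm Bochner_Integration.integrable_diff)
      show "integrable \<mu> (\<lambda>y. indicator V y * (1/2) :: real)" using fin by simp
      show "cmod (indicator V y * pairing \<xi> y - indicator V y) \<le> indicator V y * (1/2)" for y
        using near[OF \<xi>, of y] by (auto simp: indicator_def)
    qed (use m in auto)
    also have "\<dots> = 1/2" using m by (simp add: m_def[symmetric])
    finally show ?thesis
      using norm_triangle_ineq2[of 1 "1 - u \<xi>"] by (simp add: norm_minus_commute)
  qed
  \<comment> \<open>If \<open>y + \<gamma>\<^sub>0\<close> lies in \<open>V\<close>, every
    \<open>\<gamma>\<close> with \<open>y + \<gamma> \<in> V\<close> differs from
    \<open>\<gamma>\<^sub>0\<close> by an element of \<open>K\<^sub>0 - K\<^sub>0\<close>. So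
    \<open>C\<^sub>1\<close> bounds the measure of these \<open>\<gamma>\<close> for all cosets at
    once.\<close>
  define C\<^sub>1 where "C\<^sub>1 = measure \<mu>\<Gamma> (\<Gamma> \<inter> (\<lambda>z. fst z - snd z) ` (K\<^sub>0 \<times> K\<^sub>0))"
  have K1: "compact ((\<lambda>z. fst z - snd z) ` (K\<^sub>0 \<times> K\<^sub>0))"
    using V(2) by (intro compact_continuous_image continuous_intros compact_Times)
  have C1: "(\<integral>\<^sup>+\<gamma>. indicator V (y + \<gamma>) \<partial>\<mu>\<Gamma>) \<le> ennreal C\<^sub>1" for y
  proof (cases "\<exists>\<gamma>\<in>\<Gamma>. y + \<gamma> \<in> V")
    case True
    then obtain \<gamma>\<^sub>0 where \<gamma>\<^sub>0: "\<gamma>\<^sub>0 \<in> \<Gamma>" "y + \<gamma>\<^sub>0 \<in> V" by blast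
    let ?K = "(\<lambda>z. fst z - snd z) ` (K\<^sub>0 \<times> K\<^sub>0)"
    have [measurable]: "?K \<in> sets borel" using K1 by (simp add: compact_imp_closed)
    have "(\<integral>\<^sup>+\<gamma>. indicator V (y + \<gamma>) \<partial>\<mu>\<Gamma>) \<le> (\<integral>\<^sup>+\<gamma>. indicator ?K (- \<gamma>\<^sub>0 + \<gamma>) \<partial>\<mu>\<Gamma>)"
    proof (intro nn_integral_mono)
      fix \<gamma>
      have "- \<gamma>\<^sub>0 + \<gamma> \<in> ?K" if "y + \<gamma> \<in> V"
        using that \<gamma>\<^sub>0(2) V(4) by (intro image_eqI[of _ _ "(y + \<gamma>, y + \<gamma>\<^sub>0)"]) (auto simp: algebra_simps)
      then show "indicator V (y + \<gamma>) \<le> (indicator ?K (- \<gamma>\<^sub>0 + \<gamma>) :: ennreal)"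
        by (auto simp: indicator_def)
    qed
    also have "\<dots> = (\<integral>\<^sup>+\<gamma>. indicator ?K \<gamma> \<partial>\<mu>\<Gamma>)"
      by (rule nn_integral_translation_\<Gamma>) (use \<gamma>\<^sub>0 uminus_\<Gamma> in auto)
    also have "\<dots> = (\<integral>\<^sup>+\<gamma>. indicator (\<Gamma> \<inter> ?K) \<gamma> \<partial>\<mu>\<Gamma>)"
      by (intro nn_integral_cong) (auto simp: indicator_def)
    also have "\<dots> = ennreal C\<^sub>1"
      using emeasure_\<Gamma>_compact[OF K1] by (simp add: C\<^sub>1_def emeasure_eq_ennreal_measure)
    finally show ?thesis .
  next
    case False
    then have "(\<integral>\<^sup>+\<gamma>. indicator V (y + \<gamma>) \<partial>\<mu>\<Gamma>) = (\<integral>\<^sup>+\<gamma>. 0 \<partial>\<mu>\<Gamma>)"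
      by (intro nn_integral_cong) (auto simp: indicator_def)
    then show ?thesis by simp
  qed
  have C1_nonneg: "0 \<le> C\<^sub>1" by (simp add: C\<^sub>1_def)
  have main: "sq_norm \<mu>\<Gamma> (inv_fourier F) \<le> ennreal (C\<^sub>1 * 4 / m) * sq_norm \<nu> F" if F: "F \<in> supported_L2 E" for F
  proof -
    have [measurable]: "F \<in> borel_measurable borel" using supported_L2D(3)[OF F] .
    define F' where "F' \<xi> = (1 / u \<xi>) * F \<xi>" for \<xi>
    have inv: "cmod (1 / u \<xi>) \<le> 2" if "\<xi> \<in> E" for \<xi>
    proof -
      have "0 < cmod (u \<xi>)" using u_half[OF that] by linarith
      then show ?thesis using u_half[OF that] by (simp add: norm_divide field_simps)
    qed
    have F': "F' \<in> supported_L2 E" "sq_norm \<nu> F' \<le> ennreal (2\<^sup>2) * sq_norm \<nu> F"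
      unfolding F'_def[abs_def] by (rule supported_L2_mult[OF F _ inv]; measurable)+
    have [measurable]: "F' \<in> borel_measurable borel" using supported_L2D(3)[OF F'(1)] .
    have F'_int: "integrable \<nu> F'" by (rule supported_L2_integrable[OF F'(1) E])
    \<comment> \<open>Invariant under \<open>\<Gamma>\<close> as a function of \<open>y\<close>. It
      therefore leaves the inner integral in Weil's formula, where only the measure of the part of
      the coset inside \<open>V\<close> remains.\<close>
    define \<Phi> where "\<Phi> y = (\<integral>\<^sup>+\<gamma>. ennreal ((cmod (inv_fourier F' (y + \<gamma>)))\<^sup>2) \<partial>\<mu>\<Gamma>)" for y
    have avg: "complex_of_real m * inv_fourier F x = (LINT y|\<mu>. indicator V y * inv_fourier F' (x + y))" for x
    proof -
      have int: "integrable (\<nu> \<Otimes>\<^sub>M \<mu>) (\<lambda>(\<xi>, y). F' \<xi> * (indicator V y * pairing \<xi> (x + y)))"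
      proof (rule Fubini_integrable)
        have "(\<lambda>\<xi>. LINT y|\<mu>. cmod (F' \<xi> * (indicator V y * pairing \<xi> (x + y)))) = (\<lambda>\<xi>. cmod (F' \<xi>) * (LINT y|\<mu>. cmod (indicator V y)))"
          by (simp add: norm_mult)
        then show "integrable \<nu> (\<lambda>\<xi>. LINT y|\<mu>. norm (case (\<xi>, y) of (\<xi>, y) \<Rightarrow> F' \<xi> * (indicator V y * pairing \<xi> (x + y))))"
          using F'_int by simp
        have "integrable \<mu> (\<lambda>y. indicator V y * pairing \<xi> (x + y))" for \<xi>
          by (rule Bochner_Integration.integrable_bound[OF indV]) (measurable, simp add: norm_mult)
        then show "AE \<xi> in \<nu>. integrable \<mu> (\<lambda>y. case (\<xi>, y) of (\<xi>, y) \<Rightarrow> F' \<xi> * (indicator V y * pairing \<xi> (x + y)))"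
          by simp
      qed measurable
      have "complex_of_real m * (F \<xi> * pairing \<xi> x) = (LINT y|\<mu>. F' \<xi> * (indicator V y * pairing \<xi> (x + y)))" for \<xi>
      proof -
        have "(LINT y|\<mu>. F' \<xi> * (indicator V y * pairing \<xi> (x + y))) = (LINT y|\<mu>. (F' \<xi> * pairing \<xi> x) * (indicator V y * pairing \<xi> y))"
          by (intro Bochner_Integration.integral_cong) (auto simp: pairing_add)
        also have "\<dots> = (F' \<xi> * pairing \<xi> x) * (complex_of_real m * u \<xi>)"
          using m by (simp add: u_def)
        also have "\<dots> = complex_of_real m * (F \<xi> * pairing \<xi> x)"
        proof (cases "\<xi> \<in> E")
          case True
          then have "u \<xi> \<noteq> 0" using u_half by fastforce
          then show ?thesis by (simp add: F'_def)
        next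
          case False
          then show ?thesis using supported_L2D(2)[OF F] by (simp add: F'_def)
        qed
        finally show ?thesis ..
      qed
      then have "complex_of_real m * inv_fourier F x = (LINT \<xi>|\<nu>. LINT y|\<mu>. F' \<xi> * (indicator V y * pairing \<xi> (x + y)))"
        unfolding inv_fourier_def by (subst integral_mult_right_zero[symmetric]) simp
      also have "\<dots> = (LINT y|\<mu>. LINT \<xi>|\<nu>. F' \<xi> * (indicator V y * pairing \<xi> (x + y)))"
        using Fubini_integral[OF int] by simp
      also have "\<dots> = (LINT y|\<mu>. indicator V y * inv_fourier F' (x + y))"
        unfolding inv_fourier_def
        by (subst integral_mult_right_zero[symmetric]) (simp add: mult_ac)
      finally show ?thesis .
    qed
    \<comment> \<open>Cauchy-Schwarz for the average over \<open>V\<close>: splitting off one copy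
      of the indicator produces a factor \<open>m\<close>, and one of the two factors
      \<open>m\<close> on the left is cancelled against it.\<close>
    have jensen: "ennreal m * ennreal ((cmod (inv_fourier F x))\<^sup>2) \<le> (\<integral>\<^sup>+y. indicator V y * ennreal ((cmod (inv_fourier F' (x + y)))\<^sup>2) \<partial>\<mu>)" for x
    proof -
      have int: "integrable \<mu> (\<lambda>y. indicator V y * inv_fourier F' (x + y))"
        by (rule Bochner_Integration.integrable_bound[OF integrable_mult_right[OF indV, of "complex_of_real (LINT \<xi>|\<nu>. cmod (F' \<xi>))"]])
          (measurable, auto simp: norm_mult indicator_def intro!: AE_I2 cmod_inv_fourier_le)
      have "ennreal (m * cmod (inv_fourier F x)) = ennreal (cmod (LINT y|\<mu>. indicator V y * inv_fourier F' (x + y)))"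
        unfolding avg[symmetric] using m by (simp add: norm_mult)
      also have "\<dots> \<le> (\<integral>\<^sup>+y. ennreal (cmod (indicator V y * inv_fourier F' (x + y))) \<partial>\<mu>)"
        by (rule integral_norm_bound_ennreal[OF int])
      also have "\<dots> = (\<integral>\<^sup>+y. indicator V y * (indicator V y * ennreal (cmod (inv_fourier F' (x + y)))) \<partial>\<mu>)"
        by (intro nn_integral_cong) (auto simp: indicator_def norm_mult)
      finally have "(ennreal (m * cmod (inv_fourier F x)))\<^sup>2 \<le> (\<integral>\<^sup>+y. indicator V y * (indicator V y * ennreal (cmod (inv_fourier F' (x + y)))) \<partial>\<mu>)\<^sup>2"
        by (rule power_mono) simp
      also have "\<dots> \<le> (\<integral>\<^sup>+y. (indicator V y)\<^sup>2 \<partial>\<mu>) * (\<integral>\<^sup>+y. (indicator V y * ennreal (cmod (inv_fourier F' (x + y))))\<^sup>2 \<partial>\<mu>)"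
        by (rule Cauchy_Schwarz_nn_integral) measurable
      also have "(\<integral>\<^sup>+y. (indicator V y)\<^sup>2 \<partial>\<mu>) = (\<integral>\<^sup>+y. indicator V y \<partial>\<mu>)"
        by (intro nn_integral_cong) (auto simp: indicator_def)
      also have "\<dots> = ennreal m" by (simp add: emV)
      also have "(\<integral>\<^sup>+y. (indicator V y * ennreal (cmod (inv_fourier F' (x + y))))\<^sup>2 \<partial>\<mu>) = (\<integral>\<^sup>+y. indicator V y * ennreal ((cmod (inv_fourier F' (x + y)))\<^sup>2) \<partial>\<mu>)"
        by (intro nn_integral_cong) (auto simp: indicator_def ennreal_power)
      also have "(ennreal (m * cmod (inv_fourier F x)))\<^sup>2 = ennreal m * (ennreal m * ennreal ((cmod (inv_fourier F x))\<^sup>2))"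
        using m by (simp add: ennreal_power ennreal_mult[symmetric] power_mult_distrib power2_eq_square mult_ac)
      finally show ?thesis
        using m by (subst (asm) ennreal_mult_le_mult_iff) auto
    qed
    have [measurable]: "\<Phi> \<in> borel_measurable borel"
      unfolding \<Phi>_def by measurable
    have \<Phi>_inv: "\<Phi> (y + \<gamma>) = \<Phi> y" if "\<gamma> \<in> \<Gamma>" for y \<gamma>
      unfolding \<Phi>_def add.assoc
      by (rule nn_integral_translation_\<Gamma>[OF that, of "\<lambda>z. ennreal ((cmod (inv_fourier F' (y + z)))\<^sup>2)"]) measurable
    have "ennreal m * sq_norm \<mu>\<Gamma> (inv_fourier F) = (\<integral>\<^sup>+\<gamma>. ennreal m * ennreal ((cmod (inv_fourier F \<gamma>))\<^sup>2) \<partial>\<mu>\<Gamma>)"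
      unfolding sq_norm_def by (subst nn_integral_cmult) (auto intro!: measurable_\<Gamma>)
    also have "\<dots> \<le> (\<integral>\<^sup>+\<gamma>. \<integral>\<^sup>+y. indicator V y * ennreal ((cmod (inv_fourier F' (\<gamma> + y)))\<^sup>2) \<partial>\<mu> \<partial>\<mu>\<Gamma>)"
      by (intro nn_integral_mono jensen)
    also have "\<dots> = (\<integral>\<^sup>+y. \<integral>\<^sup>+\<gamma>. indicator V y * ennreal ((cmod (inv_fourier F' (\<gamma> + y)))\<^sup>2) \<partial>\<mu>\<Gamma> \<partial>\<mu>)"
      by (rule \<mu>\<Gamma>.Fubini'[symmetric]) measurable
    also have "\<dots> = (\<integral>\<^sup>+y. indicator V y * \<Phi> y \<partial>\<mu>)"
      unfolding \<Phi>_def by (intro nn_integral_cong, subst nn_integral_cmult) (auto simp: add.commute intro!: measurable_\<Gamma>)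
    also have "\<dots> = (\<integral>\<^sup>+c. (\<integral>\<^sup>+\<gamma>. indicator V ((SOME y. y \<in> c) + \<gamma>) * \<Phi> ((SOME y. y \<in> c) + \<gamma>) \<partial>\<mu>\<Gamma>) \<partial>\<kappa>)"
      by (rule weil_nn_integral) measurable
    also have "\<dots> \<le> (\<integral>\<^sup>+c. (\<integral>\<^sup>+\<gamma>. ennreal C\<^sub>1 * ennreal ((cmod (inv_fourier F' ((SOME y. y \<in> c) + \<gamma>)))\<^sup>2) \<partial>\<mu>\<Gamma>) \<partial>\<kappa>)"
    proof (rule nn_integral_mono)
      fix c :: "'g set"
      define y where "y = (SOME y. y \<in> c)"
      have "(\<integral>\<^sup>+\<gamma>. indicator V (y + \<gamma>) * \<Phi> (y + \<gamma>) \<partial>\<mu>\<Gamma>) = (\<integral>\<^sup>+\<gamma>. indicator V (y + \<gamma>) * \<Phi> y \<partial>\<mu>\<Gamma>)"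
        by (intro nn_integral_cong) (simp add: \<Phi>_inv)
      also have "\<dots> = (\<integral>\<^sup>+\<gamma>. indicator V (y + \<gamma>) \<partial>\<mu>\<Gamma>) * \<Phi> y"
        by (rule nn_integral_multc) (rule measurable_\<Gamma>, measurable)
      also have "\<dots> \<le> ennreal C\<^sub>1 * \<Phi> y" by (intro mult_right_mono C1) simp
      also have "\<dots> = (\<integral>\<^sup>+\<gamma>. ennreal C\<^sub>1 * ennreal ((cmod (inv_fourier F' (y + \<gamma>)))\<^sup>2) \<partial>\<mu>\<Gamma>)"
        unfolding \<Phi>_def by (rule nn_integral_cmult[symmetric]) (rule measurable_\<Gamma>, measurable)
      finally show "(\<integral>\<^sup>+\<gamma>. indicator V ((SOME y. y \<in> c) + \<gamma>) * \<Phi> ((SOME y. y \<in> c) + \<gamma>) \<partial>\<mu>\<Gamma>)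
          \<le> (\<integral>\<^sup>+\<gamma>. ennreal C\<^sub>1 * ennreal ((cmod (inv_fourier F' ((SOME y. y \<in> c) + \<gamma>)))\<^sup>2) \<partial>\<mu>\<Gamma>)"
        by (simp add: y_def)
    qed
    also have "\<dots> = (\<integral>\<^sup>+x. ennreal C\<^sub>1 * ennreal ((cmod (inv_fourier F' x))\<^sup>2) \<partial>\<mu>)"
      by (rule weil_nn_integral[symmetric]) measurable
    also have "\<dots> = ennreal C\<^sub>1 * sq_norm \<mu> (inv_fourier F')"
      unfolding sq_norm_def by (rule nn_integral_cmult) measurable
    also have "\<dots> \<le> ennreal C\<^sub>1 * (ennreal (2\<^sup>2) * sq_norm \<nu> F)"
      unfolding sq_norm_inv_fourier[OF F'(1) E] by (intro mult_left_mono F') simp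
    finally have "ennreal m * sq_norm \<mu>\<Gamma> (inv_fourier F) \<le> ennreal (C\<^sub>1 * 4) * sq_norm \<nu> F"
      using C1_nonneg by (simp add: ennreal_mult mult.assoc)
    also have "\<dots> = ennreal m * (ennreal (C\<^sub>1 * 4 / m) * sq_norm \<nu> F)"
      using m C1_nonneg by (simp add: mult.assoc[symmetric] ennreal_mult[symmetric])
    finally show ?thesis using m by (subst (asm) ennreal_mult_le_mult_iff) auto
  qed
  then show ?thesis using m C1_nonneg by (intro exI[of _ "C\<^sub>1 * 4 / m"]) auto
qed

section \<open>Multipliers that are symmetric for the inner product of the samples\<close>

definition sampling_bound :: "'g dual_group set \<Rightarrow> real \<Rightarrow> bool" where
  "sampling_bound E C \<longleftrightarrow> 0 \<le> C \<and> (\<forall>F\<in>supported_L2 E. inv_fourier F \<in> L2 \<mu>\<Gamma> \<and>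
    norm_L2 \<mu>\<Gamma> (inv_fourier F) \<le> C * norm_L2 \<nu> F)"

lemma ex_sampling_bound:
  assumes "compact E"
  obtains C where "sampling_bound E C"
proof -
  obtain C where C: "C \<ge> 0" "\<And>F. F \<in> supported_L2 E \<Longrightarrow> sq_norm \<mu>\<Gamma> (inv_fourier F) \<le> ennreal C * sq_norm \<nu> F"
    using sampling_bounded[OF assms] by blast
  have "inv_fourier F \<in> L2 \<mu>\<Gamma> \<and> norm_L2 \<mu>\<Gamma> (inv_fourier F) \<le> sqrt C * norm_L2 \<nu> F" if F: "F \<in> supported_L2 E" for F
  proof
    have "ennreal C * sq_norm \<nu> F < \<infinity>"
      using supported_L2D(1)[OF F] by (simp add: L2_iff ennreal_mult_less_top)
    then show L2: "inv_fourier F \<in> L2 \<mu>\<Gamma>"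
      using C(2)[OF F] measurable_inv_fourier_\<Gamma>[OF supported_L2D(3)[OF F]] by (auto simp: L2_iff)
    have "ennreal ((norm_L2 \<mu>\<Gamma> (inv_fourier F))\<^sup>2) \<le> ennreal C * ennreal ((norm_L2 \<nu> F)\<^sup>2)"
      using C(2)[OF F] by (simp only: sq_norm_eq[OF L2] sq_norm_eq[OF supported_L2D(1)[OF F]])
    also have "\<dots> = ennreal ((sqrt C * norm_L2 \<nu> F)\<^sup>2)"
      using C(1) by (simp add: ennreal_mult power_mult_distrib)
    finally have "(norm_L2 \<mu>\<Gamma> (inv_fourier F))\<^sup>2 \<le> (sqrt C * norm_L2 \<nu> F)\<^sup>2"
      by simp
    then show "norm_L2 \<mu>\<Gamma> (inv_fourier F) \<le> sqrt C * norm_L2 \<nu> F"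
      by (rule power2_le_imp_le) (simp add: C(1))
  qed
  then show thesis using C(1) that[of "sqrt C"] by (simp add: sampling_bound_def)
qed

lemma inv_fourier_add:
  assumes "F \<in> supported_L2 E" "G \<in> supported_L2 E" "compact E"
  shows "inv_fourier (\<lambda>\<xi>. F \<xi> + G \<xi>) x = inv_fourier F x + inv_fourier G x"
  using assms(1,2)[THEN supported_L2_integrable[OF _ assms(3)], THEN integrable_mult_pairing]
  by (simp add: inv_fourier_def distrib_right)

lemma inv_fourier_cmult: "inv_fourier (\<lambda>\<xi>. c * F \<xi>) x = c * inv_fourier F x"
  by (simp add: inv_fourier_def mult.assoc)

lemma supported_L2_cmult:
  assumes "F \<in> supported_L2 E"
  shows "(\<lambda>\<xi>. c * F \<xi>) \<in> supported_L2 E"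
  using assms by (auto simp: supported_L2_def L2_cmult)

lemma supported_L2_mult_continuous:
  assumes "F \<in> supported_L2 E" "compact E" "continuous_on UNIV f"
  shows "(\<lambda>\<xi>. f \<xi> * F \<xi>) \<in> supported_L2 E"
proof -
  have "bounded (f ` E)"
    using assms by (intro compact_imp_bounded compact_continuous_image continuous_on_subset[OF assms(3)]) auto
  then obtain c where "\<And>\<xi>. \<xi> \<in> E \<Longrightarrow> cmod (f \<xi>) \<le> c" by (auto simp: bounded_iff)
  then show ?thesis
    using assms by (intro supported_L2_mult(1)[where c = c] borel_measurable_continuous_onI)
qed

lemma continuous_pairing_left: "continuous_on UNIV (\<lambda>\<xi> :: 'g dual_group. pairing \<xi> x)"
proof -
  have "continuous_on UNIV (\<lambda>\<xi> :: 'g dual_group. (\<xi>, x))" by (intro continuous_intros)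
  from continuous_on_compose2[OF continuous_pairing_prod[OF locally_compact] this] show ?thesis by simp
qed

lemma continuous_Re_pairing: "continuous_on UNIV (\<lambda>\<xi> :: 'g dual_group. Re (c * pairing \<xi> x))"
  by (intro continuous_intros continuous_pairing_left)

text \<open>Self-adjointness of a real multiplier with respect to the samples. Such multipliers form
  a real algebra closed under uniform limits on \<open>E\<close>, which is what the real
  Stone-Weierstrass theorem asks for.\<close>

definition sampling_symmetric :: "'g dual_group set \<Rightarrow> ('g dual_group \<Rightarrow> real) \<Rightarrow> bool" where
  "sampling_symmetric E f \<longleftrightarrow> continuous_on UNIV f \<and> (\<forall>F\<in>supported_L2 E. \<forall>G\<in>supported_L2 E.
    inner_L2 \<mu>\<Gamma> (inv_fourier (\<lambda>\<xi>. complex_of_real (f \<xi>) * F \<xi>)) (inv_fourier G) =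
    inner_L2 \<mu>\<Gamma> (inv_fourier F) (inv_fourier (\<lambda>\<xi>. complex_of_real (f \<xi>) * G \<xi>)))"

context
  fixes E :: "'g dual_group set" and C :: real
  assumes E: "compact E" and C: "sampling_bound E C"
begin

lemma inv_fourier_L2_\<Gamma>: "F \<in> supported_L2 E \<Longrightarrow> inv_fourier F \<in> L2 \<mu>\<Gamma>"
  and norm_inv_fourier_\<Gamma>: "F \<in> supported_L2 E \<Longrightarrow> norm_L2 \<mu>\<Gamma> (inv_fourier F) \<le> C * norm_L2 \<nu> F"
  and C_nonneg: "0 \<le> C"
  using C by (auto simp: sampling_bound_def)

lemma supported_L2_mult_real:
  "F \<in> supported_L2 E \<Longrightarrow> continuous_on UNIV f \<Longrightarrow> (\<lambda>\<xi>. complex_of_real (f \<xi>) * F \<xi>) \<in> supported_L2 E"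
  by (intro supported_L2_mult_continuous E continuous_intros)

lemma sampling_symmetric_const: "sampling_symmetric E (\<lambda>_. c)"
  unfolding sampling_symmetric_def
  by (auto simp: inv_fourier_cmult[abs_def] inner_L2_cmult_left inner_L2_cmult_right)

lemma sampling_symmetric_add:
  assumes "sampling_symmetric E f" "sampling_symmetric E g"
  shows "sampling_symmetric E (\<lambda>\<xi>. f \<xi> + g \<xi>)"
  unfolding sampling_symmetric_def
proof (intro conjI ballI)
  have cont: "continuous_on UNIV f" "continuous_on UNIV g" using assms by (auto simp: sampling_symmetric_def)
  then show "continuous_on UNIV (\<lambda>\<xi>. f \<xi> + g \<xi>)" by (intro continuous_intros)
  fix F G assume FG: "F \<in> supported_L2 E" "G \<in> supported_L2 E"
  have *: "inv_fourier (\<lambda>\<xi>. complex_of_real (f \<xi> + g \<xi>) * F \<xi>) = (\<lambda>x. inv_fourier (\<lambda>\<xi>. complex_of_real (f \<xi>) * F \<xi>) x + inv_fourier (\<lambda>\<xi>. complex_of_real (g \<xi>) * F \<xi>) x)"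
    if "F \<in> supported_L2 E" for F
  proof
    fix x
    have "(\<lambda>\<xi>. complex_of_real (f \<xi> + g \<xi>) * F \<xi>) = (\<lambda>\<xi>. complex_of_real (f \<xi>) * F \<xi> + complex_of_real (g \<xi>) * F \<xi>)"
      by (simp add: distrib_right)
    then show "inv_fourier (\<lambda>\<xi>. complex_of_real (f \<xi> + g \<xi>) * F \<xi>) x =
        inv_fourier (\<lambda>\<xi>. complex_of_real (f \<xi>) * F \<xi>) x + inv_fourier (\<lambda>\<xi>. complex_of_real (g \<xi>) * F \<xi>) x"
      by (simp only: inv_fourier_add[OF supported_L2_mult_real[OF that cont(1)] supported_L2_mult_real[OF that cont(2)] E])
  qed
  note L = inv_fourier_L2_\<Gamma>[OF supported_L2_mult_real[OF _ cont(1)]] inv_fourier_L2_\<Gamma>[OF supported_L2_mult_real[OF _ cont(2)]]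
    inv_fourier_L2_\<Gamma>
  have "inner_L2 \<mu>\<Gamma> (inv_fourier (\<lambda>\<xi>. complex_of_real (f \<xi> + g \<xi>) * F \<xi>)) (inv_fourier G) =
      inner_L2 \<mu>\<Gamma> (inv_fourier F) (inv_fourier (\<lambda>\<xi>. complex_of_real (f \<xi>) * G \<xi>)) +
      inner_L2 \<mu>\<Gamma> (inv_fourier F) (inv_fourier (\<lambda>\<xi>. complex_of_real (g \<xi>) * G \<xi>))"
    unfolding *[OF FG(1)] using assms FG L by (subst inner_L2_add_left) (auto simp: sampling_symmetric_def)
  also have "\<dots> = inner_L2 \<mu>\<Gamma> (inv_fourier F) (inv_fourier (\<lambda>\<xi>. complex_of_real (f \<xi> + g \<xi>) * G \<xi>))"
    unfolding *[OF FG(2)] using FG L by (subst inner_L2_add_right) auto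
  finally show "inner_L2 \<mu>\<Gamma> (inv_fourier (\<lambda>\<xi>. complex_of_real (f \<xi> + g \<xi>) * F \<xi>)) (inv_fourier G) =
      inner_L2 \<mu>\<Gamma> (inv_fourier F) (inv_fourier (\<lambda>\<xi>. complex_of_real (f \<xi> + g \<xi>) * G \<xi>))" .
qed

lemma sampling_symmetric_mult:
  assumes "sampling_symmetric E f" "sampling_symmetric E g"
  shows "sampling_symmetric E (\<lambda>\<xi>. f \<xi> * g \<xi>)"
  unfolding sampling_symmetric_def
proof (intro conjI ballI)
  have cont: "continuous_on UNIV f" "continuous_on UNIV g" using assms by (auto simp: sampling_symmetric_def)
  then show "continuous_on UNIV (\<lambda>\<xi>. f \<xi> * g \<xi>)" by (intro continuous_intros)
  fix F G assume FG: "F \<in> supported_L2 E" "G \<in> supported_L2 E"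
  have "inner_L2 \<mu>\<Gamma> (inv_fourier (\<lambda>\<xi>. complex_of_real (f \<xi>) * (complex_of_real (g \<xi>) * F \<xi>))) (inv_fourier G) =
      inner_L2 \<mu>\<Gamma> (inv_fourier (\<lambda>\<xi>. complex_of_real (g \<xi>) * F \<xi>)) (inv_fourier (\<lambda>\<xi>. complex_of_real (f \<xi>) * G \<xi>))"
    using assms(1) FG supported_L2_mult_real[OF FG(1) cont(2)] by (simp add: sampling_symmetric_def)
  also have "\<dots> = inner_L2 \<mu>\<Gamma> (inv_fourier F) (inv_fourier (\<lambda>\<xi>. complex_of_real (g \<xi>) * (complex_of_real (f \<xi>) * G \<xi>)))"
    using assms(2) FG supported_L2_mult_real[OF FG(2) cont(1)] by (simp add: sampling_symmetric_def)
  finally show "inner_L2 \<mu>\<Gamma> (inv_fourier (\<lambda>\<xi>. complex_of_real (f \<xi> * g \<xi>) * F \<xi>)) (inv_fourier G) =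
      inner_L2 \<mu>\<Gamma> (inv_fourier F) (inv_fourier (\<lambda>\<xi>. complex_of_real (f \<xi> * g \<xi>) * G \<xi>))"
    by (simp add: mult.assoc mult.left_commute)
qed

text \<open>Multiplication by \<open>pairing \<xi> \<gamma>\<close> translates the samples by
  \<open>\<gamma>\<close>, a symmetry of \<open>\<mu>\<Gamma>\<close> whose adjoint is translation
  by \<open>- \<gamma>\<close>; the real part combines the two. The factor \<open>c\<close> is there
  to reach imaginary parts too, with \<open>c = - \<i>\<close>.\<close>

lemma sampling_symmetric_pairing:
  assumes \<gamma>: "\<gamma> \<in> \<Gamma>"
  shows "sampling_symmetric E (\<lambda>\<xi>. Re (c * pairing \<xi> \<gamma>))"
  unfolding sampling_symmetric_def
proof (intro conjI ballI)
  show "continuous_on UNIV (\<lambda>\<xi> :: 'g dual_group. Re (c * pairing \<xi> \<gamma>))" by (rule continuous_Re_pairing)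
  fix F G assume FG: "F \<in> supported_L2 E" "G \<in> supported_L2 E"
  define T where "T y H \<xi> = pairing \<xi> y * H \<xi>" for y and H :: "'g dual_group \<Rightarrow> complex" and \<xi>
  have T: "T y H \<in> supported_L2 E" if "H \<in> supported_L2 E" for y H
    unfolding T_def[abs_def] by (intro supported_L2_mult_continuous that E continuous_pairing_left)
  have Re: "inv_fourier (\<lambda>\<xi>. complex_of_real (Re (c * pairing \<xi> \<gamma>)) * H \<xi>) =
      (\<lambda>x. c / 2 * inv_fourier (T \<gamma> H) x + cnj c / 2 * inv_fourier (T (- \<gamma>) H) x)"
    if H: "H \<in> supported_L2 E" for H
  proof
    fix x
    have half: "complex_of_real (Re z) = z / 2 + cnj z / 2" for z by (simp add: complex_eq_iff)
    have eq: "complex_of_real (Re (c * pairing \<xi> \<gamma>)) * H \<xi> = c / 2 * T \<gamma> H \<xi> + cnj c / 2 * T (- \<gamma>) H \<xi>" for \<xi>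
      unfolding half[of "c * pairing \<xi> \<gamma>"] by (simp add: T_def pairing_minus distrib_right mult.assoc)
    show "inv_fourier (\<lambda>\<xi>. complex_of_real (Re (c * pairing \<xi> \<gamma>)) * H \<xi>) x =
      c / 2 * inv_fourier (T \<gamma> H) x + cnj c / 2 * inv_fourier (T (- \<gamma>) H) x"
      unfolding eq by (subst inv_fourier_add[OF supported_L2_cmult supported_L2_cmult E])
        (simp_all only: T[OF H] inv_fourier_cmult)
  qed
  have shift: "inner_L2 \<mu>\<Gamma> (inv_fourier (T y F)) (inv_fourier G) = inner_L2 \<mu>\<Gamma> (inv_fourier F) (inv_fourier (T (- y) G))"
    if y: "y \<in> \<Gamma>" for y
  proof -
    have [measurable]: "F \<in> borel_measurable borel" "G \<in> borel_measurable borel"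
      using FG supported_L2D(3) by auto
    have "inner_L2 \<mu>\<Gamma> (inv_fourier (T y F)) (inv_fourier G) =
        (LINT x|\<mu>\<Gamma>. inv_fourier F (y + x) * cnj (inv_fourier G (- y + (y + x))))"
      by (simp add: inner_L2_def T_def[abs_def] inv_fourier_modulation)
    also have "\<dots> = (LINT x|\<mu>\<Gamma>. inv_fourier F x * cnj (inv_fourier G (- y + x)))"
      by (rule integral_translation_\<Gamma>[OF y, of "\<lambda>x. inv_fourier F x * cnj (inv_fourier G (- y + x))"]) measurable
    also have "\<dots> = inner_L2 \<mu>\<Gamma> (inv_fourier F) (inv_fourier (T (- y) G))"
      by (simp add: inner_L2_def T_def[abs_def] inv_fourier_modulation)
    finally show ?thesis .
  qed
  let ?B = "\<lambda>F G. inner_L2 \<mu>\<Gamma> (inv_fourier F) (inv_fourier G)"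
  let ?m = "\<lambda>F \<xi>. complex_of_real (Re (c * pairing \<xi> \<gamma>)) * F \<xi>"
  note L = inv_fourier_L2_\<Gamma>[OF FG(1)] inv_fourier_L2_\<Gamma>[OF FG(2)]
    L2_cmult[OF inv_fourier_L2_\<Gamma>[OF T[OF FG(1)]]] L2_cmult[OF inv_fourier_L2_\<Gamma>[OF T[OF FG(2)]]]
  have "?B (?m F) G = c / 2 * ?B (T \<gamma> F) G + cnj c / 2 * ?B (T (- \<gamma>) F) G"
    unfolding Re[OF FG(1)] by (subst inner_L2_add_left[OF L(3) L(3) L(2)]) (simp only: inner_L2_cmult_left)
  also have "\<dots> = cnj (cnj c / 2) * ?B F (T (- \<gamma>) G) + cnj (c / 2) * ?B F (T \<gamma> G)"
    using shift[OF \<gamma>] shift[OF uminus_\<Gamma>[OF \<gamma>]] by simp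
  also have "\<dots> = ?B F (?m G)"
    unfolding Re[OF FG(2)]
    by (subst inner_L2_add_right[OF L(4) L(4) L(1)]) (simp only: inner_L2_cmult_right add.commute)
  finally show "?B (?m F) G = ?B F (?m G)" .
qed

text \<open>The sampling bound turns a multiplier below \<open>e\<close> on \<open>E\<close> into
  samples of norm at most \<open>C * e\<close> times the norm of the function, so neither side
  changes much when \<open>f\<close> is replaced by \<open>g\<close>.\<close>

lemma sampling_symmetric_limit:
  assumes f: "continuous_on UNIV f"
    and approx: "\<And>e. e > 0 \<Longrightarrow> \<exists>g. sampling_symmetric E g \<and> (\<forall>\<xi>\<in>E. \<bar>f \<xi> - g \<xi>\<bar> < e)"
  shows "sampling_symmetric E f"
  unfolding sampling_symmetric_def
proof (intro conjI ballI)
  fix F G assume FG: "F \<in> supported_L2 E" "G \<in> supported_L2 E"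
  let ?B = "\<lambda>F G. inner_L2 \<mu>\<Gamma> (inv_fourier F) (inv_fourier G)"
  let ?m = "\<lambda>f F \<xi>. complex_of_real (f \<xi>) * F \<xi>"
  \<comment> \<open>Two error terms, and in each of them both arguments contribute a factor
    \<open>C\<close>.\<close>
  define K where "K = 2 * C\<^sup>2 * norm_L2 \<nu> F * norm_L2 \<nu> G"
  have K: "0 \<le> K" by (simp add: K_def)
  have bound: "cmod (?B (?m f F) G - ?B F (?m f G)) \<le> e * K" if e: "e > 0" for e
  proof -
    obtain g where g: "sampling_symmetric E g" "\<And>\<xi>. \<xi> \<in> E \<Longrightarrow> \<bar>f \<xi> - g \<xi>\<bar> < e"
      using approx[OF e] by blast
    have "continuous_on UNIV g" using g(1) by (simp add: sampling_symmetric_def)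
    note cont = this continuous_on_diff[OF f this]
    have split: "inv_fourier (?m f H) = (\<lambda>x. inv_fourier (?m g H) x + inv_fourier (?m (\<lambda>\<xi>. f \<xi> - g \<xi>) H) x)"
      if "H \<in> supported_L2 E" for H
    proof
      fix x
      have "?m f H = (\<lambda>\<xi>. ?m g H \<xi> + ?m (\<lambda>\<xi>. f \<xi> - g \<xi>) H \<xi>)"
        by (simp add: left_diff_distrib)
      then show "inv_fourier (?m f H) x = inv_fourier (?m g H) x + inv_fourier (?m (\<lambda>\<xi>. f \<xi> - g \<xi>) H) x"
        by (simp only: inv_fourier_add[OF supported_L2_mult_real[OF that cont(1)] supported_L2_mult_real[OF that cont(2)] E])
    qed
    have small: "norm_L2 \<mu>\<Gamma> (inv_fourier (?m (\<lambda>\<xi>. f \<xi> - g \<xi>) H)) \<le> C * (e * norm_L2 \<nu> H)"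
      if H: "H \<in> supported_L2 E" for H
    proof -
      have m: "(\<lambda>\<xi>. complex_of_real (f \<xi> - g \<xi>)) \<in> borel_measurable borel"
        by (intro borel_measurable_continuous_onI continuous_on_of_real cont(2))
      have b: "cmod (complex_of_real (f \<xi> - g \<xi>)) \<le> e" if "\<xi> \<in> E" for \<xi>
        using g(2)[OF that] by (simp only: norm_of_real less_imp_le)
      note S = supported_L2_mult[OF H m b]
      have "ennreal ((norm_L2 \<nu> (?m (\<lambda>\<xi>. f \<xi> - g \<xi>) H))\<^sup>2) \<le> ennreal (e\<^sup>2) * ennreal ((norm_L2 \<nu> H)\<^sup>2)"
        using S(2) by (simp only: sq_norm_eq[OF supported_L2D(1)[OF S(1)]] sq_norm_eq[OF supported_L2D(1)[OF H]])
      also have "\<dots> = ennreal ((e * norm_L2 \<nu> H)\<^sup>2)" by (simp add: ennreal_mult power_mult_distrib)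
      finally have "(norm_L2 \<nu> (?m (\<lambda>\<xi>. f \<xi> - g \<xi>) H))\<^sup>2 \<le> (e * norm_L2 \<nu> H)\<^sup>2"
        by (subst (asm) ennreal_le_iff) auto
      then have "norm_L2 \<nu> (?m (\<lambda>\<xi>. f \<xi> - g \<xi>) H) \<le> e * norm_L2 \<nu> H"
        by (rule power2_le_imp_le) (use e in simp)
      then have "C * norm_L2 \<nu> (?m (\<lambda>\<xi>. f \<xi> - g \<xi>) H) \<le> C * (e * norm_L2 \<nu> H)"
        by (intro mult_left_mono C_nonneg)
      with norm_inv_fourier_\<Gamma>[OF S(1)] show ?thesis by (rule order_trans)
    qed
    note L = inv_fourier_L2_\<Gamma>[OF FG(1)] inv_fourier_L2_\<Gamma>[OF FG(2)]
      inv_fourier_L2_\<Gamma>[OF supported_L2_mult_real[OF FG(1) cont(1)]] inv_fourier_L2_\<Gamma>[OF supported_L2_mult_real[OF FG(1) cont(2)]]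
      inv_fourier_L2_\<Gamma>[OF supported_L2_mult_real[OF FG(2) cont(1)]] inv_fourier_L2_\<Gamma>[OF supported_L2_mult_real[OF FG(2) cont(2)]]
    have "?B (?m f F) G - ?B F (?m f G) = ?B (?m (\<lambda>\<xi>. f \<xi> - g \<xi>) F) G - ?B F (?m (\<lambda>\<xi>. f \<xi> - g \<xi>) G)"
    proof -
      have 0: "?B (?m g F) G = ?B F (?m g G)" using g(1) FG by (simp add: sampling_symmetric_def)
      have 1: "?B (?m f F) G = ?B (?m g F) G + ?B (?m (\<lambda>\<xi>. f \<xi> - g \<xi>) F) G"
        by (subst split[OF FG(1)], rule inner_L2_add_left[OF L(3) L(4) L(2)])
      have 2: "?B F (?m f G) = ?B F (?m g G) + ?B F (?m (\<lambda>\<xi>. f \<xi> - g \<xi>) G)"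
        by (subst split[OF FG(2)], rule inner_L2_add_right[OF L(5) L(6) L(1)])
      show ?thesis by (simp only: 0 1 2 add_diff_cancel_left)
    qed
    also have "cmod \<dots> \<le> cmod (?B (?m (\<lambda>\<xi>. f \<xi> - g \<xi>) F) G) + cmod (?B F (?m (\<lambda>\<xi>. f \<xi> - g \<xi>) G))"
      by (rule norm_triangle_ineq4)
    also have "\<dots> \<le> (C * (e * norm_L2 \<nu> F)) * (C * norm_L2 \<nu> G) + (C * norm_L2 \<nu> F) * (C * (e * norm_L2 \<nu> G))"
    proof (intro add_mono)
      show "cmod (?B (?m (\<lambda>\<xi>. f \<xi> - g \<xi>) F) G) \<le> (C * (e * norm_L2 \<nu> F)) * (C * norm_L2 \<nu> G)"
        using e C_nonneg
        by (intro order_trans[OF cmod_inner_L2_le[OF L(4) L(2)]] mult_mono small norm_inv_fourier_\<Gamma> FG) auto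
      show "cmod (?B F (?m (\<lambda>\<xi>. f \<xi> - g \<xi>) G)) \<le> (C * norm_L2 \<nu> F) * (C * (e * norm_L2 \<nu> G))"
        using e C_nonneg
        by (intro order_trans[OF cmod_inner_L2_le[OF L(1) L(6)]] mult_mono small norm_inv_fourier_\<Gamma> FG) auto
    qed
    also have "\<dots> = e * K" by (simp add: power2_eq_square K_def)
    finally show ?thesis .
  qed
  have "cmod (?B (?m f F) G - ?B F (?m f G)) \<le> 0"
  proof (rule field_le_epsilon)
    fix e :: real assume e: "e > 0"
    have "cmod (?B (?m f F) G - ?B F (?m f G)) \<le> e / (K + 1) * K"
      by (rule bound) (use e K in simp)
    also have "\<dots> \<le> 0 + e" using e K by (simp add: field_simps)
    finally show "cmod (?B (?m f F) G - ?B F (?m f G)) \<le> 0 + e" .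
  qed
  then show "?B (?m f F) G = ?B F (?m f G)" by simp
qed (rule f)

text \<open>Points that are not congruent modulo the annihilator are told apart by the pairing with
  some \<open>\<gamma> \<in> \<Gamma>\<close>. Since \<open>E\<close> meets each class at most once,
  the real and imaginary parts of these pairings separate its points, as Stone-Weierstrass
  requires.\<close>

lemma sampling_symmetric_continuous:
  assumes inj: "\<And>\<xi> \<eta>. \<xi> \<in> E \<Longrightarrow> \<eta> \<in> E \<Longrightarrow> \<xi> - \<eta> \<in> annihilator \<Gamma> \<Longrightarrow> \<xi> = \<eta>"
    and f: "continuous_on UNIV f"
  shows "sampling_symmetric E f"
proof (rule sampling_symmetric_limit[OF f])
  fix e :: real assume e: "e > 0"
  show "\<exists>g. sampling_symmetric E g \<and> (\<forall>\<xi>\<in>E. \<bar>f \<xi> - g \<xi>\<bar> < e)"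
  proof (rule Stone_Weierstrass_HOL[OF E])
    fix \<xi> \<eta> assume \<xi>\<eta>: "\<xi> \<in> E \<and> \<eta> \<in> E \<and> \<xi> \<noteq> \<eta>"
    then obtain \<gamma> where \<gamma>: "\<gamma> \<in> \<Gamma>" "pairing (\<xi> - \<eta>) \<gamma> \<noteq> 1"
      using inj[of \<xi> \<eta>] by (auto simp: annihilator_def)
    have "pairing \<xi> \<gamma> \<noteq> pairing \<eta> \<gamma>"
    proof
      assume "pairing \<xi> \<gamma> = pairing \<eta> \<gamma>"
      then have "pairing (\<xi> - \<eta>) \<gamma> = 1" by (simp only: pairing_diff pairing_mult_cnj)
      then show False using \<gamma>(2) by simp
    qed
    then have "Re (1 * pairing \<xi> \<gamma>) \<noteq> Re (1 * pairing \<eta> \<gamma>) \<or> Re (- \<i> * pairing \<xi> \<gamma>) \<noteq> Re (- \<i> * pairing \<eta> \<gamma>)"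
      by (simp add: complex_eq_iff)
    then show "\<exists>f. sampling_symmetric E f \<and> f \<xi> \<noteq> f \<eta>"
    proof
      assume "Re (1 * pairing \<xi> \<gamma>) \<noteq> Re (1 * pairing \<eta> \<gamma>)"
      with sampling_symmetric_pairing[OF \<gamma>(1), of 1] show ?thesis by blast
    next
      assume "Re (- \<i> * pairing \<xi> \<gamma>) \<noteq> Re (- \<i> * pairing \<eta> \<gamma>)"
      with sampling_symmetric_pairing[OF \<gamma>(1), of "- \<i>"] show ?thesis by blast
    qed
  next
    show "continuous_on E g" if "sampling_symmetric E g" for g
      using that continuous_on_subset unfolding sampling_symmetric_def by blast
    show "continuous_on E f" using f continuous_on_subset by blast
  qed (use e in \<open>auto intro: sampling_symmetric_const sampling_symmetric_add sampling_symmetric_mult\<close>)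
qed

end

text \<open>
  Multiplication by the characters \<open>\<xi> \<mapsto> \<langle>\<xi>, y\<rangle>\<close> preserves the sampled norm: they are uniform limits on \<open>E\<close> of
  trigonometric polynomials with frequencies in \<open>\<Gamma>\<close>, by Stone-Weierstrass, and those with \<open>y \<in> \<Gamma>\<close>
  act by translations of \<open>\<Gamma>\<close>. Weil's formula averages over \<open>y\<close>.
\<close>

lemma sampling_isometry:
  assumes E: "compact E"
    and inj: "\<And>\<xi> \<eta>. \<xi> \<in> E \<Longrightarrow> \<eta> \<in> E \<Longrightarrow> \<xi> - \<eta> \<in> annihilator \<Gamma> \<Longrightarrow> \<xi> = \<eta>"
    and F: "F \<in> supported_L2 E"
  shows "sq_norm \<mu>\<Gamma> (inv_fourier F) = sq_norm \<nu> F"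
proof -
  obtain C where C: "sampling_bound E C" by (rule ex_sampling_bound[OF E])
  \<comment> \<open>Multiplication by \<open>pairing \<xi> y\<close> shifts the samples by an
    arbitrary \<open>y\<close>. Its real and imaginary parts are symmetric multipliers, so its
    adjoint is multiplication by the inverse character, and the sampled norm is preserved.\<close>
  have translate: "sq_norm \<mu>\<Gamma> (\<lambda>\<gamma>. inv_fourier F (y + \<gamma>)) = sq_norm \<mu>\<Gamma> (inv_fourier F)" for y
  proof -
    define T where "T y H \<xi> = pairing \<xi> y * H \<xi>" for y and H :: "'g dual_group \<Rightarrow> complex" and \<xi>
    have T: "T y H \<in> supported_L2 E" if "H \<in> supported_L2 E" for y H
      unfolding T_def[abs_def] by (intro supported_L2_mult_continuous that E continuous_pairing_left)
    define m where "m c H \<xi> = complex_of_real (Re (c * pairing \<xi> y)) * H \<xi>" for c and H :: "'g dual_group \<Rightarrow> complex" and \<xi>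
    have m: "m c H \<in> supported_L2 E" if "H \<in> supported_L2 E" for c H
      unfolding m_def[abs_def] by (intro supported_L2_mult_real[OF E C] that continuous_Re_pairing)
    let ?B = "\<lambda>F G. inner_L2 \<mu>\<Gamma> (inv_fourier F) (inv_fourier G)"
    have sym: "?B (m c H) G = ?B H (m c G)" if "H \<in> supported_L2 E" "G \<in> supported_L2 E" for c H G
      using sampling_symmetric_continuous[OF E C inj continuous_Re_pairing, of c y] that
      by (simp add: sampling_symmetric_def m_def[abs_def])
    have Im: "Im z = Re (- \<i> * z)" for z by simp
    have Ty: "inv_fourier (T y H) = (\<lambda>x. inv_fourier (m 1 H) x + \<i> * inv_fourier (m (- \<i>) H) x)"
      if H: "H \<in> supported_L2 E" for H
    proof
      fix x
      have "T y H = (\<lambda>\<xi>. m 1 H \<xi> + \<i> * m (- \<i>) H \<xi>)"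
        unfolding T_def m_def by (rule ext) (subst complex_eq, simp add: distrib_right)
      then show "inv_fourier (T y H) x = inv_fourier (m 1 H) x + \<i> * inv_fourier (m (- \<i>) H) x"
        by (simp only: inv_fourier_add[OF m[OF H] supported_L2_cmult[OF m[OF H]] E] inv_fourier_cmult)
    qed
    have T_minus: "inv_fourier (T (- y) H) = (\<lambda>x. inv_fourier (m 1 H) x + - \<i> * inv_fourier (m (- \<i>) H) x)"
      if H: "H \<in> supported_L2 E" for H
    proof
      fix x
      have "cnj z = complex_of_real (Re (1 * z)) + - \<i> * complex_of_real (Re (- \<i> * z))" for z
        by (simp add: complex_eq_iff)
      then have "T (- y) H = (\<lambda>\<xi>. m 1 H \<xi> + - \<i> * m (- \<i>) H \<xi>)"
        unfolding T_def m_def pairing_minus by (intro ext) (metis distrib_right mult.assoc)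
      then show "inv_fourier (T (- y) H) x = inv_fourier (m 1 H) x + - \<i> * inv_fourier (m (- \<i>) H) x"
        by (simp only: inv_fourier_add[OF m[OF H] supported_L2_cmult[OF m[OF H]] E] inv_fourier_cmult)
    qed
    note L = inv_fourier_L2_\<Gamma>[OF E C]
    define G where "G = T y F"
    have G: "G \<in> supported_L2 E" unfolding G_def by (rule T[OF F])
    have "?B G G = ?B (m 1 F) G + \<i> * ?B (m (- \<i>) F) G"
      unfolding G_def[symmetric] unfolding G_def
      by (subst (1) Ty[OF F], subst inner_L2_add_left[OF L[OF m[OF F]] L2_cmult[OF L[OF m[OF F]]] L[OF T[OF F]]])
        (simp only: inner_L2_cmult_left)
    also have "\<dots> = ?B F (m 1 G) + cnj (- \<i>) * ?B F (m (- \<i>) G)"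
      by (simp only: sym[OF F G]) simp
    also have "\<dots> = ?B F (T (- y) G)"
      by (subst T_minus[OF G], subst inner_L2_add_right[OF L[OF m[OF G]] L2_cmult[OF L[OF m[OF G]]] L[OF F]])
        (simp only: inner_L2_cmult_right)
    also have "T (- y) G = F"
    proof
      fix \<xi>
      have "T (- y) G \<xi> = pairing \<xi> (- y + y) * F \<xi>" by (simp only: G_def T_def pairing_add mult.assoc)
      then show "T (- y) G \<xi> = F \<xi>" by simp
    qed
    finally have "complex_of_real ((norm_L2 \<mu>\<Gamma> (inv_fourier G))\<^sup>2) = complex_of_real ((norm_L2 \<mu>\<Gamma> (inv_fourier F))\<^sup>2)"
      by (simp only: inner_L2_self)
    then have "sq_norm \<mu>\<Gamma> (inv_fourier G) = sq_norm \<mu>\<Gamma> (inv_fourier F)"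
      by (simp only: of_real_eq_iff sq_norm_eq[OF L[OF G]] sq_norm_eq[OF L[OF F]])
    moreover have "inv_fourier G = (\<lambda>\<gamma>. inv_fourier F (y + \<gamma>))"
      unfolding G_def T_def[abs_def] by (rule ext) (rule inv_fourier_modulation)
    ultimately show ?thesis by simp
  qed
  have "sq_norm \<nu> F = (\<integral>\<^sup>+c. sq_norm \<mu>\<Gamma> (inv_fourier F) \<partial>\<kappa>)"
    unfolding sq_norm_\<Gamma>_weil[OF F E, symmetric] translate ..
  also have "\<dots> = sq_norm \<mu>\<Gamma> (inv_fourier F)"
    using prob_space.emeasure_space_1[OF prob_\<kappa>] by simp
  finally show ?thesis ..
qed

text \<open>\<open>E\<^sub>0\<close> is only Borel, whereas the isometry needs a compact support.
  Regularity of the measure with density \<open>(cmod (F \<xi>))\<^sup>2\<close> gives a compact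
  \<open>K \<subseteq> E\<^sub>0\<close> that carries \<open>F\<close> up to a small norm, and the
  sampling bound of \<open>E\<close> controls the remainder.\<close>

lemma sampling_contraction:
  assumes E: "compact E" and E\<^sub>0: "E\<^sub>0 \<subseteq> E" "E\<^sub>0 \<in> sets borel"
    and inj: "\<And>\<xi> \<eta>. \<xi> \<in> E\<^sub>0 \<Longrightarrow> \<eta> \<in> E\<^sub>0 \<Longrightarrow> \<xi> - \<eta> \<in> annihilator \<Gamma> \<Longrightarrow> \<xi> = \<eta>"
    and F: "F \<in> supported_L2 E\<^sub>0"
  shows "sq_norm \<mu>\<Gamma> (inv_fourier F) \<le> sq_norm \<nu> F"
proof -
  obtain C where C: "sampling_bound E C" by (rule ex_sampling_bound[OF E])
  note L = inv_fourier_L2_\<Gamma>[OF E C]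
  have FE: "F \<in> supported_L2 E" using F E\<^sub>0(1) by (auto simp: supported_L2_def)
  have [measurable]: "F \<in> borel_measurable borel" using supported_L2D(3)[OF F] .
  define M where "M = density \<nu> (\<lambda>\<xi>. ennreal ((cmod (F \<xi>))\<^sup>2))"
  have sets_M: "sets M = sets borel" by (simp add: M_def)
  have M: "emeasure M A = sq_norm \<nu> (\<lambda>\<xi>. indicator A \<xi> * F \<xi>)" if [measurable]: "A \<in> sets borel" for A
    unfolding M_def sq_norm_def
    by (subst emeasure_density) (auto simp: indicator_def intro!: nn_integral_cong)
  have "emeasure M UNIV \<noteq> \<infinity>" using supported_L2D(1)[OF F] by (simp add: M L2_iff)
  note regular = finite_borel_measure_regular[OF sets_M this E\<^sub>0(2)]
  have "norm_L2 \<mu>\<Gamma> (inv_fourier F) \<le> norm_L2 \<nu> F + e" if e: "e > 0" for e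
  proof -
    \<comment> \<open>Chosen so that \<open>C\<close> times its square root is at most
      \<open>e\<close>; the summand 1 covers \<open>C = 0\<close>.\<close>
    define \<epsilon> where "\<epsilon> = (e / (C + 1))\<^sup>2"
    have C0: "0 \<le> C" by (rule C_nonneg[OF E C])
    have "\<epsilon> > 0" using e C0 by (simp add: \<epsilon>_def)
    from regular[OF this] obtain K U where KU: "closed K" "open U" "K \<subseteq> E\<^sub>0" "E\<^sub>0 \<subseteq> U" "emeasure M (U - K) < ennreal \<epsilon>"
      by blast
    have K: "compact K" using E KU(1,3) E\<^sub>0(1) by (metis compact_Int_closed inf.absorb_iff2 order_trans)
    have [measurable]: "K \<in> sets borel" "U \<in> sets borel" using KU by auto
    define F\<^sub>1 where "F\<^sub>1 \<xi> = indicator K \<xi> * F \<xi>" for \<xi>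
    define F\<^sub>2 where "F\<^sub>2 \<xi> = indicator (- K) \<xi> * F \<xi>" for \<xi>
    have sum: "F = (\<lambda>\<xi>. F\<^sub>1 \<xi> + F\<^sub>2 \<xi>)" by (auto simp: F\<^sub>1_def F\<^sub>2_def indicator_def)
    have ind: "cmod (indicator A \<xi>) \<le> 1" for A :: "'g dual_group set" and \<xi> by (cases "\<xi> \<in> A") auto
    have mK: "(indicator K :: _ \<Rightarrow> complex) \<in> borel_measurable borel"
      "(indicator (- K) :: _ \<Rightarrow> complex) \<in> borel_measurable borel" by measurable
    have 1: "F\<^sub>1 \<in> supported_L2 E" "sq_norm \<nu> F\<^sub>1 \<le> ennreal (1\<^sup>2) * sq_norm \<nu> F"
      unfolding F\<^sub>1_def[abs_def] by (rule supported_L2_mult[OF FE mK(1) ind])+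
    have 2: "F\<^sub>2 \<in> supported_L2 E"
      unfolding F\<^sub>2_def[abs_def] by (rule supported_L2_mult(1)[OF FE mK(2) ind])
    have F1K: "F\<^sub>1 \<in> supported_L2 K" using 1(1) by (auto simp: supported_L2_def F\<^sub>1_def)
    have "norm_L2 \<mu>\<Gamma> (inv_fourier F\<^sub>1) \<le> norm_L2 \<nu> F"
    proof (rule norm_L2_mono[OF L[OF 1(1)] supported_L2D(1)[OF F]])
      have "sq_norm \<mu>\<Gamma> (inv_fourier F\<^sub>1) = sq_norm \<nu> F\<^sub>1"
        using KU(3) inj by (intro sampling_isometry[OF K _ F1K]) blast
      then show "sq_norm \<mu>\<Gamma> (inv_fourier F\<^sub>1) \<le> sq_norm \<nu> F" using 1(2) by simp
    qed
    moreover have "norm_L2 \<mu>\<Gamma> (inv_fourier F\<^sub>2) \<le> e"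
    proof -
      have "F\<^sub>2 = (\<lambda>\<xi>. indicator (U - K) \<xi> * F \<xi>)"
        using supported_L2D(2)[OF F] KU(4) by (auto simp: F\<^sub>2_def indicator_def fun_eq_iff)
      then have "sq_norm \<nu> F\<^sub>2 < ennreal \<epsilon>" using KU(5) by (simp add: M)
      then have "ennreal ((norm_L2 \<nu> F\<^sub>2)\<^sup>2) \<le> ennreal \<epsilon>" by (simp add: sq_norm_eq[OF supported_L2D(1)[OF 2]])
      then have "(norm_L2 \<nu> F\<^sub>2)\<^sup>2 \<le> (e / (C + 1))\<^sup>2" by (subst (asm) ennreal_le_iff) (auto simp: \<epsilon>_def)
      then have "norm_L2 \<nu> F\<^sub>2 \<le> e / (C + 1)"
        by (rule power2_le_imp_le) (use e C0 in simp)
      then have "C * norm_L2 \<nu> F\<^sub>2 \<le> C * (e / (C + 1))" by (rule mult_left_mono[OF _ C0])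
      also have "\<dots> \<le> e" using e C0 by (simp add: field_simps)
      finally show ?thesis using norm_inv_fourier_\<Gamma>[OF E C 2] by simp
    qed
    moreover have "inv_fourier F = (\<lambda>x. inv_fourier F\<^sub>1 x + inv_fourier F\<^sub>2 x)"
      by (rule ext, subst sum) (rule inv_fourier_add[OF 1(1) 2 E])
    ultimately show ?thesis using norm_L2_triangle[OF L[OF 1(1)] L[OF 2]] by simp
  qed
  then have "norm_L2 \<mu>\<Gamma> (inv_fourier F) \<le> norm_L2 \<nu> F" by (rule field_le_epsilon)
  then show ?thesis
    unfolding sq_norm_eq[OF L[OF FE]] sq_norm_eq[OF supported_L2D(1)[OF F]]
    by (intro ennreal_leI power_mono) auto
qed

text \<open>Cocompactness gives a compact \<open>K'\<close> that meets every coset. A character of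
  the annihilator near 0 has positive real part on \<open>K'\<close>, hence everywhere, and a group
  of unimodular numbers in the open right half plane is trivial.\<close>

lemma annihilator_discrete: "\<exists>s>0. \<forall>\<xi>\<in>annihilator \<Gamma>. d 0 \<xi> < s \<longrightarrow> \<xi> = 0"
proof -
  let ?\<pi> = "\<lambda>x. x +o \<Gamma>"
  have coset_iff: "x +o \<Gamma> \<in> ?\<pi> ` V \<longleftrightarrow> (\<exists>\<gamma>\<in>\<Gamma>. x + \<gamma> \<in> V)" for x V
  proof
    assume "x +o \<Gamma> \<in> ?\<pi> ` V"
    then obtain v where v: "v \<in> V" "x +o \<Gamma> = v +o \<Gamma>" by blast
    have "v + 0 \<in> v +o \<Gamma>" by (rule set_plus_intro2) simp
    then obtain \<gamma> where "\<gamma> \<in> \<Gamma>" "v = x + \<gamma>" unfolding v(2)[symmetric] by (auto simp: elt_set_plus_def)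
    with v show "\<exists>\<gamma>\<in>\<Gamma>. x + \<gamma> \<in> V" by auto
  next
    assume "\<exists>\<gamma>\<in>\<Gamma>. x + \<gamma> \<in> V"
    then obtain \<gamma> where \<gamma>: "\<gamma> \<in> \<Gamma>" "x + \<gamma> \<in> V" by blast
    have "x +o \<Gamma> = (x + \<gamma>) +o \<Gamma>"
    proof (intro set_eqI iffI)
      fix z assume "z \<in> x +o \<Gamma>"
      then obtain g where "g \<in> \<Gamma>" "z = x + g" by (auto simp: elt_set_plus_def)
      then show "z \<in> (x + \<gamma>) +o \<Gamma>"
        using \<gamma>(1) diff_\<Gamma>[of g \<gamma>] by (auto simp: elt_set_plus_def intro!: bexI[of _ "g - \<gamma>"])
    next
      fix z assume "z \<in> (x + \<gamma>) +o \<Gamma>"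
      then obtain g where "g \<in> \<Gamma>" "z = x + \<gamma> + g" by (auto simp: elt_set_plus_def)
      then show "z \<in> x +o \<Gamma>"
        using \<gamma>(1) add_\<Gamma>[of \<gamma> g] by (auto simp: elt_set_plus_def add.assoc)
    qed
    with \<gamma>(2) show "x +o \<Gamma> \<in> ?\<pi> ` V" by auto
  qed
  have "\<exists>V K. open V \<and> compact K \<and> x \<in> V \<and> V \<subseteq> K" for x :: 'g
  proof -
    obtain V K where "open V" "compact K" "x \<in> V" "V \<subseteq> K" "K \<subseteq> UNIV"
      by (rule locally_compactE[OF locally_compact open_UNIV UNIV_I])
    then show ?thesis by blast
  qed
  then obtain V K where VK: "\<And>x::'g. open (V x)" "\<And>x. compact (K x)" "\<And>x. x \<in> V x" "\<And>x. V x \<subseteq> K x"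
    by metis
  have open_translate: "open {x. x + \<gamma> \<in> V y}" for \<gamma> y
    using VK(1)[of y] continuous_on_add[OF continuous_on_id continuous_on_const, of UNIV \<gamma>]
    by (simp add: continuous_on_open_vimage vimage_def)
  \<comment> \<open>The quotient map is open: the preimage of the image of \<open>V y\<close> is a
    union of translates of \<open>V y\<close>. This lets a finite subcover of the quotient lift to
    the compact set \<open>K'\<close>.\<close>
  have "openin (coset_topology \<Gamma>) (?\<pi> ` V y)" for y
  proof -
    have "{x. x +o \<Gamma> \<in> ?\<pi> ` V y} = (\<Union>\<gamma>\<in>\<Gamma>. {x. x + \<gamma> \<in> V y})"
      by (simp only: coset_iff) auto
    then have "open {x. x +o \<Gamma> \<in> ?\<pi> ` V y}" using open_translate by auto
    then show ?thesis by (simp add: openin_coset_topology image_mono)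
  qed
  moreover have "topspace (coset_topology \<Gamma>) \<subseteq> \<Union> (range (\<lambda>y. ?\<pi> ` V y))"
    unfolding topspace_coset_topology using VK(3) by auto
  ultimately obtain \<F> where \<F>: "finite \<F>" "\<F> \<subseteq> range (\<lambda>y. ?\<pi> ` V y)" "topspace (coset_topology \<Gamma>) \<subseteq> \<Union>\<F>"
    using cocompact unfolding compact_space_alt by (metis (no_types, lifting) imageE)
  obtain Y where Y: "finite Y" "\<F> = (\<lambda>y. ?\<pi> ` V y) ` Y"
    using finite_subset_image[OF \<F>(1,2)] by blast
  define K' where "K' = (\<Union>y\<in>Y. K y)"
  have K': "compact K'" unfolding K'_def using Y(1) VK(2) by (intro compact_UN) auto
  have cover: "\<exists>\<gamma>\<in>\<Gamma>. x + \<gamma> \<in> K'" for x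
  proof -
    have "x +o \<Gamma> \<in> \<Union>\<F>" using \<F>(3) unfolding topspace_coset_topology by blast
    then obtain y where "y \<in> Y" "x +o \<Gamma> \<in> ?\<pi> ` V y" unfolding Y(2) by blast
    then show ?thesis unfolding coset_iff K'_def using VK(4) by blast
  qed
  have O: "open {\<xi>. pairing \<xi> ` K' \<subseteq> {z. 0 < Re z}}"
    by (intro open_subbasic_dual K' open_halfspace_Re_gt)
  have "0 \<in> {\<xi>. pairing \<xi> ` K' \<subseteq> {z. 0 < Re z}}" by auto
  from bspec[OF iffD1[OF open_iff O] this]
  obtain s where s: "s > 0" "mball 0 s \<subseteq> {\<xi>. pairing \<xi> ` K' \<subseteq> {z. 0 < Re z}}" by blast
  have "\<xi> = 0" if \<xi>: "\<xi> \<in> annihilator \<Gamma>" "d 0 \<xi> < s" for \<xi>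
  proof (rule pairing_eqI)
    fix x
    have Re: "0 < Re (pairing \<xi> x)" for x
    proof -
      obtain \<gamma> where \<gamma>: "\<gamma> \<in> \<Gamma>" "x + \<gamma> \<in> K'" using cover by blast
      have "pairing \<xi> (x + \<gamma>) = pairing \<xi> x" using \<xi>(1) \<gamma>(1) by (simp add: annihilator_def pairing_add)
      moreover have "\<xi> \<in> mball 0 s" using \<xi>(2) by simp
      then have "pairing \<xi> ` K' \<subseteq> {z. 0 < Re z}" using s(2) by blast
      then have "0 < Re (pairing \<xi> (x + \<gamma>))" using \<gamma>(2) by auto
      ultimately show ?thesis by simp
    qed
    \<comment> \<open>With \<open>pairing \<xi> x = cos t + \<i> * sin t\<close> this is
      \<open>1 - cos (2 t) = 2 (1 - cos t) (1 + cos t)\<close>, where \<open>cos t > 0\<close>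
      bounds the last factor below by 1. Iterated doubling forces \<open>1 - cos t\<close> under
      every power of \<open>1/2\<close>.\<close>
    have double: "1 - Re (pairing \<xi> x) \<le> (1 - Re (pairing \<xi> (x + x))) / 2" for x
    proof -
      let ?z = "pairing \<xi> x"
      have sq: "(Re ?z)\<^sup>2 + (Im ?z)\<^sup>2 = 1" using cmod_pairing[of \<xi> x] by (simp add: cmod_def)
      have "Re (pairing \<xi> (x + x)) = (Re ?z)\<^sup>2 - (Im ?z)\<^sup>2" by (simp add: pairing_add power2_eq_square)
      then have "1 - Re (pairing \<xi> (x + x)) = 2 * ((1 - Re ?z) * (1 + Re ?z))"
        using sq by (simp add: algebra_simps power2_eq_square)
      moreover have "(1 - Re ?z) * 1 \<le> (1 - Re ?z) * (1 + Re ?z)"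
        using Re[of x] complex_Re_le_cmod[of ?z] by (intro mult_left_mono) auto
      ultimately show ?thesis by simp
    qed
    have "1 - Re (pairing \<xi> x) \<le> (1 / 2) ^ n" for n x
    proof (induction n arbitrary: x)
      case 0
      then show ?case using Re[of x] by simp
    next
      case (Suc n)
      note double[of x]
      also have "(1 - Re (pairing \<xi> (x + x))) / 2 \<le> (1 / 2) ^ n / 2"
        by (intro divide_right_mono Suc.IH) simp
      finally show ?case by simp
    qed
    moreover have "(\<lambda>n. (1 / 2) ^ n) \<longlonglongrightarrow> (0 :: real)" by (intro LIMSEQ_power_zero) simp
    ultimately have "1 - Re (pairing \<xi> x) \<le> 0" by (intro LIMSEQ_le_const) blast+
    then have Re1: "Re (pairing \<xi> x) = 1" using complex_Re_le_cmod[of "pairing \<xi> x"] by simp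
    then have "Im (pairing \<xi> x) = 0" using cmod_pairing[of \<xi> x] by (simp add: cmod_def)
    with Re1 show "pairing \<xi> x = pairing 0 x" by (simp add: complex_eq_iff)
  qed
  with s(1) show ?thesis by blast
qed

text \<open>
  The points of each class modulo \<open>\<Gamma>\<^sup>\<bottom>\<close> are ranked according to the index of the piece that contains them,
  and \<open>F\<close> is cut into its restrictions to the sets of points of a given rank.
\<close>

lemma sampling_le_card:
  assumes E: "compact E" and n: "0 < n"
    and fin: "finite (annihilator \<Gamma> \<inter> D)" and card: "card (annihilator \<Gamma> \<inter> D) \<le> n"
    and D: "\<And>\<xi> \<eta>. \<xi> \<in> E \<Longrightarrow> \<eta> \<in> E \<Longrightarrow> \<xi> - \<eta> \<in> D"
    and F: "F \<in> supported_L2 E"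
  shows "sq_norm \<mu>\<Gamma> (inv_fourier F) \<le> of_nat n * sq_norm \<nu> F"
proof -
  define \<Lambda> where "\<Lambda> = annihilator \<Gamma> \<inter> D"
  have ann_diff: "z - z' \<in> annihilator \<Gamma>" if "z \<in> annihilator \<Gamma>" "z' \<in> annihilator \<Gamma>" for z z'
    using that by (simp add: annihilator_def pairing_diff)
  obtain s where s: "s > 0" "\<And>\<xi>. \<xi> \<in> annihilator \<Gamma> \<Longrightarrow> d 0 \<xi> < s \<Longrightarrow> \<xi> = 0"
    using annihilator_discrete by blast
  have [measurable]: "E \<in> sets borel" using E by (simp add: compact_imp_closed)
  obtain Y where Y: "finite Y" "E \<subseteq> (\<Union>y\<in>Y. mball y (s / 2))"
  proof (rule compactE_image[OF E, of UNIV "\<lambda>y. mball y (s / 2)"])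
    have "\<xi> \<in> mball \<xi> (s / 2)" for \<xi> using s(1) by simp
    then show "E \<subseteq> (\<Union>y\<in>UNIV. mball y (s / 2))" by blast
  qed (auto intro: that)
  obtain c k where c: "Y = c ` {..<k::nat}"
    using finite_imp_nat_seg_image_inj_on[OF Y(1)] by (auto simp: lessThan_def)
  \<comment> \<open>Disjoint pieces of \<open>E\<close> whose points are less than \<open>s\<close>
    apart. As \<open>s\<close> separates the annihilator from 0, a piece contains at most one point
    of each class.\<close>
  define Q where "Q i = E \<inter> mball (c i) (s / 2) - (\<Union>j<i. mball (c j) (s / 2))" for i
  have [measurable]: "Q i \<in> sets borel" for i unfolding Q_def by measurable
  have Q_disj: "i = j" if "\<xi> \<in> Q i" "\<xi> \<in> Q j" for \<xi> i j
    using that by (cases i j rule: linorder_cases) (auto simp: Q_def)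
  have Q_E: "\<xi> \<in> E" if "\<xi> \<in> Q i" for \<xi> i using that by (auto simp: Q_def)
  have Q_small: "\<xi> = \<eta>" if "\<xi> \<in> Q i" "\<eta> \<in> Q i" "\<xi> - \<eta> \<in> annihilator \<Gamma>" for \<xi> \<eta> i
  proof -
    have "d \<xi> \<eta> \<le> d \<xi> (c i) + d (c i) \<eta>" by (rule triangle_UNIV)
    then have "d \<xi> \<eta> < s" using that(1,2) by (simp add: Q_def commute)
    then have "d 0 (\<xi> - \<eta>) < s" by (simp add: commute[of 0] dist_diff_0)
    then show ?thesis using s(2)[OF that(3)] by simp
  qed
  have Q_cover: "\<exists>i<k. \<xi> \<in> Q i" if "\<xi> \<in> E" for \<xi>
  proof -
    have ex: "\<exists>i. i < k \<and> \<xi> \<in> mball (c i) (s / 2)" using Y(2) that unfolding c by blast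
    from iffD1[OF exists_least_iff ex] obtain i where
      i: "i < k" "\<xi> \<in> mball (c i) (s / 2)" "\<forall>j<i. \<not> (j < k \<and> \<xi> \<in> mball (c j) (s / 2))" by blast
    have "\<xi> \<notin> (\<Union>j<i. mball (c j) (s / 2))"
    proof
      assume "\<xi> \<in> (\<Union>j<i. mball (c j) (s / 2))"
      then obtain j where j: "j < i" "\<xi> \<in> mball (c j) (s / 2)" by blast
      then have "j < k" using i(1) by simp
      with j i(3) show False by blast
    qed
    with i(2) that have "\<xi> \<in> Q i" unfolding Q_def by blast
    with i(1) show ?thesis by blast
  qed
  \<comment> \<open>The earlier pieces that contain a point congruent to \<open>\<xi>\<close>; their
    number is the rank. Only shifts in the finite set \<open>\<Lambda>\<close> can connect two
    points of \<open>E\<close>, which makes the condition a finite disjunction and so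
    measurable.\<close>
  define R where "R i \<xi> = {j. j < i \<and> (\<exists>z\<in>\<Lambda>. z + \<xi> \<in> Q j)}" for i \<xi>
  have R_fin: "finite (R i \<xi>)" for i \<xi> by (rule finite_subset[of _ "{..<i}"]) (auto simp: R_def)
  define S where "S t i = {\<xi> \<in> Q i. card (R i \<xi>) = t}" for t i
  define P where "P t = (\<Union>i<k. S t i)" for t
  have S_meas [measurable]: "S t i \<in> sets borel" for t i
  proof -
    have [measurable]: "Measurable.pred borel (\<lambda>\<xi>. \<exists>z\<in>\<Lambda>. z + \<xi> \<in> Q j)" for j
      using fin by (intro pred_intros_finite) (simp_all add: \<Lambda>_def)
    let ?A = "{A. A \<subseteq> {..<i} \<and> card A = t}"
    have "finite ?A" by (rule finite_subset[of _ "Pow {..<i}"]) auto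
    moreover have "{\<xi> \<in> space borel. \<forall>j\<in>{..<i}. (\<exists>z\<in>\<Lambda>. z + \<xi> \<in> Q j) \<longleftrightarrow> j \<in> A} \<in> sets borel" for A
      by measurable
    ultimately have "(\<Union>A\<in>?A. {\<xi> \<in> space borel. \<forall>j\<in>{..<i}. (\<exists>z\<in>\<Lambda>. z + \<xi> \<in> Q j) \<longleftrightarrow> j \<in> A}) \<in> sets borel"
      by (intro sets.finite_UN) auto
    also have "(\<Union>A\<in>?A. {\<xi> \<in> space borel. \<forall>j\<in>{..<i}. (\<exists>z\<in>\<Lambda>. z + \<xi> \<in> Q j) \<longleftrightarrow> j \<in> A}) = {\<xi> \<in> space borel. card (R i \<xi>) = t}"
    proof (intro equalityI subsetI)
      fix \<xi> assume "\<xi> \<in> (\<Union>A\<in>?A. {\<xi> \<in> space borel. \<forall>j\<in>{..<i}. (\<exists>z\<in>\<Lambda>. z + \<xi> \<in> Q j) \<longleftrightarrow> j \<in> A})"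
      then obtain A where A: "A \<subseteq> {..<i}" "card A = t" "\<forall>j\<in>{..<i}. (\<exists>z\<in>\<Lambda>. z + \<xi> \<in> Q j) \<longleftrightarrow> j \<in> A" by blast
      then have "R i \<xi> = A" unfolding R_def by blast
      with A(2) show "\<xi> \<in> {\<xi> \<in> space borel. card (R i \<xi>) = t}" by simp
    next
      fix \<xi> assume "\<xi> \<in> {\<xi> \<in> space borel. card (R i \<xi>) = t}"
      then have A: "R i \<xi> \<in> ?A" "\<forall>j\<in>{..<i}. (\<exists>z\<in>\<Lambda>. z + \<xi> \<in> Q j) \<longleftrightarrow> j \<in> R i \<xi>" by (auto simp: R_def)
      show "\<xi> \<in> (\<Union>A\<in>?A. {\<xi> \<in> space borel. \<forall>j\<in>{..<i}. (\<exists>z\<in>\<Lambda>. z + \<xi> \<in> Q j) \<longleftrightarrow> j \<in> A})"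
        by (intro UN_I[OF A(1)] CollectI conjI A(2)) simp
    qed
    finally have "{\<xi> \<in> space borel. card (R i \<xi>) = t} \<in> sets borel" .
    then have "Q i \<inter> {\<xi> \<in> space borel. card (R i \<xi>) = t} \<in> sets borel" by (intro sets.Int) auto
    also have "Q i \<inter> {\<xi> \<in> space borel. card (R i \<xi>) = t} = S t i" by (auto simp: S_def)
    finally show ?thesis .
  qed
  then have [measurable]: "P t \<in> sets borel" for t unfolding P_def by measurable
  have P_E: "P t \<subseteq> E" for t using Q_E by (auto simp: P_def S_def)
  have less: "card (R i \<xi>) < card (R j \<eta>)"
    if "\<xi> \<in> Q i" "\<eta> \<in> Q j" "\<xi> - \<eta> \<in> annihilator \<Gamma>" "i < j" for \<xi> \<eta> i j
  proof (rule psubset_card_mono[OF R_fin], rule psubsetI)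
    show "R i \<xi> \<subseteq> R j \<eta>"
    proof
      fix m assume m: "m \<in> R i \<xi>"
      then obtain z where z: "z \<in> annihilator \<Gamma>" "z + \<xi> \<in> Q m" by (auto simp: R_def \<Lambda>_def)
      let ?l = "z + \<xi> - \<eta>"
      have "\<eta> - \<xi> \<in> annihilator \<Gamma>" using ann_diff[OF ann_diff[OF that(3) that(3)] that(3)] by simp
      from ann_diff[OF z(1) this] have "?l \<in> annihilator \<Gamma>" by (simp add: diff_diff_eq2)
      moreover have "?l \<in> D" by (rule D[OF Q_E[OF z(2)] Q_E[OF that(2)]])
      moreover have "?l + \<eta> \<in> Q m" using z(2) by simp
      ultimately have "\<exists>z\<in>\<Lambda>. z + \<eta> \<in> Q m" by (intro bexI[of _ ?l]) (simp_all add: \<Lambda>_def)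
      moreover have "m < j" using m that(4) by (simp add: R_def)
      ultimately show "m \<in> R j \<eta>" by (simp add: R_def)
    qed
    have "\<xi> - \<eta> \<in> \<Lambda>" using that(3) D[OF Q_E[OF that(1)] Q_E[OF that(2)]] by (simp add: \<Lambda>_def)
    then have "i \<in> R j \<eta>" using that(1,4) by (auto simp: R_def intro!: bexI[of _ "\<xi> - \<eta>"])
    moreover have "i \<notin> R i \<xi>" by (simp add: R_def)
    ultimately show "R i \<xi> \<noteq> R j \<eta>" by blast
  qed
  have P_inj: "\<xi> = \<eta>" if P: "\<xi> \<in> P t" "\<eta> \<in> P t" and a: "\<xi> - \<eta> \<in> annihilator \<Gamma>" for \<xi> \<eta> t
  proof -
    obtain i j where ij: "\<xi> \<in> Q i" "\<eta> \<in> Q j" "card (R i \<xi>) = t" "card (R j \<eta>) = t"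
      using P by (auto simp: P_def S_def)
    have "\<eta> - \<xi> \<in> annihilator \<Gamma>" using ann_diff[OF ann_diff[OF a a] a] by simp
    then have "i = j"
      using less[OF ij(1,2) a] less[OF ij(2,1)] ij(3,4) by (cases i j rule: linorder_cases) auto
    then show ?thesis using Q_small ij(1,2) a by blast
  qed
  have P_cover: "\<exists>t<n. \<xi> \<in> P t" if \<xi>: "\<xi> \<in> E" for \<xi>
  proof -
    obtain i where i: "i < k" "\<xi> \<in> Q i" using Q_cover[OF \<xi>] by blast
    \<comment> \<open>Each earlier piece uses its own nonzero shift in \<open>\<Lambda>\<close>, and
      0 is left over. The inequality is therefore strict, and ranks \<open>0, ..., n - 1\<close>
      suffice.\<close>
    have "card (R i \<xi>) < card \<Lambda>"
    proof -
      have "\<forall>j\<in>R i \<xi>. \<exists>z. z \<in> \<Lambda> \<and> z + \<xi> \<in> Q j" by (auto simp: R_def)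
      then obtain l where l: "\<And>j. j \<in> R i \<xi> \<Longrightarrow> l j \<in> \<Lambda>" "\<And>j. j \<in> R i \<xi> \<Longrightarrow> l j + \<xi> \<in> Q j"
        by (metis (no_types))
      have inj: "inj_on l (R i \<xi>)"
      proof (rule inj_onI)
        fix j j' assume "j \<in> R i \<xi>" "j' \<in> R i \<xi>" "l j = l j'"
        then show "j = j'" using l(2)[of j] l(2)[of j'] Q_disj[of "l j + \<xi>" j j'] by simp
      qed
      have 0: "0 \<in> \<Lambda>"
        using D[OF \<xi> \<xi>] by (simp add: \<Lambda>_def annihilator_def)
      have "l j \<noteq> 0" if "j \<in> R i \<xi>" for j
      proof
        assume "l j = 0"
        then have "\<xi> \<in> Q j" using l(2)[OF that] by simp
        then have "i = j" by (rule Q_disj[OF i(2)])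
        then show False using that by (simp add: R_def)
      qed
      then have "0 \<notin> l ` R i \<xi>" by fastforce
      moreover have "l ` R i \<xi> \<subseteq> \<Lambda>" using l(1) by (rule image_subsetI)
      ultimately have "l ` R i \<xi> \<subset> \<Lambda>" using 0 by blast
      then have "card (l ` R i \<xi>) < card \<Lambda>" using fin by (intro psubset_card_mono) (simp_all add: \<Lambda>_def)
      then show ?thesis by (simp add: card_image[OF inj])
    qed
    then have "card (R i \<xi>) < n" using card by (simp add: \<Lambda>_def)
    moreover have "\<xi> \<in> P (card (R i \<xi>))" using i by (auto simp: P_def S_def)
    ultimately show ?thesis by blast
  qed
  have P_disj: "t = u" if P: "\<xi> \<in> P t" "\<xi> \<in> P u" for \<xi> t u
  proof -
    obtain i j where "\<xi> \<in> Q i" "\<xi> \<in> Q j" "card (R i \<xi>) = t" "card (R j \<xi>) = u"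
      using P by (auto simp: P_def S_def)
    then show ?thesis using Q_disj by blast
  qed
  define G where "G t \<xi> = indicator (P t) \<xi> * F \<xi>" for t \<xi>
  have F_meas [measurable]: "F \<in> borel_measurable borel" using supported_L2D(3)[OF F] .
  have ind: "cmod (indicator A \<xi>) \<le> 1" for A :: "'g dual_group set" and \<xi> by (cases "\<xi> \<in> A") auto
  have G_E: "G t \<in> supported_L2 E" for t
    unfolding G_def[abs_def] by (rule supported_L2_mult(1)[OF F _ ind]) measurable
  then have G_P: "G t \<in> supported_L2 (P t)" for t by (auto simp: supported_L2_def G_def)
  have G_eq: "G u \<xi> = (if u = t then F \<xi> else 0)" if "\<xi> \<in> P t" for u t \<xi>
  proof (cases "u = t")
    case False
    then have "\<xi> \<notin> P u" using P_disj[OF _ that] by blast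
    with False show ?thesis by (simp add: G_def)
  qed (simp add: G_def that)
  have F_sum: "F \<xi> = (\<Sum>t<n. G t \<xi>)" for \<xi>
  proof (cases "\<xi> \<in> E")
    case True
    then obtain t where t: "t < n" "\<xi> \<in> P t" using P_cover by blast
    have "(\<Sum>u<n. G u \<xi>) = (\<Sum>u<n. if u = t then F \<xi> else 0)"
      by (simp only: G_eq[OF t(2)])
    also have "\<dots> = F \<xi>" using t(1) by simp
    finally show ?thesis ..
  next
    case False
    then show ?thesis using supported_L2D(2)[OF F] by (simp add: G_def)
  qed
  have sq_sum: "(\<Sum>t<n. sq_norm \<nu> (G t)) = sq_norm \<nu> F"
  proof -
    have "(\<Sum>t<n. ennreal ((cmod (G t \<xi>))\<^sup>2)) = ennreal ((cmod (F \<xi>))\<^sup>2)" for \<xi>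
    proof (cases "\<xi> \<in> E")
      case True
      then obtain t where t: "t < n" "\<xi> \<in> P t" using P_cover by blast
      have "(\<Sum>u<n. ennreal ((cmod (G u \<xi>))\<^sup>2)) = (\<Sum>u<n. if u = t then ennreal ((cmod (F \<xi>))\<^sup>2) else 0)"
        by (intro sum.cong) (simp_all add: G_eq[OF t(2)])
      also have "\<dots> = ennreal ((cmod (F \<xi>))\<^sup>2)" using t(1) by simp
      finally show ?thesis .
    next
      case False
      then show ?thesis using supported_L2D(2)[OF F] by (simp add: G_def)
    qed
    moreover have "(\<lambda>\<xi>. ennreal ((cmod (G t \<xi>))\<^sup>2)) \<in> borel_measurable \<nu>" for t
      using supported_L2D(3)[OF G_E] by measurable
    ultimately show ?thesis
      unfolding sq_norm_def by (subst nn_integral_sum[symmetric]) auto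
  qed
  have inv_sum: "inv_fourier F x = (\<Sum>t<n. inv_fourier (G t) x)" for x
  proof -
    have "inv_fourier F x = (LINT \<xi>|\<nu>. (\<Sum>t<n. G t \<xi> * pairing \<xi> x))"
      unfolding inv_fourier_def F_sum by (simp add: sum_distrib_right)
    also have "\<dots> = (\<Sum>t<n. inv_fourier (G t) x)"
      unfolding inv_fourier_def
      by (intro Bochner_Integration.integral_sum integrable_mult_pairing supported_L2_integrable[OF G_E E])
    finally show ?thesis .
  qed
  \<comment> \<open>Cauchy-Schwarz over the \<open>n\<close> ranks. The samples of different
    \<open>G t\<close> need not be orthogonal; this is where the factor \<open>n\<close> comes
    from.\<close>
  have bound: "(cmod (inv_fourier F x))\<^sup>2 \<le> real n * (\<Sum>t<n. (cmod (inv_fourier (G t) x))\<^sup>2)" for x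
  proof -
    have "cmod (inv_fourier F x) \<le> (\<Sum>t<n. cmod (inv_fourier (G t) x))"
      unfolding inv_sum by (rule norm_sum)
    then have "(cmod (inv_fourier F x))\<^sup>2 \<le> (\<Sum>t<n. cmod (inv_fourier (G t) x) * 1)\<^sup>2"
      by (intro power_mono) auto
    also have "\<dots> \<le> (\<Sum>t<n. (cmod (inv_fourier (G t) x))\<^sup>2) * (\<Sum>t<n. 1\<^sup>2)"
      by (rule Cauchy_Schwarz_ineq_sum)
    finally show ?thesis by (simp add: mult.commute)
  qed
  have "ennreal ((cmod (inv_fourier F x))\<^sup>2) \<le> of_nat n * (\<Sum>t<n. ennreal ((cmod (inv_fourier (G t) x))\<^sup>2))" for x
  proof -
    have "ennreal ((cmod (inv_fourier F x))\<^sup>2) \<le> ennreal (real n * (\<Sum>t<n. (cmod (inv_fourier (G t) x))\<^sup>2))"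
      by (intro ennreal_leI bound)
    also have "\<dots> = ennreal (real n) * ennreal (\<Sum>t<n. (cmod (inv_fourier (G t) x))\<^sup>2)"
      by (intro ennreal_mult sum_nonneg) auto
    also have "\<dots> = of_nat n * (\<Sum>t<n. ennreal ((cmod (inv_fourier (G t) x))\<^sup>2))"
      by (subst sum_ennreal) (auto simp: ennreal_of_nat_eq_real_of_nat)
    finally show ?thesis .
  qed
  then have "sq_norm \<mu>\<Gamma> (inv_fourier F) \<le> (\<integral>\<^sup>+x. of_nat n * (\<Sum>t<n. ennreal ((cmod (inv_fourier (G t) x))\<^sup>2)) \<partial>\<mu>\<Gamma>)"
    unfolding sq_norm_def by (intro nn_integral_mono) simp
  also have "\<dots> = of_nat n * (\<Sum>t<n. sq_norm \<mu>\<Gamma> (inv_fourier (G t)))"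
  proof -
    have m: "(\<lambda>x. ennreal ((cmod (inv_fourier (G t) x))\<^sup>2)) \<in> borel_measurable \<mu>\<Gamma>" for t
    proof -
      have "(\<lambda>z. ennreal ((cmod z)\<^sup>2)) \<in> borel_measurable borel" by measurable
      from measurable_compose[OF measurable_inv_fourier_\<Gamma>[OF supported_L2D(3)[OF G_E]] this] show ?thesis .
    qed
    have "(\<lambda>x. \<Sum>t<n. ennreal ((cmod (inv_fourier (G t) x))\<^sup>2)) \<in> borel_measurable \<mu>\<Gamma>"
      by (intro borel_measurable_sum m)
    from nn_integral_cmult[OF this, of "of_nat n"]
    have "(\<integral>\<^sup>+x. of_nat n * (\<Sum>t<n. ennreal ((cmod (inv_fourier (G t) x))\<^sup>2)) \<partial>\<mu>\<Gamma>) =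
        of_nat n * (\<integral>\<^sup>+x. (\<Sum>t<n. ennreal ((cmod (inv_fourier (G t) x))\<^sup>2)) \<partial>\<mu>\<Gamma>)" .
    also have "(\<integral>\<^sup>+x. (\<Sum>t<n. ennreal ((cmod (inv_fourier (G t) x))\<^sup>2)) \<partial>\<mu>\<Gamma>) =
        (\<Sum>t<n. \<integral>\<^sup>+x. ennreal ((cmod (inv_fourier (G t) x))\<^sup>2) \<partial>\<mu>\<Gamma>)"
      by (rule nn_integral_sum) (rule m)
    finally show ?thesis by (simp only: sq_norm_def)
  qed
  also have "\<dots> \<le> of_nat n * (\<Sum>t<n. sq_norm \<nu> (G t))"
  proof (intro mult_left_mono sum_mono)
    show "sq_norm \<mu>\<Gamma> (inv_fourier (G t)) \<le> sq_norm \<nu> (G t)" for t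
    proof (rule sampling_contraction[OF E P_E _ _ G_P])
      show "P t \<in> sets borel" by measurable
      show "\<xi> = \<eta>" if "\<xi> \<in> P t" "\<eta> \<in> P t" "\<xi> - \<eta> \<in> annihilator \<Gamma>" for \<xi> \<eta>
        using that by (rule P_inj)
    qed
  qed simp
  also have "\<dots> = of_nat n * sq_norm \<nu> F" by (simp only: sq_sum)
  finally show ?thesis .
qed

end

section \<open>The Calderon sum\<close>

locale lca_lattice_automorphism = lca_lattice d \<nu> \<mu> \<Gamma> \<mu>\<Gamma> \<kappa> + lca_automorphism d \<nu> \<mu> a \<delta> l L
  for d :: "'g::{topological_ab_group_add, t2_space, second_countable_topology} dual_group \<Rightarrow> 'g dual_group \<Rightarrow> real"
    and \<nu> \<mu> \<Gamma> \<mu>\<Gamma> \<kappa> a \<delta> l L +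
  fixes \<psi> :: "'g \<Rightarrow> complex" and \<psi>h :: "'g dual_group \<Rightarrow> complex"
  assumes \<psi>: "is_fourier_L2 \<mu> \<nu> \<psi> \<psi>h"
begin

lemma \<psi>h_L2: "\<psi>h \<in> L2 \<nu>"
  using \<psi> by (simp add: is_fourier_L2_def)

lemma \<psi>h_measurable [measurable]: "\<psi>h \<in> borel_measurable borel"
  using \<psi>h_L2 by (auto simp: L2_def)

text \<open>The conjugate is there because the affine system stands in the second, conjugated
  argument of \<open>inner_L2\<close>.\<close>

definition sampled :: "'g dual_group set \<Rightarrow> 'g dual_group \<Rightarrow> complex" where
  "sampled U \<eta> = indicator (ah ` U) \<eta> * cnj (\<psi>h \<eta>)"

lemma ah_image_measurable [measurable]: "U \<in> sets borel \<Longrightarrow> ah ` U \<in> sets borel"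
  unfolding ah_image_eq using measurable_sets[OF measurable_ah(2), of U] by simp

lemma sampled_measurable [measurable]: "U \<in> sets borel \<Longrightarrow> sampled U \<in> borel_measurable borel"
proof -
  assume "U \<in> sets borel"
  then have [measurable]: "ah ` U \<in> sets borel" by (rule ah_image_measurable)
  show ?thesis unfolding sampled_def[abs_def] by measurable
qed

lemma indicator_ah: "indicator (ah ` U) (ah \<xi>) = indicator U \<xi>"
  using bij_is_inj[OF bij_dual_automorphism[OF aut]] by (simp add: indicator_def inj_image_mem_iff)

lemma sampled_supported:
  assumes [measurable]: "U \<in> sets borel" and "ah ` U \<subseteq> K"
  shows "sampled U \<in> supported_L2 K"
proof -
  have "sampled U \<in> L2 \<nu>"
    by (rule L2_bound[OF \<psi>h_L2, where c = 1]) (measurable, auto simp: sampled_def indicator_def)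
  then show ?thesis using assms(2) by (auto simp: supported_L2_def sampled_def indicator_def)
qed

lemma sq_norm_sampled:
  assumes [measurable]: "U \<in> sets borel"
  shows "ennreal (1 / \<delta>) * sq_norm \<nu> (sampled U) = (\<integral>\<^sup>+\<xi>\<in>U. ennreal ((cmod (\<psi>h (ah \<xi>)))\<^sup>2) \<partial>\<nu>)"
proof -
  have "ennreal (1 / \<delta>) * sq_norm \<nu> (sampled U) = (\<integral>\<^sup>+\<xi>. ennreal ((cmod (sampled U (ah \<xi>)))\<^sup>2) \<partial>\<nu>)"
    unfolding sq_norm_def by (rule nn_integral_ah[symmetric]) measurable
  also have "\<dots> = (\<integral>\<^sup>+\<xi>\<in>U. ennreal ((cmod (\<psi>h (ah \<xi>)))\<^sup>2) \<partial>\<nu>)"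
    unfolding sampled_def indicator_ah by (intro nn_integral_cong) (simp add: indicator_def)
  finally show ?thesis .
qed

text \<open>Parseval moves the inner product to the dual group, and the substitution
  \<open>\<eta> = ah \<xi>\<close> costs \<open>1 / \<delta>\<close>. Afterwards
  \<open>\<gamma>\<close> occurs only in a pairing, so the coefficient is a sample at
  \<open>\<gamma>\<close>.\<close>

lemma inner_L2_affine:
  assumes U [measurable]: "U \<in> sets borel" and f: "is_fourier_L2 \<mu> \<nu> f (indicator U)"
  shows "inner_L2 \<mu> f (\<lambda>x. complex_of_real (\<delta> powr (- 1/2)) * \<psi> (a x - \<gamma>)) =
    complex_of_real (\<delta> powr (1/2) * (1 / \<delta>)) * inv_fourier (sampled U) \<gamma>"
proof -
  have "inner_L2 \<mu> f (\<lambda>x. complex_of_real (\<delta> powr (- 1/2)) * \<psi> (a x - \<gamma>)) =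
      inner_L2 \<nu> (indicator U) (\<lambda>\<xi>. complex_of_real (\<delta> powr (1/2)) * (\<psi>h (ah \<xi>) * cnj (pairing (ah \<xi>) \<gamma>)))"
    by (rule parseval[OF f is_fourier_L2_affine[OF \<psi>]])
  also have "\<dots> = complex_of_real (\<delta> powr (1/2)) * (LINT \<xi>|\<nu>. sampled U (ah \<xi>) * pairing (ah \<xi>) \<gamma>)"
    unfolding inner_L2_def sampled_def indicator_ah
    by (subst integral_mult_right_zero[symmetric]) (simp add: mult_ac)
  also have "(LINT \<xi>|\<nu>. sampled U (ah \<xi>) * pairing (ah \<xi>) \<gamma>) = complex_of_real (1 / \<delta>) * inv_fourier (sampled U) \<gamma>"
    unfolding inv_fourier_def by (rule integral_ah[of "\<lambda>\<eta>. sampled U \<eta> * pairing \<eta> \<gamma>"]) measurable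
  finally show ?thesis by (simp only: of_real_mult mult.assoc)
qed

text \<open>The squared factor is \<open>\<delta> * (1 / \<delta>)\<^sup>2 = 1 / \<delta>\<close>.
  The same factor stands in \<open>sq_norm_sampled\<close>, so no power of \<open>\<delta>\<close>
  survives when sampling is isometric.\<close>

lemma energy_eq:
  assumes U: "U \<in> sets borel" and f: "is_fourier_L2 \<mu> \<nu> f (indicator U)"
  shows "(\<integral>\<^sup>+\<gamma>. ennreal ((cmod (inner_L2 \<mu> f (\<lambda>x. complex_of_real (\<delta> powr (- 1/2)) * \<psi> (a x - \<gamma>))))\<^sup>2) \<partial>\<mu>\<Gamma>) =
    ennreal (1 / \<delta>) * sq_norm \<mu>\<Gamma> (inv_fourier (sampled U))"
proof -
  define c where "c = \<delta> powr (1/2) * (1 / \<delta>)"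
  have c: "c\<^sup>2 = 1 / \<delta>"
    using \<delta>_pos by (simp add: c_def powr_half_sqrt power2_eq_square field_simps)
  have "ennreal ((cmod (inner_L2 \<mu> f (\<lambda>x. complex_of_real (\<delta> powr (- 1/2)) * \<psi> (a x - \<gamma>))))\<^sup>2) =
      ennreal (1 / \<delta>) * ennreal ((cmod (inv_fourier (sampled U) \<gamma>))\<^sup>2)" for \<gamma>
    unfolding inner_L2_affine[OF assms] c_def[symmetric] norm_mult norm_of_real power_mult_distrib power2_abs c
    using \<delta>_pos by (intro ennreal_mult) auto
  then have "(\<integral>\<^sup>+\<gamma>. ennreal ((cmod (inner_L2 \<mu> f (\<lambda>x. complex_of_real (\<delta> powr (- 1/2)) * \<psi> (a x - \<gamma>))))\<^sup>2) \<partial>\<mu>\<Gamma>) =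
      (\<integral>\<^sup>+\<gamma>. ennreal (1 / \<delta>) * ennreal ((cmod (inv_fourier (sampled U) \<gamma>))\<^sup>2) \<partial>\<mu>\<Gamma>)"
    by (simp only:)
  also have "\<dots> = ennreal (1 / \<delta>) * sq_norm \<mu>\<Gamma> (inv_fourier (sampled U))"
    unfolding sq_norm_def
  proof (rule nn_integral_cmult)
    have "(\<lambda>z. ennreal ((cmod z)\<^sup>2)) \<in> borel_measurable borel" by measurable
    from measurable_compose[OF measurable_inv_fourier_\<Gamma>[OF sampled_measurable[OF U]] this]
    show "(\<lambda>\<gamma>. ennreal ((cmod (inv_fourier (sampled U) \<gamma>))\<^sup>2)) \<in> borel_measurable \<mu>\<Gamma>" .
  qed
  finally show ?thesis .
qed

text \<open>Two points of the ball are less than \<open>r\<close> apart, and \<open>ah\<close> is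
  additive. The closed ball is taken because the sampling lemmas require a compact support.\<close>

lemma ah_mcball:
  assumes "2 * \<epsilon> < r"
  shows "compact (ah ` mcball \<xi> \<epsilon>)"
    and "x \<in> ah ` mcball \<xi> \<epsilon> \<Longrightarrow> y \<in> ah ` mcball \<xi> \<epsilon> \<Longrightarrow> x - y \<in> ah ` mball 0 r"
proof -
  show "compact (ah ` mcball \<xi> \<epsilon>)"
    by (intro compact_continuous_image continuous_on_subset[OF continuous_ah] compact_mcball) auto
  assume "x \<in> ah ` mcball \<xi> \<epsilon>" "y \<in> ah ` mcball \<xi> \<epsilon>"
  then obtain u v where uv: "d \<xi> u \<le> \<epsilon>" "d \<xi> v \<le> \<epsilon>" "x = ah u" "y = ah v" by auto
  have "d 0 (u - v) = d u v" by (simp add: commute[of 0] dist_diff_0)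
  also have "\<dots> \<le> d u \<xi> + d \<xi> v" by (rule triangle_UNIV)
  also have "\<dots> < r" using uv(1,2) assms by (simp add: commute)
  finally show "x - y \<in> ah ` mball 0 r"
    using uv(3,4) by (intro image_eqI[of _ _ "u - v"]) (simp_all add: dual_automorphism_diff[OF aut])
qed

lemma energy_isometry:
  assumes \<epsilon>: "2 * \<epsilon> < r" and f: "is_fourier_L2 \<mu> \<nu> f (indicator (mball \<xi> \<epsilon>))"
    and disjoint: "annihilator \<Gamma> \<inter> ah ` mball 0 r \<subseteq> {0}"
  shows "(\<integral>\<^sup>+\<gamma>. ennreal ((cmod (inner_L2 \<mu> f (\<lambda>x. complex_of_real (\<delta> powr (- 1/2)) * \<psi> (a x - \<gamma>))))\<^sup>2) \<partial>\<mu>\<Gamma>) =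
    (\<integral>\<^sup>+\<xi>\<in>mball \<xi> \<epsilon>. ennreal ((cmod (\<psi>h (ah \<xi>)))\<^sup>2) \<partial>\<nu>)"
proof -
  have U: "mball \<xi> \<epsilon> \<in> sets borel" by simp
  have supp: "sampled (mball \<xi> \<epsilon>) \<in> supported_L2 (ah ` mcball \<xi> \<epsilon>)"
    by (intro sampled_supported U image_mono mball_subset_mcball)
  have "sq_norm \<mu>\<Gamma> (inv_fourier (sampled (mball \<xi> \<epsilon>))) = sq_norm \<nu> (sampled (mball \<xi> \<epsilon>))"
  proof (rule sampling_isometry[OF ah_mcball(1)[OF \<epsilon>] _ supp])
    fix x y assume "x \<in> ah ` mcball \<xi> \<epsilon>" "y \<in> ah ` mcball \<xi> \<epsilon>" "x - y \<in> annihilator \<Gamma>"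
    with ah_mcball(2)[OF \<epsilon>] disjoint have "x - y = 0" by blast
    then show "x = y" by simp
  qed
  then show ?thesis by (simp only: energy_eq[OF U f] sq_norm_sampled[OF U])
qed

lemma energy_le:
  assumes \<epsilon>: "2 * \<epsilon> < r" and f: "is_fourier_L2 \<mu> \<nu> f (indicator (mball \<xi> \<epsilon>))"
    and fin: "finite (annihilator \<Gamma> \<inter> ah ` mball 0 r)" and c: "real (card (annihilator \<Gamma> \<inter> ah ` mball 0 r)) \<le> c"
    and r: "0 < r"
  shows "(\<integral>\<^sup>+\<gamma>. ennreal ((cmod (inner_L2 \<mu> f (\<lambda>x. complex_of_real (\<delta> powr (- 1/2)) * \<psi> (a x - \<gamma>))))\<^sup>2) \<partial>\<mu>\<Gamma>) \<le>
    ennreal c * (\<integral>\<^sup>+\<xi>\<in>mball \<xi> \<epsilon>. ennreal ((cmod (\<psi>h (ah \<xi>)))\<^sup>2) \<partial>\<nu>)"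
proof -
  have U: "mball \<xi> \<epsilon> \<in> sets borel" by simp
  have supp: "sampled (mball \<xi> \<epsilon>) \<in> supported_L2 (ah ` mcball \<xi> \<epsilon>)"
    by (intro sampled_supported U image_mono mball_subset_mcball)
  let ?n = "card (annihilator \<Gamma> \<inter> ah ` mball 0 r)"
  have "0 \<in> annihilator \<Gamma> \<inter> ah ` mball 0 r"
    using r dual_automorphism_0[OF aut] by (auto simp: annihilator_def intro!: image_eqI[of _ _ 0])
  then have n: "0 < ?n" using fin by (auto simp: card_gt_0_iff)
  have "sq_norm \<mu>\<Gamma> (inv_fourier (sampled (mball \<xi> \<epsilon>))) \<le> of_nat ?n * sq_norm \<nu> (sampled (mball \<xi> \<epsilon>))"
    by (rule sampling_le_card[OF ah_mcball(1)[OF \<epsilon>] n fin order_refl ah_mcball(2)[OF \<epsilon>] supp])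
  also have "\<dots> \<le> ennreal c * sq_norm \<nu> (sampled (mball \<xi> \<epsilon>))"
    using c by (intro mult_right_mono) (auto simp: ennreal_of_nat_eq_real_of_nat intro: ennreal_leI)
  finally have "ennreal (1 / \<delta>) * sq_norm \<mu>\<Gamma> (inv_fourier (sampled (mball \<xi> \<epsilon>))) \<le>
      ennreal (1 / \<delta>) * (ennreal c * sq_norm \<nu> (sampled (mball \<xi> \<epsilon>)))"
    by (rule mult_left_mono) simp
  also have "\<dots> = ennreal c * (ennreal (1 / \<delta>) * sq_norm \<nu> (sampled (mball \<xi> \<epsilon>)))" by (rule mult.left_commute)
  finally show ?thesis by (simp only: energy_eq[OF U f] sq_norm_sampled[OF U])
qed

end

section \<open>The frame inequality on small balls and its differentiation\<close>

locale affine_setting = lca_lattice d \<nu> \<mu> \<Gamma> \<mu>\<Gamma> \<kappa>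
  for d :: "'g::{topological_ab_group_add, t2_space, second_countable_topology} dual_group \<Rightarrow> 'g dual_group \<Rightarrow> real"
    and \<nu> \<mu> \<Gamma> \<mu>\<Gamma> \<kappa> +
  fixes \<sigma> :: "'h measure" and \<alpha> :: "'h \<Rightarrow> 'g \<Rightarrow> 'g" and \<delta> l L :: "'h \<Rightarrow> real"
    and S :: "('g \<Rightarrow> complex) set" and \<psi> :: "'g \<Rightarrow> complex" and \<psi>h :: "'g dual_group \<Rightarrow> complex"
    and A B M \<epsilon>\<^sub>0 :: real
  assumes doubling: "weakly_doubling \<nu> d"
    and sigma_finite_\<sigma>: "sigma_finite_measure \<sigma>"
    and aut: "\<And>h. topological_automorphism (\<alpha> h)"
    and \<alpha>: "(\<lambda>(x, h). \<alpha> h x) \<in> \<mu> \<Otimes>\<^sub>M \<sigma> \<rightarrow>\<^sub>M borel"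
    and modulus: "modulus_function \<mu> \<sigma> \<alpha> \<delta>"
    and \<psi>: "is_fourier_L2 \<mu> \<nu> \<psi> \<psi>h"
    and A_pos: "0 < A" and A_le_B: "A \<le> B"
    and frame: "affine_frame \<mu> \<Gamma> \<mu>\<Gamma> \<sigma> \<alpha> \<delta> S \<psi> A B"
    and lipschitz: "measurably_bi_lipschitz d \<sigma> \<alpha> l L"
    and X: "property_X d \<alpha> \<delta> L (annihilator \<Gamma>)"
    and M_pos: "0 < M" and \<epsilon>\<^sub>0_pos: "0 < \<epsilon>\<^sub>0"
begin

sublocale \<sigma>: sigma_finite_measure \<sigma> by (rule sigma_finite_\<sigma>)

sublocale \<sigma>\<nu>: pair_sigma_finite \<sigma> \<nu> ..

abbreviation "good \<equiv> good_set \<mu> \<nu> d S \<epsilon>\<^sub>0"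

abbreviation "hat h \<equiv> dual_automorphism (\<alpha> h)"

lemma lattice_automorphism: "lca_lattice_automorphism d \<nu> \<mu> \<Gamma> \<mu>\<Gamma> \<kappa> (\<alpha> h) (\<delta> h) (l h) (L h) \<psi> \<psi>h"
  using aut modulus lipschitz \<psi>
  by unfold_locales (auto simp: modulus_function_def measurably_bi_lipschitz_def)

lemma \<delta>_pos: "0 < \<delta> h" and L_pos: "0 < L h"
  using modulus lipschitz by (auto simp: modulus_function_def measurably_bi_lipschitz_def)

lemma measurable_parameters [measurable]: "\<delta> \<in> borel_measurable \<sigma>" "L \<in> borel_measurable \<sigma>"
  using modulus lipschitz by (auto simp: modulus_function_def measurably_bi_lipschitz_def)

definition w :: "'h \<Rightarrow> 'g dual_group \<Rightarrow> ennreal" where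
  "w h \<xi> = ennreal ((cmod (\<psi>h (hat h \<xi>)))\<^sup>2)"

lemma w_measurable [measurable]: "(\<lambda>z. w (fst z) (snd z)) \<in> borel_measurable (\<sigma> \<Otimes>\<^sub>M \<nu>)"
proof -
  have [measurable]: "\<psi>h \<in> borel_measurable borel" using \<psi> by (auto simp: is_fourier_L2_def L2_def)
  have "(\<lambda>z. hat (fst z) (snd z)) \<in> \<sigma> \<Otimes>\<^sub>M \<nu> \<rightarrow>\<^sub>M borel"
    using measurable_dual_automorphism_prod[OF aut \<alpha> modulus] by (simp add: split_beta')
  from measurable_compose[OF this, of "\<lambda>\<eta>. ennreal ((cmod (\<psi>h \<eta>))\<^sup>2)" borel]
  show ?thesis by (simp add: w_def)
qed

lemma w_measurable1 [measurable]: "(\<lambda>h. w h \<xi>) \<in> borel_measurable \<sigma>"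
  using measurable_compose[OF measurable_Pair2'[of \<xi> \<nu> \<sigma>] w_measurable] by simp

lemma w_measurable2 [measurable]: "w h \<in> borel_measurable borel"
proof -
  interpret lca_lattice_automorphism d \<nu> \<mu> \<Gamma> \<mu>\<Gamma> \<kappa> "\<alpha> h" "\<delta> h" "l h" "L h" \<psi> \<psi>h
    by (rule lattice_automorphism)
  show ?thesis unfolding w_def[abs_def] by measurable
qed

lemma calderon_eq: "calderon_sum \<sigma> \<alpha> \<psi>h \<xi> = (\<integral>\<^sup>+h. w h \<xi> \<partial>\<sigma>)"
  by (simp add: calderon_sum_def w_def)

lemma Psi_eq: "Psi \<sigma> \<alpha> \<delta> L m \<psi>h \<xi> = (\<integral>\<^sup>+h. indicator {h. m < L h} h * (ennreal (\<delta> h) * w h \<xi>) \<partial>\<sigma>)"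
proof -
  have "ennreal ((cmod (dual_dilation \<alpha> \<delta> h \<psi>h \<xi>))\<^sup>2) = ennreal (\<delta> h) * w h \<xi>" for h
    using norm_dual_dilation[of \<delta> h \<alpha> \<psi>h \<xi>, OF \<delta>_pos] less_imp_le[OF \<delta>_pos[of h]]
    by (simp add: w_def ennreal_mult)
  then show ?thesis unfolding Psi_def by (intro nn_integral_cong) (simp add: mult.commute)
qed

lemma weighted_measurable:
  assumes [measurable]: "u \<in> borel_measurable \<sigma>"
  shows "(\<lambda>\<xi>. \<integral>\<^sup>+h. u h * w h \<xi> \<partial>\<sigma>) \<in> borel_measurable borel"
proof -
  have "(\<lambda>z. u (snd z) * w (snd z) (fst z)) \<in> borel_measurable (\<nu> \<Otimes>\<^sub>M \<sigma>)"
  proof -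
    have "(\<lambda>z. (snd z, fst z)) \<in> \<nu> \<Otimes>\<^sub>M \<sigma> \<rightarrow>\<^sub>M \<sigma> \<Otimes>\<^sub>M \<nu>" by measurable
    from measurable_compose[OF this w_measurable] have "(\<lambda>z. w (snd z) (fst z)) \<in> borel_measurable (\<nu> \<Otimes>\<^sub>M \<sigma>)"
      by simp
    moreover have "(\<lambda>z. u (snd z)) \<in> borel_measurable (\<nu> \<Otimes>\<^sub>M \<sigma>)" by measurable
    ultimately show ?thesis by (intro borel_measurable_times_ennreal)
  qed
  from \<sigma>.borel_measurable_nn_integral_fst[OF this] show ?thesis
    by (simp add: measurable_cong_sets[OF sets_haar refl])
qed

text \<open>The weight \<open>u\<close> later selects the part of the parameter space that is kept
  and carries the bound for the multiplicity.\<close>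

lemma weighted_fubini:
  assumes [measurable]: "u \<in> borel_measurable \<sigma>" and U [measurable]: "U \<in> sets borel"
  shows "(\<integral>\<^sup>+\<xi>\<in>U. (\<integral>\<^sup>+h. u h * w h \<xi> \<partial>\<sigma>) \<partial>\<nu>) = (\<integral>\<^sup>+h. u h * (\<integral>\<^sup>+\<xi>\<in>U. w h \<xi> \<partial>\<nu>) \<partial>\<sigma>)"
proof -
  have U\<nu>: "U \<in> sets \<nu>" using U by simp
  have "(\<lambda>z. u (fst z)) \<in> borel_measurable (\<sigma> \<Otimes>\<^sub>M \<nu>)" by measurable
  moreover have "(\<lambda>z. indicator U (snd z) :: ennreal) \<in> borel_measurable (\<sigma> \<Otimes>\<^sub>M \<nu>)"
    by (rule measurable_compose[OF measurable_snd borel_measurable_indicator[OF U\<nu>]])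
  ultimately have m: "(\<lambda>(h, \<xi>). u h * (w h \<xi> * indicator U \<xi>)) \<in> borel_measurable (\<sigma> \<Otimes>\<^sub>M \<nu>)"
    using w_measurable unfolding split_beta' by (intro borel_measurable_times_ennreal)
  have "(\<integral>\<^sup>+\<xi>\<in>U. (\<integral>\<^sup>+h. u h * w h \<xi> \<partial>\<sigma>) \<partial>\<nu>) = (\<integral>\<^sup>+\<xi>. \<integral>\<^sup>+h. u h * (w h \<xi> * indicator U \<xi>) \<partial>\<sigma> \<partial>\<nu>)"
    by (intro nn_integral_cong, subst nn_integral_multc[symmetric]) (auto simp: mult.assoc)
  also have "\<dots> = (\<integral>\<^sup>+h. \<integral>\<^sup>+\<xi>. u h * (w h \<xi> * indicator U \<xi>) \<partial>\<nu> \<partial>\<sigma>)"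
    using \<sigma>\<nu>.Fubini'[OF m] by simp
  also have "\<dots> = (\<integral>\<^sup>+h. u h * (\<integral>\<^sup>+\<xi>\<in>U. w h \<xi> \<partial>\<nu>) \<partial>\<sigma>)"
    by (intro nn_integral_cong nn_integral_cmult) measurable
  finally show ?thesis .
qed

text \<open>
  On \<open>H\<^sub>1\<close> the translates by \<open>\<Gamma>\<^sup>\<bottom>\<close> of the support do not overlap: for \<open>L h \<le> m\<close> because \<open>\<Gamma>\<^sup>\<bottom>\<close>
  is discrete, and for \<open>C \<delta> h < 1\<close> because Property X leaves only one point of \<open>\<Gamma>\<^sup>\<bottom>\<close>.
\<close>

lemma calderon_bounds_cutoff:
  fixes m C r :: real and N :: "'g dual_group set"
  assumes r: "0 < r" and C: "0 < C" and m: "0 < m" "M \<le> m"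
    and XC: "\<And>h. m < L h \<Longrightarrow> finite (annihilator \<Gamma> \<inter> hat h ` mball 0 r)"
      "\<And>h. m < L h \<Longrightarrow> real (card (annihilator \<Gamma> \<inter> hat h ` mball 0 r)) \<le> 1 + C * \<delta> h"
    and \<Psi>: "Psi \<sigma> \<alpha> \<delta> L M \<psi>h \<in> L1_loc \<nu> d (good - N)"
  shows "AE \<xi> in \<nu>. \<xi> \<in> good \<longrightarrow> (\<integral>\<^sup>+h. indicator {h. L h \<le> m} h * w h \<xi> \<partial>\<sigma>) \<le> ennreal B"
    and "AE \<xi> in \<nu>. \<xi> \<in> good - N \<longrightarrow>
      ennreal A \<le> calderon_sum \<sigma> \<alpha> \<psi>h \<xi> + ennreal (2 * C) * Psi \<sigma> \<alpha> \<delta> L m \<psi>h \<xi>"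
proof -
  obtain s where s: "s > 0" "\<And>\<xi>. \<xi> \<in> annihilator \<Gamma> \<Longrightarrow> d 0 \<xi> < s \<Longrightarrow> \<xi> = 0"
    using annihilator_discrete by blast
  \<comment> \<open>For \<open>L h \<le> m\<close> the image of the ball of radius
    \<open>s / m\<close> stays within distance \<open>s\<close> of 0 and meets the annihilator in 0
    alone; \<open>r\<close> is the radius of Property X.\<close>
  define r' where "r' = min r (s / m)"
  have r': "0 < r'" "r' \<le> r" "m * r' \<le> s" using r s(1) m by (auto simp: r'_def min_def field_simps)
  define H\<^sub>1 where "H\<^sub>1 = {h. L h \<le> m \<or> C * \<delta> h < 1}"
  define u\<^sub>1 where "u\<^sub>1 h = (indicator H\<^sub>1 h :: ennreal)" for h
  \<comment> \<open>Outside \<open>H\<^sub>1\<close> the weight is the bound for the multiplicity.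
    It leaves no plain \<open>w\<close>, only a multiple of the integrand of
    \<open>Psi\<close>.\<close>
  define u\<^sub>2 where "u\<^sub>2 h = indicator (- H\<^sub>1) h * ennreal (2 * C * \<delta> h)" for h
  have u [measurable]: "u\<^sub>1 \<in> borel_measurable \<sigma>" "u\<^sub>2 \<in> borel_measurable \<sigma>"
    unfolding u\<^sub>1_def[abs_def] u\<^sub>2_def[abs_def] H\<^sub>1_def indicator_def by measurable
  define I where "I f h = (\<integral>\<^sup>+\<gamma>. ennreal ((cmod (inner_L2 \<mu> f (dilation \<alpha> \<delta> h (translation \<gamma> \<psi>))))\<^sup>2) \<partial>\<mu>\<Gamma>)" for f h
  have good: "\<exists>f\<in>S. is_fourier_L2 \<mu> \<nu> f (indicator (mball \<xi> \<epsilon>))" if "\<xi> \<in> good" "0 < \<epsilon>" "\<epsilon> < \<epsilon>\<^sub>0" for \<xi> \<epsilon>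
    using that by (auto simp: good_set_def fourier_image_def)
  have I_eq: "I f h = (\<integral>\<^sup>+\<gamma>. ennreal ((cmod (inner_L2 \<mu> f (\<lambda>x. complex_of_real (\<delta> h powr (- 1/2)) * \<psi> (\<alpha> h x - \<gamma>))))\<^sup>2) \<partial>\<mu>\<Gamma>)" for f h
    by (simp add: I_def dilation_def[abs_def] translation_def)
  have I1: "I f h = (\<integral>\<^sup>+\<xi>\<in>mball \<xi> \<epsilon>. w h \<xi> \<partial>\<nu>)"
    if f: "is_fourier_L2 \<mu> \<nu> f (indicator (mball \<xi> \<epsilon>))" and \<epsilon>: "2 * \<epsilon> < r'" and h: "h \<in> H\<^sub>1" for f h \<xi> \<epsilon>
  proof -
    interpret h: lca_lattice_automorphism d \<nu> \<mu> \<Gamma> \<mu>\<Gamma> \<kappa> "\<alpha> h" "\<delta> h" "l h" "L h" \<psi> \<psi>h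
      by (rule lattice_automorphism)
    have "annihilator \<Gamma> \<inter> hat h ` mball 0 r' \<subseteq> {0}"
    proof (cases "L h \<le> m")
      case True
      have "\<eta> = 0" if \<eta>: "\<eta> \<in> annihilator \<Gamma>" "\<eta> = hat h \<xi>" "d 0 \<xi> < r'" for \<xi> \<eta>
      proof (rule s(2)[OF \<eta>(1)])
        have "d \<eta> 0 \<le> L h * d \<xi> 0" unfolding \<eta>(2) by (rule h.lipschitz(2))
        also have "\<dots> \<le> m * d \<xi> 0" using True by (intro mult_right_mono) auto
        also have "\<dots> < m * r'" using \<eta>(3) m(1) by (simp add: commute)
        also note r'(3)
        finally show "d 0 \<eta> < s" by (simp add: commute)
      qed
      then show ?thesis by auto
    next
      case False
      let ?\<Lambda> = "annihilator \<Gamma> \<inter> hat h ` mball 0 r"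
      have "C * \<delta> h < 1" "m < L h" using h False by (auto simp: H\<^sub>1_def)
      then have "real (card ?\<Lambda>) < 2" using XC(2)[of h] by simp
      then have "card ?\<Lambda> \<le> Suc 0" by simp
      moreover have "0 \<in> ?\<Lambda>"
        using r dual_automorphism_0[OF aut] by (auto simp: annihilator_def intro!: image_eqI[of _ _ 0])
      ultimately have "?\<Lambda> \<subseteq> {0}"
        using card_le_Suc0_iff_eq[OF XC(1)[OF \<open>m < L h\<close>]] by blast
      moreover have "hat h ` mball 0 r' \<subseteq> hat h ` mball 0 r"
        using r'(2) by (intro image_mono mball_subset_concentric)
      ultimately show ?thesis by blast
    qed
    from h.energy_isometry[OF \<epsilon> f this] show ?thesis by (simp add: I_eq w_def)
  qed
  have I2: "I f h \<le> ennreal (2 * C * \<delta> h) * (\<integral>\<^sup>+\<xi>\<in>mball \<xi> \<epsilon>. w h \<xi> \<partial>\<nu>)"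
    if f: "is_fourier_L2 \<mu> \<nu> f (indicator (mball \<xi> \<epsilon>))" and \<epsilon>: "2 * \<epsilon> < r'" and h: "h \<notin> H\<^sub>1" for f h \<xi> \<epsilon>
  proof -
    interpret h: lca_lattice_automorphism d \<nu> \<mu> \<Gamma> \<mu>\<Gamma> \<kappa> "\<alpha> h" "\<delta> h" "l h" "L h" \<psi> \<psi>h
      by (rule lattice_automorphism)
    have h': "m < L h" "1 \<le> C * \<delta> h" using h by (auto simp: H\<^sub>1_def)
    have "2 * \<epsilon> < r" using \<epsilon> r'(2) by simp
    moreover have "real (card (annihilator \<Gamma> \<inter> hat h ` mball 0 r)) \<le> 2 * C * \<delta> h"
      using XC(2)[OF h'(1)] h'(2) by simp
    ultimately show ?thesis
      using h.energy_le[OF _ f XC(1)[OF h'(1)] _ r] by (simp add: I_eq w_def)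
  qed
  \<comment> \<open>The frame inequality for the function whose transform is the indicator of a
    ball; by Parseval its squared norm is the measure of that ball.\<close>
  have frame_ball: "ennreal A * emeasure \<nu> (mball \<xi> \<epsilon>) \<le> (\<integral>\<^sup>+h. I f h \<partial>\<sigma>)" "(\<integral>\<^sup>+h. I f h \<partial>\<sigma>) \<le> ennreal B * emeasure \<nu> (mball \<xi> \<epsilon>)"
    if f: "f \<in> S" "is_fourier_L2 \<mu> \<nu> f (indicator (mball \<xi> \<epsilon>))" for f \<xi> \<epsilon>
  proof -
    have "complex_of_real ((norm_L2 \<mu> f)\<^sup>2) = complex_of_real ((norm_L2 \<nu> (indicator (mball \<xi> \<epsilon>)))\<^sup>2)"
      using parseval[OF f(2) f(2)] by (simp only: inner_L2_self)
    then have "ennreal ((norm_L2 \<mu> f)\<^sup>2) = sq_norm \<nu> (indicator (mball \<xi> \<epsilon>))"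
      using f(2) by (simp only: of_real_eq_iff is_fourier_L2_def sq_norm_eq)
    then have norm: "ennreal ((norm_L2 \<mu> f)\<^sup>2) = emeasure \<nu> (mball \<xi> \<epsilon>)" by (simp add: sq_norm_indicator)
    have "ennreal (A * (norm_L2 \<mu> f)\<^sup>2) \<le> (\<integral>\<^sup>+h. I f h \<partial>\<sigma>)" "(\<integral>\<^sup>+h. I f h \<partial>\<sigma>) \<le> ennreal (B * (norm_L2 \<mu> f)\<^sup>2)"
      using frame f(1) unfolding affine_frame_def Let_def I_def by blast+
    then show "ennreal A * emeasure \<nu> (mball \<xi> \<epsilon>) \<le> (\<integral>\<^sup>+h. I f h \<partial>\<sigma>)" "(\<integral>\<^sup>+h. I f h \<partial>\<sigma>) \<le> ennreal B * emeasure \<nu> (mball \<xi> \<epsilon>)"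
      using A_pos A_le_B unfolding norm[symmetric] by (simp_all add: ennreal_mult)
  qed
  define \<epsilon>\<^sub>1 where "\<epsilon>\<^sub>1 = min \<epsilon>\<^sub>0 (r' / 2)"
  have \<epsilon>\<^sub>1: "0 < \<epsilon>\<^sub>1" using \<epsilon>\<^sub>0_pos r'(1) by (simp add: \<epsilon>\<^sub>1_def)
  define F\<^sub>1 where "F\<^sub>1 \<xi> = (\<integral>\<^sup>+h. u\<^sub>1 h * w h \<xi> \<partial>\<sigma>)" for \<xi>
  define F\<^sub>2 where "F\<^sub>2 \<xi> = (\<integral>\<^sup>+h. u\<^sub>2 h * w h \<xi> \<partial>\<sigma>)" for \<xi>
  have [measurable]: "F\<^sub>1 \<in> borel_measurable borel" "F\<^sub>2 \<in> borel_measurable borel"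
    unfolding F\<^sub>1_def[abs_def] F\<^sub>2_def[abs_def] by (intro weighted_measurable u)+
  \<comment> \<open>For \<open>h \<in> H\<^sub>1\<close> the energy is exactly an integral over the
    ball; the other energies are nonnegative and are dropped.\<close>
  have upper: "(\<integral>\<^sup>+\<eta>\<in>mball \<xi> \<epsilon>. F\<^sub>1 \<eta> \<partial>\<nu>) \<le> ennreal B * emeasure \<nu> (mball \<xi> \<epsilon>)"
    if \<xi>: "\<xi> \<in> good" and \<epsilon>: "0 < \<epsilon>" "\<epsilon> < \<epsilon>\<^sub>1" for \<xi> \<epsilon>
  proof -
    have \<epsilon>': "\<epsilon> < \<epsilon>\<^sub>0" "2 * \<epsilon> < r'" using \<epsilon> by (auto simp: \<epsilon>\<^sub>1_def)
    obtain f where f: "f \<in> S" "is_fourier_L2 \<mu> \<nu> f (indicator (mball \<xi> \<epsilon>))" using good[OF \<xi> \<epsilon>(1) \<epsilon>'(1)] by blast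
    have "(\<integral>\<^sup>+\<eta>\<in>mball \<xi> \<epsilon>. F\<^sub>1 \<eta> \<partial>\<nu>) = (\<integral>\<^sup>+h. u\<^sub>1 h * (\<integral>\<^sup>+\<eta>\<in>mball \<xi> \<epsilon>. w h \<eta> \<partial>\<nu>) \<partial>\<sigma>)"
      unfolding F\<^sub>1_def by (rule weighted_fubini[OF u(1)]) simp
    also have "\<dots> \<le> (\<integral>\<^sup>+h. I f h \<partial>\<sigma>)"
      using I1[OF f(2) \<epsilon>'(2)] by (intro nn_integral_mono) (simp add: u\<^sub>1_def indicator_def)
    also note frame_ball(2)[OF f]
    finally show ?thesis .
  qed
  have "AE \<xi> in \<nu>. \<xi> \<in> good \<longrightarrow> F\<^sub>1 \<xi> \<le> ennreal B"
  proof (rule AE_le_of_averages[OF doubling])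
    show "\<exists>e>0. \<forall>\<epsilon>. 0 < \<epsilon> \<and> \<epsilon> < e \<longrightarrow> (\<integral>\<^sup>+\<eta>\<in>mball \<xi> \<epsilon>. F\<^sub>1 \<eta> \<partial>\<nu>) \<le> ennreal B * emeasure \<nu> (mball \<xi> \<epsilon>)"
      if "\<xi> \<in> good" for \<xi>
      using \<epsilon>\<^sub>1 upper[OF that] by blast
  qed (use A_pos A_le_B in auto)
  then show "AE \<xi> in \<nu>. \<xi> \<in> good \<longrightarrow> (\<integral>\<^sup>+h. indicator {h. L h \<le> m} h * w h \<xi> \<partial>\<sigma>) \<le> ennreal B"
  proof eventually_elim
    case (elim \<xi>)
    have "(\<integral>\<^sup>+h. indicator {h. L h \<le> m} h * w h \<xi> \<partial>\<sigma>) \<le> F\<^sub>1 \<xi>"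
      unfolding F\<^sub>1_def u\<^sub>1_def by (intro nn_integral_mono mult_right_mono) (auto simp: H\<^sub>1_def indicator_def)
    with elim show ?case by auto
  qed
  have F2: "F\<^sub>2 \<xi> \<le> ennreal (2 * C) * Psi \<sigma> \<alpha> \<delta> L m \<psi>h \<xi>" for \<xi>
  proof -
    have "F\<^sub>2 \<xi> \<le> (\<integral>\<^sup>+h. ennreal (2 * C) * (indicator {h. m < L h} h * (ennreal (\<delta> h) * w h \<xi>)) \<partial>\<sigma>)"
      unfolding F\<^sub>2_def
    proof (rule nn_integral_mono)
      fix h
      have "ennreal (2 * C * \<delta> h) = ennreal (2 * C) * ennreal (\<delta> h)"
        using C less_imp_le[OF \<delta>_pos] by (intro ennreal_mult) auto
      then show "u\<^sub>2 h * w h \<xi> \<le> ennreal (2 * C) * (indicator {h. m < L h} h * (ennreal (\<delta> h) * w h \<xi>))"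
        by (simp add: u\<^sub>2_def H\<^sub>1_def indicator_def mult.assoc)
    qed
    also have "\<dots> = ennreal (2 * C) * Psi \<sigma> \<alpha> \<delta> L m \<psi>h \<xi>"
      unfolding Psi_eq indicator_def by (rule nn_integral_cmult) measurable
    finally show ?thesis .
  qed
  have Psi_mono: "Psi \<sigma> \<alpha> \<delta> L m \<psi>h \<xi> \<le> Psi \<sigma> \<alpha> \<delta> L M \<psi>h \<xi>" for \<xi>
    unfolding Psi_eq using m(2) by (intro nn_integral_mono mult_right_mono) (auto simp: indicator_def)
  have "AE \<xi> in \<nu>. \<xi> \<in> good - N \<longrightarrow> ennreal A \<le> F\<^sub>1 \<xi> + F\<^sub>2 \<xi>"
  proof (rule AE_ge_of_averages[OF doubling])
    fix \<xi> assume \<xi>: "\<xi> \<in> good - N"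
    show "\<exists>e>0. \<forall>\<epsilon>. 0 < \<epsilon> \<and> \<epsilon> < e \<longrightarrow> ennreal A * emeasure \<nu> (mball \<xi> \<epsilon>) \<le> (\<integral>\<^sup>+\<eta>\<in>mball \<xi> \<epsilon>. (F\<^sub>1 \<eta> + F\<^sub>2 \<eta>) \<partial>\<nu>)"
    proof (intro exI[of _ \<epsilon>\<^sub>1] conjI allI impI \<epsilon>\<^sub>1)
      fix \<epsilon> assume "0 < \<epsilon> \<and> \<epsilon> < \<epsilon>\<^sub>1"
      then have \<epsilon>: "0 < \<epsilon>" "\<epsilon> < \<epsilon>\<^sub>0" "2 * \<epsilon> < r'" by (auto simp: \<epsilon>\<^sub>1_def)
      obtain f where f: "f \<in> S" "is_fourier_L2 \<mu> \<nu> f (indicator (mball \<xi> \<epsilon>))" using good[OF _ \<epsilon>(1,2)] \<xi> by blast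
      note frame_ball(1)[OF f]
      also have "(\<integral>\<^sup>+h. I f h \<partial>\<sigma>) \<le> (\<integral>\<^sup>+h. (u\<^sub>1 h + u\<^sub>2 h) * (\<integral>\<^sup>+\<eta>\<in>mball \<xi> \<epsilon>. w h \<eta> \<partial>\<nu>) \<partial>\<sigma>)"
        using I1[OF f(2) \<epsilon>(3)] I2[OF f(2) \<epsilon>(3)]
        by (intro nn_integral_mono) (simp add: u\<^sub>1_def u\<^sub>2_def indicator_def)
      also have "\<dots> = (\<integral>\<^sup>+\<eta>\<in>mball \<xi> \<epsilon>. (\<integral>\<^sup>+h. (u\<^sub>1 h + u\<^sub>2 h) * w h \<eta> \<partial>\<sigma>) \<partial>\<nu>)"
        by (rule weighted_fubini[symmetric]) measurable
      also have "\<dots> = (\<integral>\<^sup>+\<eta>\<in>mball \<xi> \<epsilon>. (F\<^sub>1 \<eta> + F\<^sub>2 \<eta>) \<partial>\<nu>)"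
        unfolding F\<^sub>1_def F\<^sub>2_def by (intro nn_integral_cong, subst nn_integral_add[symmetric]) (auto simp: distrib_right)
      finally show "ennreal A * emeasure \<nu> (mball \<xi> \<epsilon>) \<le> (\<integral>\<^sup>+\<eta>\<in>mball \<xi> \<epsilon>. (F\<^sub>1 \<eta> + F\<^sub>2 \<eta>) \<partial>\<nu>)" .
    qed
    \<comment> \<open>Local integrability of \<open>F\<^sub>1 + F\<^sub>2\<close>: the first term is
      bounded on balls around good points by \<open>upper\<close>, the second by \<open>Psi\<close>
      at level \<open>M\<close>, which dominates \<open>Psi\<close> at level
      \<open>m\<close>.\<close>
    obtain e where e: "e > 0" "(\<integral>\<^sup>+\<eta>\<in>mball \<xi> e. Psi \<sigma> \<alpha> \<delta> L M \<psi>h \<eta> \<partial>\<nu>) < \<infinity>"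
      using \<Psi> \<xi> by (auto simp: L1_loc_def)
    have Psi_m [measurable]: "Psi \<sigma> \<alpha> \<delta> L M \<psi>h \<in> borel_measurable borel"
      using \<Psi> by (simp add: L1_loc_def measurable_cong_sets[OF sets_haar refl])
    define \<epsilon> where "\<epsilon> = min e (\<epsilon>\<^sub>1 / 2)"
    have \<epsilon>: "0 < \<epsilon>" "\<epsilon> < \<epsilon>\<^sub>1" "\<epsilon> \<le> e" using e(1) \<epsilon>\<^sub>1 by (auto simp: \<epsilon>_def)
    have "(\<integral>\<^sup>+\<eta>\<in>mball \<xi> \<epsilon>. (F\<^sub>1 \<eta> + F\<^sub>2 \<eta>) \<partial>\<nu>) = (\<integral>\<^sup>+\<eta>\<in>mball \<xi> \<epsilon>. F\<^sub>1 \<eta> \<partial>\<nu>) + (\<integral>\<^sup>+\<eta>\<in>mball \<xi> \<epsilon>. F\<^sub>2 \<eta> \<partial>\<nu>)"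
    proof -
      have [measurable]: "mball \<xi> \<epsilon> \<in> sets borel" by simp
      have "(\<lambda>\<eta>. F\<^sub>1 \<eta> * indicator (mball \<xi> \<epsilon>) \<eta>) \<in> borel_measurable \<nu>"
        "(\<lambda>\<eta>. F\<^sub>2 \<eta> * indicator (mball \<xi> \<epsilon>) \<eta>) \<in> borel_measurable \<nu>"
        by measurable
      from nn_integral_add[OF this] show ?thesis by (simp add: distrib_right)
    qed
    also have "\<dots> < \<infinity>"
    proof -
      have "(\<integral>\<^sup>+\<eta>\<in>mball \<xi> \<epsilon>. F\<^sub>1 \<eta> \<partial>\<nu>) \<le> ennreal B * emeasure \<nu> (mball \<xi> \<epsilon>)"
        using \<xi> by (intro upper \<epsilon>) auto
      also have "\<dots> < \<infinity>" using emeasure_mball_finite[of \<xi> \<epsilon>] by (simp add: ennreal_mult_less_top)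
      finally have 1: "(\<integral>\<^sup>+\<eta>\<in>mball \<xi> \<epsilon>. F\<^sub>1 \<eta> \<partial>\<nu>) < \<infinity>" .
      have "(\<integral>\<^sup>+\<eta>\<in>mball \<xi> \<epsilon>. F\<^sub>2 \<eta> \<partial>\<nu>) \<le> (\<integral>\<^sup>+\<eta>. ennreal (2 * C) * (Psi \<sigma> \<alpha> \<delta> L M \<psi>h \<eta> * indicator (mball \<xi> e) \<eta>) \<partial>\<nu>)"
      proof (rule nn_integral_mono)
        fix \<eta>
        have "F\<^sub>2 \<eta> \<le> ennreal (2 * C) * Psi \<sigma> \<alpha> \<delta> L M \<psi>h \<eta>"
          by (rule order_trans[OF F2 mult_left_mono[OF Psi_mono]]) simp
        moreover have "indicator (mball \<xi> \<epsilon>) \<eta> \<le> (indicator (mball \<xi> e) \<eta> :: ennreal)"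
          using mball_subset_concentric[OF \<epsilon>(3), of \<xi>] by (auto simp: indicator_def)
        ultimately show "F\<^sub>2 \<eta> * indicator (mball \<xi> \<epsilon>) \<eta> \<le> ennreal (2 * C) * (Psi \<sigma> \<alpha> \<delta> L M \<psi>h \<eta> * indicator (mball \<xi> e) \<eta>)"
          unfolding mult.assoc[symmetric] by (rule mult_mono) auto
      qed
      also have "\<dots> = ennreal (2 * C) * (\<integral>\<^sup>+\<eta>\<in>mball \<xi> e. Psi \<sigma> \<alpha> \<delta> L M \<psi>h \<eta> \<partial>\<nu>)"
      proof (rule nn_integral_cmult)
        have [measurable]: "mball \<xi> e \<in> sets borel" by simp
        show "(\<lambda>\<eta>. Psi \<sigma> \<alpha> \<delta> L M \<psi>h \<eta> * indicator (mball \<xi> e) \<eta>) \<in> borel_measurable \<nu>" by measurable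
      qed
      also have "\<dots> < \<infinity>" using e(2) by (simp add: ennreal_mult_less_top)
      finally show ?thesis using 1 by simp
    qed
    finally show "\<exists>e>0. (\<integral>\<^sup>+\<eta>\<in>mball \<xi> e. (F\<^sub>1 \<eta> + F\<^sub>2 \<eta>) \<partial>\<nu>) < \<infinity>" using \<epsilon>(1) by blast
  qed (use A_pos in auto)
  then show "AE \<xi> in \<nu>. \<xi> \<in> good - N \<longrightarrow>
      ennreal A \<le> calderon_sum \<sigma> \<alpha> \<psi>h \<xi> + ennreal (2 * C) * Psi \<sigma> \<alpha> \<delta> L m \<psi>h \<xi>"
  proof eventually_elim
    case (elim \<xi>)
    have "F\<^sub>1 \<xi> \<le> calderon_sum \<sigma> \<alpha> \<psi>h \<xi>"
      unfolding F\<^sub>1_def u\<^sub>1_def calderon_eq by (intro nn_integral_mono) (auto simp: indicator_def)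
    then have "F\<^sub>1 \<xi> + F\<^sub>2 \<xi> \<le> calderon_sum \<sigma> \<alpha> \<psi>h \<xi> + ennreal (2 * C) * Psi \<sigma> \<alpha> \<delta> L m \<psi>h \<xi>"
      using F2 by (rule add_mono)
    with elim show ?case by auto
  qed
qed

section \<open>Removing the cutoff\<close>

lemma AE_Psi_finite:
  assumes \<Psi>: "Psi \<sigma> \<alpha> \<delta> L M \<psi>h \<in> L1_loc \<nu> d T"
  shows "AE \<xi> in \<nu>. \<xi> \<in> T \<longrightarrow> Psi \<sigma> \<alpha> \<delta> L M \<psi>h \<xi> < \<infinity>"
proof -
  let ?P = "Psi \<sigma> \<alpha> \<delta> L M \<psi>h"
  let ?F = "{U. open U \<and> (\<integral>\<^sup>+\<xi>\<in>U. ?P \<xi> \<partial>\<nu>) < \<infinity>}"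
  have [measurable]: "?P \<in> borel_measurable borel"
    using \<Psi> by (simp add: L1_loc_def measurable_cong_sets[OF sets_haar refl])
  obtain \<V> where \<V>: "countable \<V>" "\<V> \<subseteq> ?F" "\<Union>\<V> = \<Union>?F"
  proof (rule countable_open_subcover[OF second_countable, of ?F])
    show "open U" if "U \<in> ?F" for U using that by auto
  qed (rule that)
  have "AE \<xi> in \<nu>. \<xi> \<in> U \<longrightarrow> ?P \<xi> < \<infinity>" if U: "U \<in> \<V>" for U
  proof -
    have [measurable]: "U \<in> sets borel" and fin: "(\<integral>\<^sup>+\<xi>\<in>U. ?P \<xi> \<partial>\<nu>) \<noteq> \<infinity>" using U \<V>(2) by auto
    have "(\<lambda>\<xi>. ?P \<xi> * indicator U \<xi>) \<in> borel_measurable \<nu>" by measurable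
    from nn_integral_PInf_AE[OF this fin] show ?thesis
      by eventually_elim (auto simp: indicator_def less_top)
  qed
  then have "AE \<xi> in \<nu>. \<forall>U\<in>\<V>. \<xi> \<in> U \<longrightarrow> ?P \<xi> < \<infinity>"
    by (simp only: AE_ball_countable[OF \<V>(1)]) blast
  then show ?thesis
  proof eventually_elim
    case (elim \<xi>)
    show ?case
    proof
      assume "\<xi> \<in> T"
      then obtain e where "e > 0" "(\<integral>\<^sup>+\<eta>\<in>mball \<xi> e. ?P \<eta> \<partial>\<nu>) < \<infinity>" using \<Psi> by (auto simp: L1_loc_def)
      then have "\<xi> \<in> \<Union>\<V>" unfolding \<V>(3) by (intro UnionI[of "mball \<xi> e"]) auto
      with elim show "?P \<xi> < \<infinity>" by blast
    qed
  qed
qed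

text \<open>Dominated convergence: a fixed \<open>h\<close> drops out once \<open>m + real n\<close>
  reaches \<open>L h\<close>, and the integrand of \<open>Psi\<close> at level \<open>M\<close> is
  the majorant.\<close>

lemma Psi_tendsto_0:
  assumes "Psi \<sigma> \<alpha> \<delta> L M \<psi>h \<xi> < \<infinity>" and "M \<le> m"
  shows "(\<lambda>n. Psi \<sigma> \<alpha> \<delta> L (m + real n) \<psi>h \<xi>) \<longlonglongrightarrow> 0"
proof -
  have lim: "(\<lambda>n. indicator {h. m + real n < L h} h * (ennreal (\<delta> h) * w h \<xi>)) \<longlonglongrightarrow> 0" for h
  proof -
    obtain k :: nat where "L h - m \<le> real k" using real_arch_simple by blast
    then have "indicator {h. m + real n < L h} h * (ennreal (\<delta> h) * w h \<xi>) = 0" if "k \<le> n" for n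
      using that by (auto simp: indicator_def)
    then show ?thesis by (intro tendsto_eventually) (auto simp: eventually_sequentially)
  qed
  have "(\<lambda>n. \<integral>\<^sup>+h. indicator {h. m + real n < L h} h * (ennreal (\<delta> h) * w h \<xi>) \<partial>\<sigma>) \<longlonglongrightarrow> (\<integral>\<^sup>+h. 0 \<partial>\<sigma>)"
  proof (rule nn_integral_dominated_convergence)
    show "(\<lambda>h. indicator {h. m + real n < L h} h * (ennreal (\<delta> h) * w h \<xi>)) \<in> borel_measurable \<sigma>" for n
      unfolding indicator_def by measurable
    show "(\<lambda>h. indicator {h. M < L h} h * (ennreal (\<delta> h) * w h \<xi>)) \<in> borel_measurable \<sigma>"
      unfolding indicator_def by measurable
    show "(\<integral>\<^sup>+h. indicator {h. M < L h} h * (ennreal (\<delta> h) * w h \<xi>) \<partial>\<sigma>) < \<infinity>"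
      using assms(1) by (simp add: Psi_eq)
    show "AE h in \<sigma>. indicator {h. m + real n < L h} h * (ennreal (\<delta> h) * w h \<xi>) \<le> indicator {h. M < L h} h * (ennreal (\<delta> h) * w h \<xi>)" for n
      using assms(2) by (intro AE_I2 mult_right_mono) (auto simp: indicator_def)
  qed (use lim in auto)
  then show ?thesis by (simp add: Psi_eq)
qed

text \<open>Fatou's lemma along the cutoffs: \<open>L h\<close> is a real number, so every
  \<open>h\<close> is counted eventually.\<close>

lemma calderon_le:
  assumes "\<And>n::nat. (\<integral>\<^sup>+h. indicator {h. L h \<le> m + real n} h * w h \<xi> \<partial>\<sigma>) \<le> b"
  shows "calderon_sum \<sigma> \<alpha> \<psi>h \<xi> \<le> b"
proof -
  have "w h \<xi> \<le> liminf (\<lambda>n. indicator {h. L h \<le> m + real n} h * w h \<xi>)" for h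
  proof -
    obtain k :: nat where "L h - m \<le> real k" using real_arch_simple by blast
    then have "w h \<xi> \<le> indicator {h. L h \<le> m + real n} h * w h \<xi>" if "k \<le> n" for n
      using that by (auto simp: indicator_def)
    then show ?thesis by (intro Liminf_bounded) (auto simp: eventually_sequentially)
  qed
  then have "calderon_sum \<sigma> \<alpha> \<psi>h \<xi> \<le> (\<integral>\<^sup>+h. liminf (\<lambda>n. indicator {h. L h \<le> m + real n} h * w h \<xi>) \<partial>\<sigma>)"
    unfolding calderon_eq by (intro nn_integral_mono)
  also have "\<dots> \<le> liminf (\<lambda>n. \<integral>\<^sup>+h. indicator {h. L h \<le> m + real n} h * w h \<xi> \<partial>\<sigma>)"
    unfolding indicator_def by (intro nn_integral_liminf) measurable
  also have "\<dots> \<le> liminf (\<lambda>n::nat. b)"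
    using assms by (intro Liminf_mono always_eventually allI)
  also have "\<dots> = b" by (simp add: Liminf_const)
  finally show ?thesis .
qed

lemma calderon_bounds:
  assumes N: "N \<in> null_sets \<nu>" and \<Psi>: "Psi \<sigma> \<alpha> \<delta> L M \<psi>h \<in> L1_loc \<nu> d (good - N)"
  shows "AE \<xi> in \<nu>. \<xi> \<in> good \<longrightarrow>
    ennreal A \<le> calderon_sum \<sigma> \<alpha> \<psi>h \<xi> \<and> calderon_sum \<sigma> \<alpha> \<psi>h \<xi> \<le> ennreal B"
proof -
  obtain r M' C where X': "r > 0" "M' > 0" "C > 0"
    "\<And>h. L h > M' \<Longrightarrow> finite (annihilator \<Gamma> \<inter> hat h ` mball 0 r)"
    "\<And>h. L h > M' \<Longrightarrow> real (card (annihilator \<Gamma> \<inter> hat h ` mball 0 r)) \<le> 1 + C * \<delta> h"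
    using X unfolding property_X_def by blast
  \<comment> \<open>The cutoff must lie beyond \<open>M'\<close>, where Property X takes effect, and
    beyond \<open>M\<close>, so that the error is dominated by the given \<open>Psi\<close>.\<close>
  define m where "m = max M M'"
  have cutoff: "AE \<xi> in \<nu>. \<xi> \<in> good \<longrightarrow> (\<integral>\<^sup>+h. indicator {h. L h \<le> m + real n} h * w h \<xi> \<partial>\<sigma>) \<le> ennreal B"
    "AE \<xi> in \<nu>. \<xi> \<in> good - N \<longrightarrow>
      ennreal A \<le> calderon_sum \<sigma> \<alpha> \<psi>h \<xi> + ennreal (2 * C) * Psi \<sigma> \<alpha> \<delta> L (m + real n) \<psi>h \<xi>" for n :: nat
  proof -
    have m': "0 < m + real n" "M \<le> m + real n" "M' \<le> m + real n" using M_pos by (auto simp: m_def)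
    then have XC: "finite (annihilator \<Gamma> \<inter> hat h ` mball 0 r)" "real (card (annihilator \<Gamma> \<inter> hat h ` mball 0 r)) \<le> 1 + C * \<delta> h"
      if "m + real n < L h" for h
      using that X'(4,5)[of h] by auto
    note bounds = calderon_bounds_cutoff[OF X'(1,3) m'(1,2) XC \<Psi>]
    show "AE \<xi> in \<nu>. \<xi> \<in> good \<longrightarrow> (\<integral>\<^sup>+h. indicator {h. L h \<le> m + real n} h * w h \<xi> \<partial>\<sigma>) \<le> ennreal B"
      by (rule bounds(1))
    show "AE \<xi> in \<nu>. \<xi> \<in> good - N \<longrightarrow>
      ennreal A \<le> calderon_sum \<sigma> \<alpha> \<psi>h \<xi> + ennreal (2 * C) * Psi \<sigma> \<alpha> \<delta> L (m + real n) \<psi>h \<xi>"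
      by (rule bounds(2))
  qed
  \<comment> \<open>The cutoffs run through a countable set, so that one null set serves all of them
    and the limit can be taken pointwise.\<close>
  have "AE \<xi> in \<nu>. \<forall>n::nat. \<xi> \<in> good \<longrightarrow> (\<integral>\<^sup>+h. indicator {h. L h \<le> m + real n} h * w h \<xi> \<partial>\<sigma>) \<le> ennreal B"
    unfolding AE_all_countable using cutoff(1) by blast
  moreover have "AE \<xi> in \<nu>. \<forall>n::nat. \<xi> \<in> good - N \<longrightarrow>
      ennreal A \<le> calderon_sum \<sigma> \<alpha> \<psi>h \<xi> + ennreal (2 * C) * Psi \<sigma> \<alpha> \<delta> L (m + real n) \<psi>h \<xi>"
    unfolding AE_all_countable using cutoff(2) by blast
  moreover have "AE \<xi> in \<nu>. \<xi> \<in> good - N \<longrightarrow> Psi \<sigma> \<alpha> \<delta> L M \<psi>h \<xi> < \<infinity>"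
    by (rule AE_Psi_finite[OF \<Psi>])
  moreover have "AE \<xi> in \<nu>. \<xi> \<notin> N" by (rule AE_not_in[OF N])
  ultimately show ?thesis
  proof eventually_elim
    case (elim \<xi>)
    show ?case
    proof
      assume \<xi>: "\<xi> \<in> good"
      have "calderon_sum \<sigma> \<alpha> \<psi>h \<xi> \<le> ennreal B" using elim(1) \<xi> by (intro calderon_le) blast
      moreover have "ennreal A \<le> calderon_sum \<sigma> \<alpha> \<psi>h \<xi> + ennreal (2 * C) * 0"
      proof (rule LIMSEQ_le_const)
        show "(\<lambda>n. calderon_sum \<sigma> \<alpha> \<psi>h \<xi> + ennreal (2 * C) * Psi \<sigma> \<alpha> \<delta> L (m + real n) \<psi>h \<xi>) \<longlonglongrightarrow>
            calderon_sum \<sigma> \<alpha> \<psi>h \<xi> + ennreal (2 * C) * 0"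
          using elim(3,4) \<xi> by (intro tendsto_add tendsto_const ennreal_tendsto_cmult Psi_tendsto_0) (auto simp: m_def)
        show "\<exists>k. \<forall>n\<ge>k. ennreal A \<le> calderon_sum \<sigma> \<alpha> \<psi>h \<xi> + ennreal (2 * C) * Psi \<sigma> \<alpha> \<delta> L (m + real n) \<psi>h \<xi>"
          using elim(2,4) \<xi> by blast
      qed
      ultimately show "ennreal A \<le> calderon_sum \<sigma> \<alpha> \<psi>h \<xi> \<and> calderon_sum \<sigma> \<alpha> \<psi>h \<xi> \<le> ennreal B" by simp
    qed
  qed
qed

end

theorem theorem17:
  fixes \<mu> :: "'g::{topological_ab_group_add, t2_space, second_countable_topology} measure"
    and \<nu> :: "'g dual_group measure"
    and \<Gamma> :: "'g set" and \<mu>\<Gamma> :: "'g measure" and \<kappa> :: "'g set measure"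
    and d :: "'g dual_group \<Rightarrow> 'g dual_group \<Rightarrow> real"
    and \<sigma> :: "'h::topological_space measure"
    and \<alpha> :: "'h \<Rightarrow> 'g \<Rightarrow> 'g" and \<delta> l L :: "'h \<Rightarrow> real"
    and S :: "('g \<Rightarrow> complex) set"
    and \<psi> :: "'g \<Rightarrow> complex" and \<psi>h :: "'g dual_group \<Rightarrow> complex"
    and A B M \<epsilon>\<^sub>0 :: real and N :: "'g dual_group set"
  assumes "locally_compact_space (euclidean :: 'g topology)"
    and "haar_measure euclidean \<mu>"
    and "plancherel_measure \<mu> \<nu>"
    and "closed_subgroup \<Gamma>"
    and "compact_space (coset_topology \<Gamma>)"
    and "haar_measure (top_of_set \<Gamma>) \<mu>\<Gamma>"
    and "haar_measure (coset_topology \<Gamma>) \<kappa>" and "prob_space \<kappa>"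
    and "weil_formula \<mu> \<mu>\<Gamma> \<kappa>"
    and "compatible_metric d"
    and "weakly_doubling \<nu> d"
    and "sets \<sigma> = sets borel" and "sigma_finite_measure \<sigma>"
    and "\<And>h. topological_automorphism (\<alpha> h)"
    and "(\<lambda>(x, h). \<alpha> h x) \<in> \<mu> \<Otimes>\<^sub>M \<sigma> \<rightarrow>\<^sub>M borel"
    and "modulus_function \<mu> \<sigma> \<alpha> \<delta>"
    and "closed_subspace_L2 \<mu> S"
    and "\<psi> \<in> L2 \<mu>"
    and "is_fourier_L2 \<mu> \<nu> \<psi> \<psi>h"
    and "0 < A" and "A \<le> B"
    and "affine_frame \<mu> \<Gamma> \<mu>\<Gamma> \<sigma> \<alpha> \<delta> S \<psi> A B"
    and "measurably_bi_lipschitz d \<sigma> \<alpha> l L"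
    and "property_X d \<alpha> \<delta> L (annihilator \<Gamma>)"
    and "0 < M" and "0 < \<epsilon>\<^sub>0"
    and "N \<in> null_sets \<nu>"
    and "0 < emeasure \<nu> (good_set \<mu> \<nu> d S \<epsilon>\<^sub>0)"
    and "Psi \<sigma> \<alpha> \<delta> L M \<psi>h \<in> L1_loc \<nu> d (good_set \<mu> \<nu> d S \<epsilon>\<^sub>0 - N)"
  shows "AE \<xi> in \<nu>. \<xi> \<in> good_set \<mu> \<nu> d S \<epsilon>\<^sub>0 \<longrightarrow>
           ennreal A \<le> calderon_sum \<sigma> \<alpha> \<psi>h \<xi> \<and> calderon_sum \<sigma> \<alpha> \<psi>h \<xi> \<le> ennreal B"
proof -
  \<comment> \<open>The one locale assumption that is not literally a hypothesis: being a Haar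
    measure is part of \<open>plancherel_measure\<close>.\<close>
  have haar: "haar_measure euclidean \<nu>" using assms(3) by (simp add: plancherel_measure_def)
  interpret affine_setting d \<nu> \<mu> \<Gamma> \<mu>\<Gamma> \<kappa> \<sigma> \<alpha> \<delta> l L S \<psi> \<psi>h A B M \<epsilon>\<^sub>0
    by (intro affine_setting.intro affine_setting_axioms.intro lca_lattice.intro lca_lattice_axioms.intro
      lca_plancherel.intro lca_plancherel_axioms.intro haar_metric_group.intro haar_metric_group_axioms.intro
      proper_metric_group.intro) (rule assms haar)+
  show ?thesis by (rule calderon_bounds) (rule assms)+
qed

end
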